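(* Let $k$ be a field of characteristic $p\ge0$, let $0\le \ell<n$ be integers, let $P(z)$ be an admissible Hilbert polynomial for homogeneous ideals of $S^{(\ell,n)}=k[x_\ell,\dots,x_n]$, and let $s$ be a positive integer that is an upper bound for the Gotzmann number of $P(z)$. Then the algorithm $\mathrm{Borel}(\ell,n,P(z),s,p)$ returns the set of all saturated $p$-Borel ideals of $S^{(\ell,n)}$ having Hilbert polynomial $P(z)$.
   Context: Ring and terms. $S^{(\ell,n)}=k[x_\ell,\dots,x_n]$ is standard graded, with variables ordered $x_\ell<\cdots<x_n$. A term is a power product $x^\alpha=x_\ell^{\alpha_\ell}\cdots x_n^{\alpha_n}$; $\mathbb T(\ell)$ is the set of terms in $x_\ell,\dots,x_n$. For a term $x^\alpha\ne 1$, $\min(x^\alpha)$ is the smallest variable dividing $x^\alpha$. For a homogeneous ideal $I$, $I_t$ is its degree-$t$ component and $I_{\ge t}=\bigoplus_{i\ge t}I_i$. Hilbert polynomial. The Hilbert polynomial of a homogeneous ideal $I\subseteq S^{(\ell,n)}$ is the polynomial $P(z)$ with $\dim_k(S^{(\ell,n)}_t/I_t)=P(t)$ for all $t\gg0$. $P(z)$ is admissible if it is the Hilbert polynomial of some homogeneous ideal of the ring. $\Delta P(z)=P(z)-P(z-1)$. The Gotzmann number of an admissible $P(z)$ is the integer $r$ in the unique expression $P(z)=\binom{z+a_1}{a_1}+\binom{z+a_2-1}{a_2}+\cdots+\binom{z+a_r-(r-1)}{a_r}$ with $a_1\ge a_2\ge\cdots\ge a_r\ge 0$ ($r=0$ if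 $P=0$). Saturation. $I^{\mathrm{sat}}=(I:(x_\ell,\dots,x_n)^\infty)$; $I$ is saturated if $I=I^{\mathrm{sat}}$. Borel-fixed. A matrix $g=(g_{ij})_{0\le i,j\le n-\ell}\in\mathrm{GL}(n-\ell+1,k)$ acts on $S^{(\ell,n)}$ as the $k$-algebra automorphism $x_{\ell+i}\mapsto\sum_j g_{ij}x_{\ell+j}$. A homogeneous ideal $I$ is Borel-fixed if $g(I)=I$ for every upper triangular $g\in\mathrm{GL}(n-\ell+1,k)$. An ideal is $p$-Borel if it is Borel-fixed in $S^{(\ell,n)}$, with $\mathrm{char}(k)=p$. Order $<_p$. For natural numbers $a,b$: if $p$ is prime, $a\prec_p b$ means $\binom ba\not\equiv0 \bmod p$; $a\prec_0 b$ means $a\le b$. For $i<j$ and $t>0$, the increasing move $e^{+(t)}_{i,j}(x^\alpha)=x_j^tx^\alpha/x_i^t$ is $p$-admissible on $x^\alpha$ if the result is a term and $t\prec_p\alpha_i$. The relation $<_p$ on terms is the transitive closure of: $x^\alpha<_px^\beta$ if $x^\beta=e^{+(t)}_{i,j}(x^\alpha)$ for some $p$-admissible increasing move. A term $x^\alpha$ in a $p$-Borel ideal $J$ is $p$-minimal if no other term of $J$ is smaller than $x^\alpha$ with respect to $<_p$. St-minimal. A monomial ideal $H$ is stable if for every term $x^\gamma\neq 1$ in $H$ and every $x_j>\min(x^\gamma)$ one has $x_jx^\gamma/\min(x^\gamma)\in H$. For a stable monomial ideal $H$, a term $x^\alpha\in H$ is St-minimal for $H$ if $x_jx^\beta/\min(x^\beta)\ne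 x^\alpha$ for every term $x^\beta\in H$ and every $x_j>\min(x^\beta)$. Auxiliary procedure $p\text{-}\mathrm{Remove}(p,I,\ell,n,s,q)$, for a $p$-Borel ideal $I\subseteq S^{(\ell,n)}$ (given by a set of generating monomials), an upper bound $s$ on the regularity of $I$, and $q\ge0$: (1) if $q=0$, return $\{I^{\mathrm{sat}}\}$; (2) if $q>0$, let $M$ be the set of terms $x^\alpha\in I_s$ with $\min(x^\alpha)=x_\ell$ that are both $p$-minimal and St-minimal for $I_{\ge s}$, and return $\bigcup_{x^\alpha\in M}p\text{-}\mathrm{Remove}(p,I^{(\alpha)},\ell,n,s,q-1)$, where $I^{(\alpha)}$ is the ideal generated by $(I_s\cap\mathbb T(\ell))\setminus\{x^\alpha\}$. (The regularity of $I$ is the smallest $m$ with $m\ge a_{ij}-i$ for all $i,j$, where $E_i=\bigoplus_jS^{(\ell,n)}(-a_{ij})$ are the modules of the graded minimal free resolution $0\to E_n\to\cdots\to E_0\to I\to0$.) Algorithm $\mathrm{Borel}(\ell,n,P(z),s,p)$: (1) if $P(z)=0$, return $\{(1)\}$; (2) otherwise set $E:=\mathrm{Borel}(\ell+1,n,\Delta P(z),s,p)$ (a set of ideals of $S^{(\ell+1,n)}$) and $F:=\emptyset$; for each $J\in E$ let $I:=J\cdot k[x_\ell,\dots,x_n]$ and $q:=P(s)-\binom{n-\ell+s}{s}+\dim_k I_s$, and if $q\ge0$ replace $F$ by $F\cup p\text{-}\mathrm{Remove}(p,I,\ell,n,s,q)$; finally return $F$. In recursive calls the first index may exceed $n-1$;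 one sets $S^{(n,n)}=k[x_n]$ and $S^{(n+1,n)}=k$.
   Formalization: Over a finite field k, p-Borel ideals are also required to be monomial, since otherwise the claim fails: (x_0^2+x_0x_1) in F_2[x_0,x_1] is saturated and Borel-fixed with Hilbert polynomial 2 but not monomial; for infinite k nothing changes. *)

theory Defs
  imports
    "HOL-Library.Poly_Mapping"
    "HOL-Computational_Algebra.Polynomial"
    "HOL-Algebra.Ideal_Product"
    "Jordan_Normal_Form.Matrix"
begin

section \<open>The rings $k[x_\ell,\dots,x_n]$\<close>

text \<open>
  Terms are exponent vectors with finite support, and the polynomials of all the rings
  $k[x_\ell,\dots,x_n]$ live in one type with variables $x_0, x_1, \dots$; the rings are
  distinguished by their carriers.  For $\ell = n + 1$ the carrier consists of the constants.
\<close>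

type_synonym pterm = "nat \<Rightarrow>\<^sub>0 nat"
type_synonym 'k mpol = "pterm \<Rightarrow>\<^sub>0 'k"

definition terms_of :: "nat \<Rightarrow> nat \<Rightarrow> pterm set" where
  "terms_of l n = {\<alpha>. Poly_Mapping.keys \<alpha> \<subseteq> {l..n}}"

definition tdeg :: "pterm \<Rightarrow> nat" where
  "tdeg \<alpha> = (\<Sum>i\<in>Poly_Mapping.keys \<alpha>. Poly_Mapping.lookup \<alpha> i)"

definition tmin :: "pterm \<Rightarrow> nat" where
  "tmin \<alpha> = Min (Poly_Mapping.keys \<alpha>)"

abbreviation mono_of :: "pterm \<Rightarrow> 'k::field mpol" where
  "mono_of \<alpha> \<equiv> Poly_Mapping.single \<alpha> 1"

abbreviation xvar :: "nat \<Rightarrow> 'k::field mpol" where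
  "xvar i \<equiv> mono_of (Poly_Mapping.single i 1)"

definition scal :: "'k::field \<Rightarrow> 'k mpol \<Rightarrow> 'k mpol" where
  "scal c f = Poly_Mapping.single 0 c * f"

global_interpretation mpol: vector_space "scal :: 'k::field \<Rightarrow> 'k mpol \<Rightarrow> 'k mpol"
  defines mpol_span = mpol.span and mpol_dim = mpol.dim
  by unfold_locales
    (simp_all add: scal_def algebra_simps single_add mult_single flip: mult.assoc)

definition polyring :: "nat \<Rightarrow> nat \<Rightarrow> 'k::field mpol ring" where
  "polyring l n = \<lparr>carrier = {f. Poly_Mapping.keys f \<subseteq> terms_of l n},
     monoid.mult = (*), one = 1, ring.zero = 0, add = (+)\<rparr>"


section \<open>Homogeneous ideals, Hilbert polynomials, saturation\<close>

definition component :: "'k::field mpol set \<Rightarrow> nat \<Rightarrow> 'k mpol set" where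
  "component I t = {f \<in> I. \<forall>\<alpha>\<in>Poly_Mapping.keys f. tdeg \<alpha> = t}"

definition truncation :: "'k::field mpol set \<Rightarrow> nat \<Rightarrow> 'k mpol set" where
  "truncation I t = mpol_span (\<Union>i\<in>{t..}. component I i)"

definition homogeneous_ideal :: "nat \<Rightarrow> nat \<Rightarrow> 'k::field mpol set \<Rightarrow> bool" where
  "homogeneous_ideal l n I \<longleftrightarrow>
     ideal I (polyring l n) \<and> I = mpol_span (\<Union>t. component I t)"

text \<open>
  The dimension of the quotient space $V/W$: the number of elements of a (finite) set
  $B \subseteq V$ whose classes form a basis, i.e. such that every class in $V/W$ is a
  linear combination of the classes of the elements of $B$ with unique coefficients.
\<close>

definition quotient_dim :: "'k::field mpol set \<Rightarrow> 'k mpol set \<Rightarrow> nat" where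
  "quotient_dim V W = (THE d. \<exists>B. finite B \<and> card B = d \<and> B \<subseteq> V \<and>
     (\<forall>v\<in>V. \<exists>!c. (\<forall>b. b \<notin> B \<longrightarrow> c b = 0) \<and> v - (\<Sum>b\<in>B. scal (c b) b) \<in> W))"

definition hilbert_polynomial :: "nat \<Rightarrow> nat \<Rightarrow> 'k::field mpol set \<Rightarrow> rat poly \<Rightarrow> bool" where
  "hilbert_polynomial l n I P \<longleftrightarrow>
     (\<forall>\<^sub>F t in sequentially.
        of_nat (quotient_dim (component (carrier (polyring l n)) t) (component I t))
          = poly P (of_nat t))"

definition admissible :: "'k::field itself \<Rightarrow> nat \<Rightarrow> nat \<Rightarrow> rat poly \<Rightarrow> bool" where
  "admissible _ l n P \<longleftrightarrow>
     (\<exists>I :: 'k mpol set. homogeneous_ideal l n I \<and> hilbert_polynomial l n I P)"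

definition backward_diff :: "rat poly \<Rightarrow> rat poly" where
  "backward_diff P = P - pcompose P [:-1, 1:]"

text \<open>The indices of \<^term>\<open>as\<close> start at \<open>0\<close>, so \<open>as ! i\<close> is $a_{i+1}$.\<close>

definition is_gotzmann_number :: "rat poly \<Rightarrow> nat \<Rightarrow> bool" where
  "is_gotzmann_number P r \<longleftrightarrow>
     (\<exists>as :: nat list. length as = r \<and> sorted_wrt (\<ge>) as \<and>
        (\<forall>z. poly P z = (\<Sum>i<r. (z + of_nat (as ! i) - of_nat i) gchoose (as ! i))))"

definition irrelevant_power :: "nat \<Rightarrow> nat \<Rightarrow> nat \<Rightarrow> 'k::field mpol set" where
  "irrelevant_power l n N =
     (ideal_prod (polyring l n) (genideal (polyring l n) (xvar ` {l..n})) ^^ N)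
       (carrier (polyring l n))"

definition saturation :: "nat \<Rightarrow> nat \<Rightarrow> 'k::field mpol set \<Rightarrow> 'k mpol set" where
  "saturation l n I =
     {f \<in> carrier (polyring l n). \<exists>N. \<forall>g\<in>irrelevant_power l n N. f * g \<in> I}"

definition saturated :: "nat \<Rightarrow> nat \<Rightarrow> 'k::field mpol set \<Rightarrow> bool" where
  "saturated l n I \<longleftrightarrow> I = saturation l n I"


section \<open>Borel-fixed ideals\<close>

definition linear_action :: "nat \<Rightarrow> 'k::field mat \<Rightarrow> 'k mpol \<Rightarrow> 'k mpol" where
  "linear_action l g f =
     (\<Sum>\<alpha>\<in>Poly_Mapping.keys f. scal (Poly_Mapping.lookup f \<alpha>)
        (\<Prod>i\<in>Poly_Mapping.keys \<alpha>. (\<Sum>j<dim_col g. scal (g $$ (i - l, j)) (xvar (l + j))) ^ Poly_Mapping.lookup \<alpha> i))"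

definition borel_fixed :: "nat \<Rightarrow> nat \<Rightarrow> 'k::field mpol set \<Rightarrow> bool" where
  "borel_fixed l n I \<longleftrightarrow> homogeneous_ideal l n I \<and>
     (\<forall>g \<in> carrier_mat (Suc n - l) (Suc n - l).
        invertible_mat g \<and> upper_triangular g \<longrightarrow> linear_action l g ` I = I)"

definition monomial_ideal :: "nat \<Rightarrow> nat \<Rightarrow> 'k::field mpol set \<Rightarrow> bool" where
  "monomial_ideal l n I \<longleftrightarrow> (\<exists>A \<subseteq> terms_of l n. I = genideal (polyring l n) (mono_of ` A))"

text \<open>
  Over an infinite field the upper triangular matrices include enough diagonal ones to force
  every Borel-fixed ideal to be monomial.  Over a finite field this fails: the saturated ideal
  $(x_0^2 + x_0 x_1)$ of $\mathbf F_2[x_0,x_1]$ is fixed by both upper triangular matrices.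
  Since $p$-Borel ideals are handled throughout by their terms, being monomial is made
  explicit for finite fields; for infinite fields the last conjunct is void.
\<close>

definition p_Borel :: "nat \<Rightarrow> nat \<Rightarrow> nat \<Rightarrow> 'k::field mpol set \<Rightarrow> bool" where
  "p_Borel p l n I \<longleftrightarrow> CHAR('k) = p \<and> borel_fixed l n I \<and>
     (finite (UNIV :: 'k set) \<longrightarrow> monomial_ideal l n I)"


section \<open>$p$-minimal and St-minimal terms\<close>

definition prec_p :: "nat \<Rightarrow> nat \<Rightarrow> nat \<Rightarrow> bool" where
  "prec_p p a b \<longleftrightarrow> (if p = 0 then a \<le> b else \<not> p dvd (b choose a))"

definition increasing_move :: "nat \<Rightarrow> nat \<Rightarrow> nat \<Rightarrow> pterm \<Rightarrow> pterm" where
  "increasing_move i j t \<alpha> = \<alpha> - Poly_Mapping.single i t + Poly_Mapping.single j t"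

definition admissible_step :: "nat \<Rightarrow> nat \<Rightarrow> nat \<Rightarrow> pterm \<Rightarrow> pterm \<Rightarrow> bool" where
  "admissible_step p l n \<alpha> \<beta> \<longleftrightarrow>
     (\<exists>i j t. l \<le> i \<and> i < j \<and> j \<le> n \<and> 0 < t \<and> t \<le> Poly_Mapping.lookup \<alpha> i \<and> prec_p p t (Poly_Mapping.lookup \<alpha> i) \<and>
        \<beta> = increasing_move i j t \<alpha>)"

definition less_p :: "nat \<Rightarrow> nat \<Rightarrow> nat \<Rightarrow> pterm \<Rightarrow> pterm \<Rightarrow> bool" where
  "less_p p l n = (admissible_step p l n)\<^sup>+\<^sup>+"

definition p_minimal ::
  "nat \<Rightarrow> nat \<Rightarrow> nat \<Rightarrow> 'k::field mpol set \<Rightarrow> pterm \<Rightarrow> bool" where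
  "p_minimal p l n J \<alpha> \<longleftrightarrow> mono_of \<alpha> \<in> J \<and>
     \<not> (\<exists>\<beta>. \<beta> \<noteq> \<alpha> \<and> mono_of \<beta> \<in> J \<and> less_p p l n \<beta> \<alpha>)"

definition St_minimal :: "nat \<Rightarrow> 'k::field mpol set \<Rightarrow> pterm \<Rightarrow> bool" where
  "St_minimal n H \<alpha> \<longleftrightarrow> mono_of \<alpha> \<in> H \<and>
     (\<forall>\<beta> j. mono_of \<beta> \<in> H \<and> \<beta> \<noteq> 0 \<and> tmin \<beta> < j \<and> j \<le> n \<longrightarrow>
        \<beta> - Poly_Mapping.single (tmin \<beta>) 1 + Poly_Mapping.single j 1 \<noteq> \<alpha>)"


section \<open>The algorithm\<close>

definition removable_terms ::
  "nat \<Rightarrow> 'k::field mpol set \<Rightarrow> nat \<Rightarrow> nat \<Rightarrow> nat \<Rightarrow> pterm set" where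
  "removable_terms p I l n s =
     {\<alpha> \<in> terms_of l n. mono_of \<alpha> \<in> component I s \<and> \<alpha> \<noteq> 0 \<and> tmin \<alpha> = l \<and>
        p_minimal p l n (truncation I s) \<alpha> \<and> St_minimal n (truncation I s) \<alpha>}"

definition remove_term ::
  "'k::field mpol set \<Rightarrow> nat \<Rightarrow> nat \<Rightarrow> nat \<Rightarrow> pterm \<Rightarrow> 'k mpol set" where
  "remove_term I l n s \<alpha> =
     genideal (polyring l n)
       (mono_of ` ({\<beta> \<in> terms_of l n. mono_of \<beta> \<in> component I s} - {\<alpha>}))"

fun p_Remove ::
  "nat \<Rightarrow> 'k::field mpol set \<Rightarrow> nat \<Rightarrow> nat \<Rightarrow> nat \<Rightarrow> nat \<Rightarrow> 'k mpol set set" where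
  "p_Remove p I l n s 0 = {saturation l n I}"
| "p_Remove p I l n s (Suc q) =
     (\<Union>\<alpha>\<in>removable_terms p I l n s. p_Remove p (remove_term I l n s \<alpha>) l n s q)"

lemma degree_backward_diff_less:
  assumes "P \<noteq> 0" "backward_diff P \<noteq> 0"
  shows "degree (backward_diff P) < degree P"
proof -
  have deg: "degree (pcompose P [:-1, 1:]) = degree P"
    by (simp add: degree_pcompose)
  have lc: "coeff (pcompose P [:-1, 1:]) (degree P) = lead_coeff P"
    using lead_coeff_comp[of "[:-1, 1:]" P] deg by simp
  have "coeff (backward_diff P) (degree P) = 0"
    by (simp add: backward_diff_def lc)
  moreover have "degree (backward_diff P) \<le> degree P"
    unfolding backward_diff_def by (rule degree_diff_le) (simp_all add: deg)
  ultimately show ?thesis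
    using assms(2) by (metis leading_coeff_0_iff le_neq_implies_less)
qed

text \<open>
  For $\ell \le n + 1$ and $s > 0$ the number \<open>(n + s - l) choose s\<close> is
  $\binom{n-\ell+s}{s} = \dim_k S^{(\ell,n)}_s$ (including the value $0$ for $\ell = n+1$, where
  \<open>n - l\<close> would be truncated).  The rational number \<open>q\<close> is an integer
  whenever \<open>P\<close> is admissible, so that taking its floor only converts its type.
\<close>

function Borel ::
  "nat \<Rightarrow> nat \<Rightarrow> rat poly \<Rightarrow> nat \<Rightarrow> nat \<Rightarrow> 'k::field mpol set set" where
  "Borel l n P s p =
     (if P = 0 then {genideal (polyring l n) {1}}
      else (\<Union>J \<in> Borel (Suc l) n (backward_diff P) s p.
        let I = genideal (polyring l n) J;
            q = poly P (of_nat s) - of_nat ((n + s - l) choose s)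
                  + of_nat (mpol_dim (component I s))
        in if q \<ge> 0 then p_Remove p I l n s (nat \<lfloor>q\<rfloor>) else {}))"
  by pat_completeness auto
termination
  by (relation "measure (\<lambda>(l, n, P, s, p). if P = 0 then 0 else Suc (degree P))")
    (auto dest: degree_backward_diff_less)

declare Borel.simps [simp del]

end

theory Submission
  imports Defs "Jordan_Normal_Form.Determinant"
begin

text \<open>
  A $p$-Borel ideal is given by a set of terms closed under multiplication and under admissible
  increasing moves, and everything is done with such sets.

  Moving the whole exponent of the smallest variable $x_\ell$ is always admissible, so
  saturating means setting $x_\ell = 1$.  Hence a saturated $p$-Borel ideal $I$ is determined by
  its restriction $J'$ to $x_{\ell+1},\dots,x_n$, the Hilbert function of $I$ is the summatory
  function of that of $J'$, and $J'$ has finite colength in its saturation $J$, a saturated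
  $p$-Borel ideal with Hilbert polynomial $\Delta P$.  Induction on the number of variables
  gives Gotzmann's theorem for these ideals: from the Gotzmann number on, the Hilbert function
  is the Hilbert polynomial and the ideal is stable and generated in that degree.  Therefore
  $I_s \subseteq (J S)_s$ differ by exactly $q$ terms, all of them divisible by $x_\ell$.

  If an ideal is stable and generated from degree $s$ on, removing a term that is minimal for
  both orders lowers the dimension by one in every degree $\ge s$ and preserves stability and
  closure under moves; so every output has the right Hilbert polynomial.  Conversely the $q$
  terms of $(J S)_s \setminus I_s$ can be removed in order of increasing weight $\sum_i i\alpha_i$.
\<close>

\<comment> \<open>The obstacle is that in characteristic p > 0 a p-Borel ideal need not be stable:
  (x_0^p, x_1^p) in k[x_0, x_1] is fixed but lacks x_0^(p-1) x_1. Regularity therefore cannot be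
  read off the generators. No free resolution is used; two combinatorial conditions on the degrees
  from s on (\<open>stably_generated\<close>) take the place of regularity, and they have to be
  extracted from the Hilbert polynomial alone. What makes this elementary is that the excess of a
  Hilbert function over its Gotzmann sum, once zero, stays zero: every degree before that uses up at
  least one unit of it, and each unit is one entry 0 of the Gotzmann representation one variable
  further down. One s serves all recursive calls because a difference of P lowers the positive
  entries of the representation and deletes the zeros, so the Gotzmann number does not grow. On the
  side of polynomials, elementary and diagonal matrices show that fixed ideals are monomial (over
  infinite fields) and closed under moves; conversely, on a set closed under moves every upper
  triangular matrix acts triangularly with respect to weight, hence bijectively.\<close>
alias lookup = Poly_Mapping.lookup
alias single = Poly_Mapping.single
alias keys = Poly_Mapping.keys

section \<open>Terms\<close>

lemma terms_of_iff: "\<alpha> \<in> terms_of l n \<longleftrightarrow> (\<forall>i. lookup \<alpha> i \<noteq> 0 \<longrightarrow> l \<le> i \<and> i \<le> n)"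
  by (simp add: terms_of_def subset_iff in_keys_iff)

lemma zero_in_terms_of [simp]: "0 \<in> terms_of l n"
  by (simp add: terms_of_iff)

lemma single_in_terms_of: "l \<le> i \<Longrightarrow> i \<le> n \<Longrightarrow> single i m \<in> terms_of l n"
  by (auto simp: terms_of_iff lookup_single when_def)

lemma add_in_terms_of: "\<alpha> \<in> terms_of l n \<Longrightarrow> \<beta> \<in> terms_of l n \<Longrightarrow> \<alpha> + \<beta> \<in> terms_of l n"
  by (auto simp: terms_of_iff lookup_add)

lemma add_in_terms_of_iff:
  "\<alpha> + \<beta> \<in> terms_of l n \<longleftrightarrow> \<alpha> \<in> terms_of l n \<and> \<beta> \<in> terms_of l n"
  by (auto simp: terms_of_iff lookup_add)

lemma minus_in_terms_of: "\<alpha> \<in> terms_of l n \<Longrightarrow> \<alpha> - \<beta> \<in> terms_of l n"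
  by (auto simp: terms_of_iff lookup_minus)

lemma terms_of_Suc_subset: "terms_of (Suc l) n \<subseteq> terms_of l n"
  unfolding terms_of_def by auto

lemma terms_of_trivial: "n < l \<Longrightarrow> terms_of l n = {0}"
  by (auto simp: terms_of_def)

lemma pterm_diff_add: "m \<le> lookup \<alpha> i \<Longrightarrow>
    \<alpha> - single i m + single i m = (\<alpha> :: pterm)"
  by (rule poly_mapping_eqI) (auto simp: lookup_add lookup_minus lookup_single when_def)

lemma pterm_add_diff: "\<alpha> + \<beta> - \<beta> = (\<alpha> :: pterm)"
  by simp

lemma tdeg_superset: "finite S \<Longrightarrow> keys \<alpha> \<subseteq> S \<Longrightarrow>
    tdeg \<alpha> = (\<Sum>i\<in>S. lookup \<alpha> i)"
  unfolding tdeg_def by (rule sum.mono_neutral_left) (auto simp: in_keys_iff)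

lemma tdeg_add: "tdeg (\<alpha> + \<beta>) = tdeg \<alpha> + tdeg \<beta>"
proof -
  let ?S = "keys \<alpha> \<union> keys \<beta>"
  have "tdeg (\<alpha> + \<beta>) = (\<Sum>i\<in>?S. lookup (\<alpha> + \<beta>) i)"
    by (rule tdeg_superset) (auto dest: set_mp[OF Poly_Mapping.keys_add])
  also have "\<dots> = tdeg \<alpha> + tdeg \<beta>"
    using tdeg_superset[of ?S \<alpha>] tdeg_superset[of ?S \<beta>] by (simp add: lookup_add sum.distrib)
  finally show ?thesis .
qed

lemma tdeg_single [simp]: "tdeg (single i m) = m"
  by (simp add: tdeg_def)

lemma tdeg_zero [simp]: "tdeg 0 = 0"
  by (simp add: tdeg_def)

lemma tdeg_eq_0_iff [simp]: "tdeg \<alpha> = 0 \<longleftrightarrow> \<alpha> = 0"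
  by (auto simp: tdeg_def in_keys_iff intro!: poly_mapping_eqI)

lemma lookup_le_tdeg: "lookup \<alpha> i \<le> tdeg \<alpha>"
  by (cases "i \<in> keys \<alpha>") (auto simp: tdeg_def in_keys_iff intro: member_le_sum)

lemma tdeg_move: "t \<le> lookup \<alpha> i \<Longrightarrow> tdeg (increasing_move i j t \<alpha>) = tdeg \<alpha>"
  using arg_cong[OF pterm_diff_add[of t \<alpha> i], of tdeg] by (simp add: increasing_move_def tdeg_add)

lemma move_in_terms_of: "\<alpha> \<in> terms_of l n \<Longrightarrow> l \<le> j \<Longrightarrow> j \<le> n \<Longrightarrow> increasing_move i j t \<alpha> \<in> terms_of l n"
  by (auto simp: increasing_move_def intro: add_in_terms_of minus_in_terms_of single_in_terms_of)

lemma tmin_le: "lookup \<alpha> i \<noteq> 0 \<Longrightarrow> tmin \<alpha> \<le> i"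
  by (simp add: tmin_def in_keys_iff)

lemma lookup_tmin: "\<alpha> \<noteq> 0 \<Longrightarrow> lookup \<alpha> (tmin \<alpha>) \<noteq> 0"
  using Min_in[of "keys \<alpha>"] by (simp add: tmin_def in_keys_iff)

lemma tmin_eqI: "lookup \<alpha> i \<noteq> 0 \<Longrightarrow> (\<And>j. j < i \<Longrightarrow> lookup \<alpha> j = 0) \<Longrightarrow> tmin \<alpha> = i"
  using tmin_le[of \<alpha> i] lookup_tmin[of \<alpha>] by (cases "\<alpha> = 0") (auto simp: le_less)

lemma tmin_eq_bottom: "\<alpha> \<in> terms_of l n \<Longrightarrow> lookup \<alpha> l \<noteq> 0 \<Longrightarrow> tmin \<alpha> = l"
  by (rule tmin_eqI) (auto simp: terms_of_iff)

lemma tmin_bounds: "\<alpha> \<in> terms_of l n \<Longrightarrow> \<alpha> \<noteq> 0 \<Longrightarrow> l \<le> tmin \<alpha> \<and> tmin \<alpha> \<le> n"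
  using lookup_tmin by (auto simp: terms_of_iff)

text \<open>A potential for increasing moves: they fix the degree and raise the weight, and in a
  fixed degree the weight is bounded. This makes moves acyclic and supports induction in both
  directions.\<close>

definition weight :: "pterm \<Rightarrow> nat" where
  "weight \<alpha> = (\<Sum>i\<in>keys \<alpha>. i * lookup \<alpha> i)"

lemma weight_superset: "finite S \<Longrightarrow> keys \<alpha> \<subseteq> S \<Longrightarrow>
    weight \<alpha> = (\<Sum>i\<in>S. i * lookup \<alpha> i)"
  unfolding weight_def by (rule sum.mono_neutral_left) (auto simp: in_keys_iff)

lemma weight_add: "weight (\<alpha> + \<beta>) = weight \<alpha> + weight \<beta>"
proof -
  let ?S = "keys \<alpha> \<union> keys \<beta>"
  have "weight (\<alpha> + \<beta>) = (\<Sum>i\<in>?S. i * lookup (\<alpha> + \<beta>) i)"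
    by (rule weight_superset) (auto dest: set_mp[OF Poly_Mapping.keys_add])
  also have "\<dots> = weight \<alpha> + weight \<beta>"
    using weight_superset[of ?S \<alpha>] weight_superset[of ?S \<beta>]
    by (simp add: lookup_add sum.distrib algebra_simps)
  finally show ?thesis .
qed

lemma weight_single [simp]: "weight (single i m) = i * m"
  by (simp add: weight_def)

lemma weight_move:
  assumes "t \<le> lookup \<alpha> i" "i < j" "0 < t"
  shows "weight \<alpha> < weight (increasing_move i j t \<alpha>)"
proof -
  have "i * t < j * t"
    using assms(2,3) by simp
  then show ?thesis
    using arg_cong[OF pterm_diff_add[OF assms(1)], of weight]
    unfolding increasing_move_def weight_add weight_single by linarith
qed

lemma weight_le: "\<alpha> \<in> terms_of l n \<Longrightarrow> weight \<alpha> \<le> n * tdeg \<alpha>"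
  unfolding weight_def tdeg_def sum_distrib_left
  by (rule sum_mono) (auto simp: terms_of_def)

lemma finite_terms_of_degree: "finite {\<alpha> \<in> terms_of l n. tdeg \<alpha> = t}"
proof -
  have "finite (lookup ` {\<alpha> \<in> terms_of l n. tdeg \<alpha> = t})"
  proof (rule finite_subset)
    show "lookup ` {\<alpha> \<in> terms_of l n. tdeg \<alpha> = t}
        \<subseteq> {f. \<forall>i. (i \<in> {l..n} \<longrightarrow> f i \<in> {..t}) \<and> (i \<notin> {l..n} \<longrightarrow> f i = 0)}"
      by (auto simp: terms_of_iff intro: lookup_le_tdeg)
    show "finite {f. \<forall>i. (i \<in> {l..n} \<longrightarrow> f i \<in> {..t}) \<and> (i \<notin> {l..n} \<longrightarrow> f i = (0::nat))}"
      by (rule finite_set_of_finite_funs) auto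
  qed
  then show ?thesis
    by (rule finite_imageD) (auto simp: inj_on_def intro: poly_mapping_eqI)
qed

lemma ex_factor: "0 < tdeg \<alpha> \<Longrightarrow> \<exists>i. lookup \<alpha> i \<noteq> 0"
  using lookup_tmin[of \<alpha>] by (cases "\<alpha> = 0") auto


section \<open>Monomial ideals as sets of terms\<close>

definition term_ideal :: "nat \<Rightarrow> nat \<Rightarrow> pterm set \<Rightarrow> bool" where
  "term_ideal l n A \<longleftrightarrow> A \<subseteq> terms_of l n \<and> (\<forall>\<alpha>\<in>A. \<forall>\<beta>\<in>terms_of l n. \<alpha> + \<beta> \<in> A)"

definition move_closed :: "nat \<Rightarrow> nat \<Rightarrow> nat \<Rightarrow> pterm set \<Rightarrow> bool" where
  "move_closed p l n A \<longleftrightarrow> (\<forall>\<alpha>\<in>A. \<forall>\<beta>. admissible_step p l n \<alpha> \<beta> \<longrightarrow> \<beta> \<in> A)"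

text \<open>The terms of degree exactly m generate the m-th power of the irrelevant ideal, so
  testing one degree is enough. Without variables no term has degree 1, and everything saturates to
  the whole ring.\<close>

definition term_sat :: "nat \<Rightarrow> nat \<Rightarrow> pterm set \<Rightarrow> pterm set" where
  "term_sat l n A =
     {\<alpha> \<in> terms_of l n. \<exists>m. \<forall>\<beta>\<in>terms_of l n. tdeg \<beta> = m \<longrightarrow> \<alpha> + \<beta> \<in> A}"

definition term_span :: "nat \<Rightarrow> nat \<Rightarrow> pterm set \<Rightarrow> pterm set" where
  "term_span l n B = {\<beta> + \<gamma> |\<beta> \<gamma>. \<beta> \<in> B \<and> \<gamma> \<in> terms_of l n}"

definition drop_var :: "nat \<Rightarrow> pterm \<Rightarrow> pterm" where
  "drop_var l \<alpha> = \<alpha> - single l (lookup \<alpha> l)"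

definition term_slice :: "nat \<Rightarrow> pterm set \<Rightarrow> pterm set" where
  "term_slice l A = {\<alpha> \<in> A. lookup \<alpha> l = 0}"

text \<open>The extension of an ideal of k[x_(l+1), ..., x_n] to k[x_l, ..., x_n], as
  \<open>term_span_Suc_eq_ext\<close> confirms; testing the part free of x_l avoids choosing a
  factorization.\<close>

definition term_ext :: "nat \<Rightarrow> nat \<Rightarrow> pterm set \<Rightarrow> pterm set" where
  "term_ext l n B = {\<alpha> \<in> terms_of l n. drop_var l \<alpha> \<in> B}"

lemma term_idealD: "term_ideal l n A \<Longrightarrow> \<alpha> \<in> A \<Longrightarrow> \<beta> \<in> terms_of l n \<Longrightarrow> \<alpha> + \<beta> \<in> A"
  by (simp add: term_ideal_def)

lemma term_ideal_subset: "term_ideal l n A \<Longrightarrow> A \<subseteq> terms_of l n"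
  by (simp add: term_ideal_def)

lemma term_idealD_le:
  assumes "term_ideal l n A" "\<alpha> + single i a \<in> A" "a \<le> b" "l \<le> i" "i \<le> n"
  shows "\<alpha> + single i b \<in> A"
proof -
  have "\<alpha> + single i b = (\<alpha> + single i a) + single i (b - a)"
    using assms(3) by (simp add: add.assoc flip: single_add)
  then show ?thesis
    using assms by (simp add: term_idealD single_in_terms_of)
qed

lemma move_closedD:
  assumes "move_closed p l n A" "\<alpha> \<in> A" "l \<le> i" "i < j" "j \<le> n" "0 < t"
    "t \<le> lookup \<alpha> i" "prec_p p t (lookup \<alpha> i)"
  shows "\<alpha> - single i t + single j t \<in> A"
  using assms unfolding move_closed_def admissible_step_def increasing_move_def by blast

lemma prec_p_refl: "p \<noteq> 1 \<Longrightarrow> prec_p p a a"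
  by (simp add: prec_p_def)

lemma lookup_drop_var: "lookup (drop_var l \<alpha>) i = (if i = l then 0 else lookup \<alpha> i)"
  by (simp add: drop_var_def lookup_minus lookup_single when_def)

lemma drop_var_add_single: "drop_var l \<alpha> + single l (lookup \<alpha> l) = \<alpha>"
  by (simp add: drop_var_def pterm_diff_add)

lemma drop_var_add: "drop_var l (\<alpha> + \<beta>) = drop_var l \<alpha> + drop_var l \<beta>"
  by (rule poly_mapping_eqI) (simp add: lookup_drop_var lookup_add)

lemma drop_var_single [simp]: "drop_var l (single l m) = 0"
  by (simp add: drop_var_def)

lemma drop_var_id: "lookup \<alpha> l = 0 \<Longrightarrow> drop_var l \<alpha> = \<alpha>"
  by (simp add: drop_var_def)

lemma drop_var_in_terms_of: "\<alpha> \<in> terms_of l n \<Longrightarrow> drop_var l \<alpha> \<in> terms_of (Suc l) n"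
  unfolding terms_of_iff lookup_drop_var by (metis Suc_leI le_neq_implies_less)

lemma lookup_terms_of_Suc: "\<alpha> \<in> terms_of (Suc l) n \<Longrightarrow> lookup \<alpha> l = 0"
  using not_less_eq_eq by (auto simp: terms_of_iff)

lemma terms_of_SucI: "\<alpha> \<in> terms_of l n \<Longrightarrow> lookup \<alpha> l = 0 \<Longrightarrow> \<alpha> \<in> terms_of (Suc l) n"
  using drop_var_in_terms_of drop_var_id by metis

lemma tdeg_drop_var: "tdeg \<alpha> = tdeg (drop_var l \<alpha>) + lookup \<alpha> l"
  using arg_cong[OF drop_var_add_single[of l \<alpha>], of tdeg] by (simp add: tdeg_add)


subsection \<open>Saturation\<close>

lemma subset_term_sat: "term_ideal l n A \<Longrightarrow> A \<subseteq> term_sat l n A"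
  by (auto simp: term_sat_def dest: term_ideal_subset intro!: exI[of _ 0])

lemma term_sat_trivial: "n < l \<Longrightarrow> term_sat l n A = terms_of l n"
  by (auto simp: term_sat_def terms_of_trivial intro!: exI[of _ 1])

lemma term_ideal_sat:
  assumes "term_ideal l n A"
  shows "term_ideal l n (term_sat l n A)"
  unfolding term_ideal_def
proof (intro conjI ballI)
  fix \<alpha> \<beta> assume \<alpha>: "\<alpha> \<in> term_sat l n A" and \<beta>: "\<beta> \<in> terms_of l n"
  then obtain m where m: "\<And>\<gamma>. \<gamma> \<in> terms_of l n \<Longrightarrow> tdeg \<gamma> = m \<Longrightarrow> \<alpha> + \<gamma> \<in> A"
    by (auto simp: term_sat_def)
  have "\<alpha> + \<beta> + \<gamma> \<in> A" if "\<gamma> \<in> terms_of l n" "tdeg \<gamma> = m" for \<gamma>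
    using term_idealD[OF assms m[OF that] \<beta>] by (simp add: ac_simps)
  then show "\<alpha> + \<beta> \<in> term_sat l n A"
    using \<alpha> \<beta> by (auto simp: term_sat_def add_in_terms_of)
qed (auto simp: term_sat_def)

text \<open>If all exponents were below a, the degree would be below (n - l + 1) a; the rounder
  bound is enough for the saturation argument.\<close>

lemma pigeonhole_degree:
  assumes "\<beta> \<in> terms_of l n" "tdeg \<beta> = Suc n * a" "l \<le> n"
  shows "\<exists>j\<in>{l..n}. a \<le> lookup \<beta> j"
proof (rule ccontr)
  assume neg: "\<not> ?thesis"
  have "tdeg \<beta> = (\<Sum>j\<in>{l..n}. lookup \<beta> j)"
    using assms(1) by (intro tdeg_superset) (auto simp: terms_of_def)
  also have "\<dots> < (\<Sum>j\<in>{l..n}. a)"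
    using neg assms(3) by (intro sum_strict_mono) (auto simp: not_le)
  also have "\<dots> \<le> Suc n * a"
    using mult_le_mono1[of "Suc n - l" "Suc n" a] by simp
  finally show False
    using assms(2) by simp
qed

text \<open>Moving the whole exponent of the smallest variable is always admissible, since
  $\binom aa = 1$; hence this variable alone decides membership in the saturation.\<close>

lemma term_sat_iff:
  assumes "term_ideal l n A" "move_closed p l n A" "l \<le> n" "p \<noteq> 1"
  shows "\<alpha> \<in> term_sat l n A \<longleftrightarrow> \<alpha> \<in> terms_of l n \<and> (\<exists>m. \<alpha> + single l m \<in> A)"
proof
  assume "\<alpha> \<in> term_sat l n A"
  then obtain m where "\<alpha> \<in> terms_of l n" "\<forall>\<beta>\<in>terms_of l n. tdeg \<beta> = m \<longrightarrow> \<alpha> + \<beta> \<in> A"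
    by (auto simp: term_sat_def)
  moreover from this have "\<alpha> + single l m \<in> A"
    using assms(3) by (simp add: single_in_terms_of)
  ultimately show "\<alpha> \<in> terms_of l n \<and> (\<exists>m. \<alpha> + single l m \<in> A)"
    by blast
next
  assume "\<alpha> \<in> terms_of l n \<and> (\<exists>m. \<alpha> + single l m \<in> A)"
  then obtain m where \<alpha>: "\<alpha> \<in> terms_of l n" and m: "\<alpha> + single l m \<in> A"
    by blast
  \<comment> \<open>The full exponent of x_l in \<alpha> x_l^m. Every variable to the power a will
    carry \<alpha> into A, so by the pigeonhole every term of degree \<open>Suc n * a\<close>
    does.\<close>
  define a where "a = lookup \<alpha> l + m"
  have *: "\<alpha> + single j a \<in> A" if j: "l \<le> j" "j \<le> n" for j
  proof (cases "j = l \<or> a = 0")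
    case True
    then show ?thesis
      using term_idealD_le[OF assms(1) m, of a] assms(3) m by (auto simp: a_def)
  next
    case False
    \<comment> \<open>All a copies of x_l move to x_j, which also uses up the x_l-part of \<alpha>;
      multiplying by x_l to the exponent it had in \<alpha> restores that part.\<close>
    have "\<alpha> + single l m - single l a + single j a \<in> A"
      using False j assms(4)
      by (intro move_closedD[OF assms(2) m]) (auto simp: lookup_add a_def prec_p_refl)
    then have "\<alpha> + single l m - single l a + single j a
        + single l (lookup \<alpha> l) \<in> A"
      by (rule term_idealD[OF assms(1)]) (simp add: single_in_terms_of assms(3))
    also have "\<alpha> + single l m - single l a + single j a
        + single l (lookup \<alpha> l) = \<alpha> + single j a"
      using False
      by (intro poly_mapping_eqI) (auto simp: lookup_add lookup_minus lookup_single when_def a_def)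
    finally show ?thesis .
  qed
  have "\<alpha> + \<beta> \<in> A" if \<beta>: "\<beta> \<in> terms_of l n" "tdeg \<beta> = Suc n * a" for \<beta>
  proof -
    obtain j where j: "l \<le> j" "j \<le> n" "a \<le> lookup \<beta> j"
      using pigeonhole_degree[OF \<beta> assms(3)] by auto
    then have "\<alpha> + \<beta> = \<alpha> + single j a + (\<beta> - single j a)"
      using pterm_diff_add[of a \<beta> j] by (simp add: ac_simps)
    then show ?thesis
      using term_idealD[OF assms(1) *[OF j(1,2)] minus_in_terms_of[OF \<beta>(1)]] by simp
  qed
  then show "\<alpha> \<in> term_sat l n A"
    using \<alpha> by (auto simp: term_sat_def)
qed

lemma admissible_step_in_terms_of:
  "admissible_step p l n \<alpha> \<beta> \<Longrightarrow> \<alpha> \<in> terms_of l n \<Longrightarrow> \<beta> \<in> terms_of l n"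
  by (auto simp: admissible_step_def intro!: move_in_terms_of)

lemma move_closed_terms_of: "move_closed p l n (terms_of l n)"
  by (auto simp: move_closed_def intro: admissible_step_in_terms_of)

lemma term_ideal_terms_of: "term_ideal l n (terms_of l n)"
  by (auto simp: term_ideal_def add_in_terms_of)

text \<open>Splitting off the x_l-part of \<alpha> only changes the exponent of x_l that witnesses
  membership in the saturation.\<close>

lemma drop_var_in_term_sat:
  assumes "term_ideal l n A" "move_closed p l n A" "l \<le> n" "p \<noteq> 1" "\<alpha> \<in> term_sat l n A"
  shows "drop_var l \<alpha> \<in> term_sat l n A"
proof -
  obtain m where "\<alpha> + single l m \<in> A" and \<alpha>: "\<alpha> \<in> terms_of l n"
    using assms(5) term_sat_iff[OF assms(1-4)] by auto
  then have "drop_var l \<alpha> + single l (lookup \<alpha> l + m) \<in> A"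
    by (simp add: single_add drop_var_add_single flip: add.assoc)
  then show ?thesis
    using term_sat_iff[OF assms(1-4)] \<alpha> by (auto simp: drop_var_def intro: minus_in_terms_of)
qed

text \<open>For a move in the smallest variable, first replace the term by its part free of that
  variable.\<close>

lemma move_closed_sat:
  assumes "term_ideal l n A" "move_closed p l n A" "p \<noteq> 1"
  shows "move_closed p l n (term_sat l n A)"
proof (cases "l \<le> n")
  case False
  then show ?thesis
    by (simp add: term_sat_trivial move_closed_terms_of)
next
  case True
  show ?thesis
    unfolding move_closed_def
  proof (intro ballI allI impI)
    fix \<alpha> \<beta> assume \<alpha>: "\<alpha> \<in> term_sat l n A" and step: "admissible_step p l n \<alpha> \<beta>"
    then obtain i j t where ijt: "l \<le> i" "i < j" "j \<le> n" "0 < t" "t \<le> lookup \<alpha> i"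
      "prec_p p t (lookup \<alpha> i)"
      and \<beta>: "\<beta> = \<alpha> - single i t + single j t"
      by (auto simp: admissible_step_def increasing_move_def)
    obtain m where \<alpha>T: "\<alpha> \<in> terms_of l n" and m: "\<alpha> + single l m \<in> A"
      using \<alpha> term_sat_iff[OF assms(1,2) True assms(3)] by auto
    show "\<beta> \<in> term_sat l n A"
    proof (cases "i = l")
      case False
      then have "\<alpha> + single l m - single i t + single j t \<in> A"
        using ijt by (intro move_closedD[OF assms(2) m]) (auto simp: lookup_add lookup_single)
      also have "\<alpha> + single l m - single i t + single j t
          = \<beta> + single l m"
        using ijt(5) False unfolding \<beta>
        by (intro poly_mapping_eqI) (auto simp: lookup_add lookup_minus lookup_single when_def)
      finally show ?thesis
        using admissible_step_in_terms_of[OF step \<alpha>T] term_sat_iff[OF assms(1,2) True assms(3)]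
        by auto
    next
      case True
      have "\<beta> = drop_var l \<alpha> + (\<beta> - drop_var l \<alpha>)"
        unfolding \<beta> using True
        by (intro poly_mapping_eqI)
          (auto simp: lookup_add lookup_minus lookup_single when_def lookup_drop_var)
      moreover have "drop_var l \<alpha> + (\<beta> - drop_var l \<alpha>) \<in> term_sat l n A"
        by (rule term_idealD[OF term_ideal_sat[OF assms(1)]
              drop_var_in_term_sat[OF assms(1,2) \<open>l \<le> n\<close> assms(3) \<alpha>]
              minus_in_terms_of[OF admissible_step_in_terms_of[OF step \<alpha>T]]])
      ultimately show ?thesis
        by simp
    qed
  qed
qed

lemma term_sat_idem:
  assumes "term_ideal l n A" "move_closed p l n A" "p \<noteq> 1"
  shows "term_sat l n (term_sat l n A) = term_sat l n A"
proof (cases "l \<le> n")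
  case False
  then show ?thesis
    by (simp add: term_sat_trivial)
next
  case True
  note iff = term_sat_iff[OF assms(1,2) True assms(3)]
    term_sat_iff[OF term_ideal_sat[OF assms(1)] move_closed_sat[OF assms] True assms(3)]
  show ?thesis
  proof (rule equalityI)
    show "term_sat l n (term_sat l n A) \<subseteq> term_sat l n A"
    proof
      fix \<alpha> assume "\<alpha> \<in> term_sat l n (term_sat l n A)"
      then obtain m m' where "\<alpha> \<in> terms_of l n"
        "\<alpha> + single l m + single l m' \<in> A"
        by (auto simp: iff)
      then have "\<alpha> + single l (m + m') \<in> A"
        by (simp add: single_add add.assoc)
      with \<open>\<alpha> \<in> terms_of l n\<close> show "\<alpha> \<in> term_sat l n A"
        by (auto simp: iff(1))
    qed
  qed (rule subset_term_sat[OF term_ideal_sat[OF assms(1)]])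
qed

text \<open>x_l is a nonzerodivisor modulo a saturated ideal.\<close>

lemma saturated_cancel:
  assumes "term_ideal l n A" "move_closed p l n A" "p \<noteq> 1" "term_sat l n A = A" "l \<le> n"
  shows "\<alpha> + single l m \<in> A \<longleftrightarrow> \<alpha> \<in> A"
proof
  assume "\<alpha> + single l m \<in> A"
  moreover from this have "\<alpha> \<in> terms_of l n"
    using term_ideal_subset[OF assms(1)] add_in_terms_of_iff by blast
  ultimately show "\<alpha> \<in> A"
    using term_sat_iff[OF assms(1,2,5,3)] assms(4) by blast
next
  assume "\<alpha> \<in> A"
  then show "\<alpha> + single l m \<in> A"
    by (rule term_idealD[OF assms(1)]) (simp add: single_in_terms_of assms(5))
qed


subsection \<open>Restriction to and extension from the remaining variables\<close>

lemma term_ideal_slice: "term_ideal l n A \<Longrightarrow> term_ideal (Suc l) n (term_slice l A)"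
  unfolding term_ideal_def term_slice_def
  using terms_of_SucI[of _ l n] terms_of_Suc_subset[of l n]
  by (auto simp: lookup_add lookup_terms_of_Suc)

lemma move_closed_slice: "move_closed p l n A \<Longrightarrow> move_closed p (Suc l) n (term_slice l A)"
  unfolding move_closed_def term_slice_def
proof (intro ballI allI impI)
  fix \<alpha> \<beta>
  assume A: "\<forall>\<alpha>\<in>A. \<forall>\<beta>. admissible_step p l n \<alpha> \<beta> \<longrightarrow> \<beta> \<in> A"
    and \<alpha>: "\<alpha> \<in> {\<alpha> \<in> A. lookup \<alpha> l = 0}"
    and step: "admissible_step p (Suc l) n \<alpha> \<beta>"
  have "admissible_step p l n \<alpha> \<beta>"
    using step Suc_leD unfolding admissible_step_def by blast
  moreover have "lookup \<beta> l = 0"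
    using step \<alpha>
    by (auto simp: admissible_step_def increasing_move_def lookup_add lookup_minus lookup_single when_def)
  ultimately show "\<beta> \<in> {\<alpha> \<in> A. lookup \<alpha> l = 0}"
    using A \<alpha> by blast
qed

lemma term_ideal_ext: "term_ideal (Suc l) n B \<Longrightarrow> term_ideal l n (term_ext l n B)"
  by (auto simp: term_ideal_def term_ext_def drop_var_add add_in_terms_of drop_var_in_terms_of)

text \<open>A move out of x_l multiplies the x_l-free part by a power of x_j; any other move acts on
  that part alone.\<close>

lemma move_closed_ext:
  assumes "term_ideal (Suc l) n B" "move_closed p (Suc l) n B"
  shows "move_closed p l n (term_ext l n B)"
  unfolding move_closed_def
proof (intro ballI allI impI)
  fix \<alpha> \<beta> assume \<alpha>: "\<alpha> \<in> term_ext l n B" and step: "admissible_step p l n \<alpha> \<beta>"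
  then obtain i j t where ijt: "l \<le> i" "i < j" "j \<le> n" "0 < t" "t \<le> lookup \<alpha> i"
    "prec_p p t (lookup \<alpha> i)"
    and \<beta>: "\<beta> = \<alpha> - single i t + single j t"
    by (auto simp: admissible_step_def increasing_move_def)
  have "drop_var l \<beta> \<in> B"
  proof (cases "i = l")
    case True
    have "drop_var l \<beta> = drop_var l \<alpha> + single j t"
      unfolding \<beta> using True ijt(2)
      by (intro poly_mapping_eqI)
        (auto simp: lookup_add lookup_minus lookup_single when_def lookup_drop_var)
    then show ?thesis
      using \<alpha> ijt True by (auto simp: term_ext_def intro!: term_idealD[OF assms(1)] single_in_terms_of)
  next
    case False
    have "drop_var l \<beta> = drop_var l \<alpha> - single i t + single j t"
      unfolding \<beta> using False ijt(1,2)
      by (intro poly_mapping_eqI)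
        (auto simp: lookup_add lookup_minus lookup_single when_def lookup_drop_var)
    then show ?thesis
      using \<alpha> ijt False move_closedD[OF assms(2), of "drop_var l \<alpha>" i j t]
      by (auto simp: term_ext_def lookup_drop_var)
  qed
  then show "\<beta> \<in> term_ext l n B"
    using \<alpha> admissible_step_in_terms_of[OF step] by (auto simp: term_ext_def)
qed

lemma term_sat_ext:
  assumes "term_ideal (Suc l) n B" "move_closed p (Suc l) n B" "p \<noteq> 1" "l \<le> n"
  shows "term_sat l n (term_ext l n B) = term_ext l n B"
  using term_sat_iff[OF term_ideal_ext[OF assms(1)] move_closed_ext[OF assms(1,2)] assms(4,3)]
    single_in_terms_of[of l l n] assms(4)
  by (auto simp: term_ext_def drop_var_add add_in_terms_of)

lemma term_slice_ext:
  assumes "term_ideal (Suc l) n B"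
  shows "term_slice l (term_ext l n B) = B"
  using term_ideal_subset[OF assms] terms_of_Suc_subset[of l n]
  by (auto simp: term_slice_def term_ext_def drop_var_id lookup_terms_of_Suc subset_iff)

text \<open>Cancelling x_l reduces membership to terms free of x_l, so a saturated ideal is
  recovered from its restriction.\<close>

lemma term_ext_slice:
  assumes "term_ideal l n A" "move_closed p l n A" "p \<noteq> 1" "term_sat l n A = A" "l \<le> n"
  shows "term_ext l n (term_slice l A) = A"
proof -
  have "drop_var l \<alpha> \<in> A \<longleftrightarrow> \<alpha> \<in> A" for \<alpha>
    using saturated_cancel[OF assms, of "drop_var l \<alpha>"] by (metis drop_var_add_single)
  then show ?thesis
    using term_ideal_subset[OF assms(1)]
    by (auto simp: term_ext_def term_slice_def lookup_drop_var)
qed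

lemma term_ext_mono: "B \<subseteq> C \<Longrightarrow> term_ext l n B \<subseteq> term_ext l n C"
  by (auto simp: term_ext_def)


section \<open>Ideals stable and generated from a degree on\<close>

text \<open>The truncation in degrees at least s is stable, and it is generated in degree s, the
  latter expressed by a divisor of degree one less. By the Eliahou-Kervaire resolution such a
  truncation, if nonzero, has regularity s; the proof works with the two conditions
  directly.\<close>

definition stably_generated :: "nat \<Rightarrow> nat \<Rightarrow> pterm set \<Rightarrow> bool" where
  "stably_generated n s A \<longleftrightarrow>
     (\<forall>\<alpha>\<in>A. \<forall>j. s \<le> tdeg \<alpha> \<and> \<alpha> \<noteq> 0 \<and> tmin \<alpha> < j \<and> j \<le> n \<longrightarrow>
        \<alpha> - single (tmin \<alpha>) 1 + single j 1 \<in> A) \<and>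
     (\<forall>\<alpha>\<in>A. s < tdeg \<alpha> \<longrightarrow>
        (\<exists>i. lookup \<alpha> i \<noteq> 0 \<and> \<alpha> - single i 1 \<in> A))"

lemma stably_generated_mono: "stably_generated n s A \<Longrightarrow> s \<le> s' \<Longrightarrow> stably_generated n s' A"
  unfolding stably_generated_def by (meson le_trans less_le_trans le_less_trans)

lemma stably_generated_stable:
  "stably_generated n s A \<Longrightarrow> \<alpha> \<in> A \<Longrightarrow> s \<le> tdeg \<alpha> \<Longrightarrow> \<alpha> \<noteq> 0 \<Longrightarrow> tmin \<alpha> < j \<Longrightarrow> j \<le> n \<Longrightarrow>
    \<alpha> - single (tmin \<alpha>) 1 + single j 1 \<in> A"
  unfolding stably_generated_def by blast

lemma stably_generated_divisor:
  assumes "stably_generated n s A" "\<alpha> \<in> A" "s < tdeg \<alpha>"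
  obtains i \<beta> where "\<beta> \<in> A" "\<alpha> = \<beta> + single i 1"
proof -
  obtain i where i: "lookup \<alpha> i \<noteq> 0" "\<alpha> - single i 1 \<in> A"
    using assms unfolding stably_generated_def by blast
  then have "\<alpha> = \<alpha> - single i 1 + single i 1"
    by (intro pterm_diff_add[symmetric]) simp
  then show thesis
    using i(2) that by metis
qed

lemma tdeg_add_single: "tdeg (\<beta> + single i m) = tdeg \<beta> + m"
  by (simp add: tdeg_add)

text \<open>Write \<alpha> x_l = \<beta> x_i with \<beta> in A. If i differs from l, then x_l is the
  smallest variable of \<beta>, and stability exchanges it for x_i, which produces \<alpha>
  itself.\<close>

lemma stably_generated_cancel1:
  assumes "stably_generated n s A" "term_ideal l n A" "\<alpha> + single l 1 \<in> A"
    "s \<le> tdeg \<alpha>"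
  shows "\<alpha> \<in> A"
proof -
  have "s < tdeg (\<alpha> + single l 1)"
    using assms(4) by (simp add: tdeg_add_single)
  then obtain i \<beta> where \<beta>: "\<beta> \<in> A" "\<alpha> + single l 1 = \<beta> + single i 1"
    by (rule stably_generated_divisor[OF assms(1,3)])
  show ?thesis
  proof (cases "i = l")
    case True
    then show ?thesis
      using \<beta> by simp
  next
    case False
    have "\<alpha> + single l 1 \<in> terms_of l n"
      using assms(2,3) by (auto dest: term_ideal_subset)
    then have "single i (1::nat) \<in> terms_of l n" "\<beta> \<in> terms_of l n"
      unfolding \<beta>(2) by (auto simp: add_in_terms_of_iff)
    then have i: "l < i" "i \<le> n"
      using False by (auto simp: terms_of_def)
    have \<beta>l: "lookup \<beta> l \<noteq> 0"
      using arg_cong[OF \<beta>(2), of "\<lambda>\<gamma>. lookup \<gamma> l"] False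
      by (simp add: lookup_add lookup_single)
    then have min: "tmin \<beta> = l" and "\<beta> \<noteq> 0"
      using tmin_eq_bottom[OF \<open>\<beta> \<in> terms_of l n\<close>] by auto
    have "tdeg \<beta> = tdeg \<alpha>"
      using arg_cong[OF \<beta>(2), of tdeg] by (simp add: tdeg_add_single)
    then have "\<beta> - single l 1 + single i 1 \<in> A"
      using stably_generated_stable[OF assms(1) \<beta>(1) _ \<open>\<beta> \<noteq> 0\<close>, of i] min i assms(4) by simp
    also have "\<beta> - single l 1 + single i 1
        = (\<beta> + single i 1) - single l 1"
      using \<beta>l False
      by (intro poly_mapping_eqI) (auto simp: lookup_add lookup_minus lookup_single when_def)
    also have "\<dots> = \<alpha>"
      unfolding \<beta>(2)[symmetric] by (rule pterm_add_diff)
    finally show ?thesis .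
  qed
qed

lemma stably_generated_cancel:
  assumes "stably_generated n s A" "term_ideal l n A" "\<alpha> + single l m \<in> A"
    "s \<le> tdeg \<alpha>"
  shows "\<alpha> \<in> A"
  using assms(3)
proof (induction m)
  case (Suc m)
  have "\<alpha> + single l m + single l 1 \<in> A"
    using Suc.prems by (simp add: add.assoc flip: single_add)
  then have "\<alpha> + single l m \<in> A"
    by (rule stably_generated_cancel1[OF assms(1,2)]) (use assms(4) in \<open>simp add: tdeg_add_single\<close>)
  then show ?case
    by (rule Suc.IH)
qed simp

text \<open>By generation in degree s, each step upward multiplies a term already known to lie in C
  by one variable.\<close>

lemma stably_generated_subset:
  assumes "stably_generated n s A" "term_ideal l n A" "term_ideal l n C"
    "\<And>\<alpha>. \<alpha> \<in> A \<Longrightarrow> tdeg \<alpha> = s \<Longrightarrow> \<alpha> \<in> C"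
  shows "\<alpha> \<in> A \<Longrightarrow> s \<le> tdeg \<alpha> \<Longrightarrow> \<alpha> \<in> C"
proof (induction "tdeg \<alpha> - s" arbitrary: \<alpha>)
  case 0
  then show ?case
    using assms(4) by simp
next
  case (Suc k)
  then have "s < tdeg \<alpha>"
    by simp
  with Suc.prems(1) obtain i \<beta> where \<beta>: "\<beta> \<in> A" "\<alpha> = \<beta> + single i 1"
    by (rule stably_generated_divisor[OF assms(1)])
  have "\<beta> \<in> C"
    using Suc \<beta> by (intro Suc(1)) (auto simp: tdeg_add_single)
  moreover have "single i 1 \<in> terms_of l n"
    using term_ideal_subset[OF assms(2)] Suc.prems(1) \<beta>(2) by (auto simp: add_in_terms_of_iff)
  ultimately show ?case
    using \<beta>(2) term_idealD[OF assms(3)] by blast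
qed

lemma stably_generated_sat:
  assumes "stably_generated n s A" "term_ideal l n A" "move_closed p l n A" "p \<noteq> 1" "s \<le> tdeg \<alpha>"
    "l \<le> n"
  shows "\<alpha> \<in> term_sat l n A \<longleftrightarrow> \<alpha> \<in> A"
  using stably_generated_cancel[OF assms(1,2) _ assms(5)] subset_term_sat[OF assms(2)]
    term_sat_iff[OF assms(2,3,6,4)] by blast

text \<open>For terms free of x_l both conditions come from the slice. A term divisible by x_l can
  be divided by x_l inside A, which gives the divisor at once and, after multiplication by x_j,
  stability.\<close>

lemma stably_generated_of_slice:
  assumes "term_ideal l n A" "move_closed p l n A" "p \<noteq> 1" "term_sat l n A = A" "l \<le> n"
    "stably_generated n s (term_slice l A)"
  shows "stably_generated n s A"
  unfolding stably_generated_def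
proof (intro conjI ballI allI impI)
  fix \<alpha> j assume \<alpha>: "\<alpha> \<in> A" and *: "s \<le> tdeg \<alpha> \<and> \<alpha> \<noteq> 0 \<and> tmin \<alpha> < j \<and> j \<le> n"
  have \<alpha>T: "\<alpha> \<in> terms_of l n"
    using \<alpha> assms(1) term_ideal_subset by blast
  show "\<alpha> - single (tmin \<alpha>) 1 + single j 1 \<in> A"
  proof (cases "lookup \<alpha> l = 0")
    case True
    then show ?thesis
      using stably_generated_stable[OF assms(6), of \<alpha> j] \<alpha> * by (auto simp: term_slice_def)
  next
    case False
    then have min: "tmin \<alpha> = l"
      by (rule tmin_eq_bottom[OF \<alpha>T])
    have "\<alpha> - single l 1 + single l 1 \<in> A"
      using False \<alpha> by (subst pterm_diff_add) auto
    then have "\<alpha> - single l 1 \<in> A"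
      by (rule saturated_cancel[THEN iffD1, OF assms(1-5)])
    then show ?thesis
      using * min by (intro term_idealD[OF assms(1)]) (auto intro: single_in_terms_of)
  qed
next
  fix \<alpha> assume \<alpha>: "\<alpha> \<in> A" "s < tdeg \<alpha>"
  show "\<exists>i. lookup \<alpha> i \<noteq> 0 \<and> \<alpha> - single i 1 \<in> A"
  proof (cases "lookup \<alpha> l = 0")
    case True
    then have "\<alpha> \<in> term_slice l A"
      using \<alpha> by (simp add: term_slice_def)
    then have "\<exists>i. lookup \<alpha> i \<noteq> 0 \<and> \<alpha> - single i 1 \<in> term_slice l A"
      using assms(6) \<alpha>(2) unfolding stably_generated_def by blast
    then show ?thesis
      by (auto simp: term_slice_def)
  next
    case False
    have "\<alpha> - single l 1 + single l 1 \<in> A"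
      using False \<alpha> by (subst pterm_diff_add) auto
    then have "\<alpha> - single l 1 \<in> A"
      by (rule saturated_cancel[THEN iffD1, OF assms(1-5)])
    then show ?thesis
      using False by blast
  qed
qed

text \<open>Neither exchanging the smallest variable for a larger one nor dividing by a variable
  introduces x_l.\<close>

lemma stably_generated_slice:
  assumes "stably_generated n s A" "term_ideal l n A"
  shows "stably_generated n s (term_slice l A)"
  unfolding stably_generated_def
proof (intro conjI ballI allI impI)
  fix \<alpha> j assume \<alpha>: "\<alpha> \<in> term_slice l A" and *: "s \<le> tdeg \<alpha> \<and> \<alpha> \<noteq> 0 \<and> tmin \<alpha> < j \<and> j \<le> n"
  have "\<alpha> \<in> terms_of l n"
    using \<alpha> term_ideal_subset[OF assms(2)] by (auto simp: term_slice_def)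
  then have "l \<le> tmin \<alpha>"
    using tmin_bounds * by blast
  then show "\<alpha> - single (tmin \<alpha>) 1 + single j 1 \<in> term_slice l A"
    using stably_generated_stable[OF assms(1), of \<alpha> j] \<alpha> *
    by (auto simp: term_slice_def lookup_add lookup_minus lookup_single)
next
  fix \<alpha> assume "\<alpha> \<in> term_slice l A" "s < tdeg \<alpha>"
  then show "\<exists>i. lookup \<alpha> i \<noteq> 0 \<and> \<alpha> - single i 1 \<in> term_slice l A"
    using assms by (fastforce simp: stably_generated_def term_slice_def lookup_minus)
qed


subsection \<open>Ideals generated in one degree\<close>

lemma term_ideal_span:
  assumes "B \<subseteq> terms_of l n"
  shows "term_ideal l n (term_span l n B)"
  unfolding term_ideal_def
proof (intro conjI ballI)
  fix \<alpha> \<delta> assume "\<alpha> \<in> term_span l n B" and \<delta>: "\<delta> \<in> terms_of l n"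
  then obtain \<beta> \<gamma> where \<alpha>: "\<alpha> = \<beta> + \<gamma>" "\<beta> \<in> B" "\<gamma> \<in> terms_of l n"
    by (auto simp: term_span_def)
  have "\<alpha> + \<delta> = \<beta> + (\<gamma> + \<delta>)"
    by (simp add: \<alpha>(1) add.assoc)
  then show "\<alpha> + \<delta> \<in> term_span l n B"
    using \<alpha>(2) add_in_terms_of[OF \<alpha>(3) \<delta>] unfolding term_span_def by blast
qed (use assms in \<open>auto simp: term_span_def add_in_terms_of_iff\<close>)

lemma subset_term_span: "B \<subseteq> term_span l n B"
  unfolding term_span_def by (force intro: exI[of _ 0])

lemma term_span_subset: "term_ideal l n A \<Longrightarrow> B \<subseteq> A \<Longrightarrow> term_span l n B \<subseteq> A"
  by (auto simp: term_span_def term_ideal_def)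

lemma term_span_same_degree:
  assumes "\<And>\<beta>. \<beta> \<in> B \<Longrightarrow> tdeg \<beta> = s" "tdeg \<alpha> = s"
  shows "\<alpha> \<in> term_span l n B \<longleftrightarrow> \<alpha> \<in> B"
proof
  assume "\<alpha> \<in> term_span l n B"
  then obtain \<beta> \<gamma> where \<alpha>: "\<alpha> = \<beta> + \<gamma>" "\<beta> \<in> B"
    by (auto simp: term_span_def)
  then have "tdeg \<gamma> = 0"
    using assms(1)[OF \<alpha>(2)] assms(2) by (simp add: tdeg_add)
  then show "\<alpha> \<in> B"
    using \<alpha> by simp
qed (use subset_term_span in blast)

text \<open>The smallest variable of \<beta> \<gamma> divides one of the factors. In \<beta> it is
  again the smallest, and stability of B applies; in \<gamma>, an arbitrary term, it can be
  exchanged freely.\<close>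

lemma stably_generated_span:
  assumes B: "B \<subseteq> terms_of l n" "\<And>\<beta>. \<beta> \<in> B \<Longrightarrow> tdeg \<beta> = s"
    and stable: "\<And>\<beta> j. \<beta> \<in> B \<Longrightarrow> \<beta> \<noteq> 0 \<Longrightarrow> tmin \<beta> < j \<Longrightarrow> j \<le> n \<Longrightarrow>
      \<beta> - single (tmin \<beta>) 1 + single j 1 \<in> B"
  shows "stably_generated n s (term_span l n B)"
  unfolding stably_generated_def
proof (intro conjI ballI allI impI)
  fix \<alpha> j assume "\<alpha> \<in> term_span l n B" and *: "s \<le> tdeg \<alpha> \<and> \<alpha> \<noteq> 0 \<and> tmin \<alpha> < j \<and> j \<le> n"
  then obtain \<beta> \<gamma> where \<alpha>: "\<alpha> = \<beta> + \<gamma>" "\<beta> \<in> B" "\<gamma> \<in> terms_of l n"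
    by (auto simp: term_span_def)
  define i where "i = tmin \<alpha>"
  have min: "i \<le> k" if "lookup \<beta> k \<noteq> 0 \<or> lookup \<gamma> k \<noteq> 0" for k
    using that tmin_le[of \<alpha> k] unfolding i_def \<alpha>(1) by (auto simp: lookup_add)
  have "\<alpha> \<in> terms_of l n"
    using \<alpha> B(1) add_in_terms_of by blast
  then have j: "l \<le> j" "i < j" "j \<le> n"
    using * tmin_bounds[of \<alpha> l n] by (auto simp: i_def)
  have "lookup \<alpha> i \<noteq> 0"
    using * lookup_tmin unfolding i_def by blast
  then consider "lookup \<beta> i \<noteq> 0" | "lookup \<gamma> i \<noteq> 0"
    unfolding \<alpha>(1) by (auto simp: lookup_add)
  then show "\<alpha> - single (tmin \<alpha>) 1 + single j 1 \<in> term_span l n B"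
  proof cases
    case 1
    have "lookup \<beta> k = 0" if "k < i" for k
      using min[of k] that by linarith
    with 1 have "tmin \<beta> = i"
      by (rule tmin_eqI)
    then have "\<beta> - single i 1 + single j 1 \<in> B"
      using stable[OF \<alpha>(2) _ _ j(3)] 1 j(2) lookup_zero by force
    moreover have "\<alpha> - single i 1 + single j 1
        = (\<beta> - single i 1 + single j 1) + \<gamma>"
      using 1 unfolding \<alpha>(1)
      by (intro poly_mapping_eqI) (auto simp: lookup_add lookup_minus lookup_single when_def)
    ultimately show ?thesis
      using \<alpha>(3) unfolding term_span_def i_def[symmetric] by blast
  next
    case 2
    have "\<alpha> - single i 1 + single j 1
        = \<beta> + (\<gamma> - single i 1 + single j 1)"
      using 2 unfolding \<alpha>(1)
      by (intro poly_mapping_eqI) (auto simp: lookup_add lookup_minus lookup_single when_def)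
    moreover have "\<gamma> - single i 1 + single j 1 \<in> terms_of l n"
      using \<alpha>(3) j by (intro add_in_terms_of minus_in_terms_of single_in_terms_of) auto
    ultimately show ?thesis
      using \<alpha>(2) unfolding term_span_def i_def[symmetric] by blast
  qed
next
  fix \<alpha> assume "\<alpha> \<in> term_span l n B" and s: "s < tdeg \<alpha>"
  then obtain \<beta> \<gamma> where \<alpha>: "\<alpha> = \<beta> + \<gamma>" "\<beta> \<in> B" "\<gamma> \<in> terms_of l n"
    by (auto simp: term_span_def)
  then have "0 < tdeg \<gamma>"
    using s B(2) by (auto simp: tdeg_add)
  then obtain i where i: "lookup \<gamma> i \<noteq> 0"
    using ex_factor by blast
  then have "\<alpha> - single i 1 = \<beta> + (\<gamma> - single i 1)"
    unfolding \<alpha>(1)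
    by (intro poly_mapping_eqI) (auto simp: lookup_add lookup_minus lookup_single when_def)
  moreover have "\<gamma> - single i 1 \<in> terms_of l n"
    using \<alpha>(3) by (rule minus_in_terms_of)
  ultimately have "\<alpha> - single i 1 \<in> term_span l n B"
    using \<alpha>(2) unfolding term_span_def by blast
  then show "\<exists>i. lookup \<alpha> i \<noteq> 0 \<and> \<alpha> - single i 1 \<in> term_span l n B"
    using i unfolding \<alpha>(1) by (auto simp: lookup_add)
qed

text \<open>By Vandermonde's identity $\binom{a+b}t \not\equiv 0$ forces a splitting $t = u + v$ with
  $\binom au \not\equiv 0$ and $\binom bv \not\equiv 0$.\<close>

lemma prec_p_add_split:
  assumes "prec_p p t (a + b)"
  obtains u where "u \<le> t" "u \<le> a" "t - u \<le> b" "prec_p p u a"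
proof (cases "p = 0")
  case True
  then show thesis
    using assms that[of t] that[of a] by (cases "t \<le> a") (auto simp: prec_p_def)
next
  case False
  have "(a + b) choose t = (\<Sum>u\<le>t. (a choose u) * (b choose (t - u)))"
    by (rule vandermonde[symmetric])
  moreover have "\<not> p dvd ((a + b) choose t)"
    using assms False by (simp add: prec_p_def)
  ultimately obtain u where u: "u \<le> t" "\<not> p dvd (a choose u) * (b choose (t - u))"
    using dvd_sum[of "{..t}" p "\<lambda>u. (a choose u) * (b choose (t - u))"] by auto
  then have "a choose u \<noteq> 0" "b choose (t - u) \<noteq> 0"
    by (metis dvd_0_right mult_zero_left, metis dvd_0_right mult_zero_right)
  then have "u \<le> a" "t - u \<le> b"
    by (meson binomial_eq_0 not_le)+
  moreover have "prec_p p u a"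
    using u(2) False by (auto simp: prec_p_def)
  ultimately show thesis
    using that u(1) by blast
qed

text \<open>A move of t copies on \<beta> \<gamma> is split into u copies taken from \<beta>,
  admissible by \<open>prec_p_add_split\<close>, and t - u copies taken from the arbitrary term
  \<gamma>.\<close>

lemma move_closed_span:
  assumes B: "B \<subseteq> terms_of l n" "move_closed p l n B"
  shows "move_closed p l n (term_span l n B)"
  unfolding move_closed_def
proof (intro ballI allI impI)
  fix \<alpha> \<delta> assume "\<alpha> \<in> term_span l n B" and step: "admissible_step p l n \<alpha> \<delta>"
  then obtain \<beta> \<gamma> where \<alpha>: "\<alpha> = \<beta> + \<gamma>" "\<beta> \<in> B" "\<gamma> \<in> terms_of l n"
    by (auto simp: term_span_def)
  from step obtain i j t where ijt: "l \<le> i" "i < j" "j \<le> n" "0 < t"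
      "t \<le> lookup \<alpha> i" "prec_p p t (lookup \<alpha> i)"
    and \<delta>: "\<delta> = \<alpha> - single i t + single j t"
    by (auto simp: admissible_step_def increasing_move_def)
  obtain u where u: "u \<le> t" "u \<le> lookup \<beta> i" "t - u \<le> lookup \<gamma> i"
      "prec_p p u (lookup \<beta> i)"
    using prec_p_add_split ijt(6) unfolding \<alpha>(1) lookup_add by blast
  have "\<beta> - single i u + single j u \<in> B"
    using move_closedD[OF B(2) \<alpha>(2) ijt(1-3), of u] u \<alpha>(2) by (cases "u = 0") auto
  moreover have "\<gamma> - single i (t - u) + single j (t - u) \<in> terms_of l n"
    using \<alpha>(3) ijt by (intro add_in_terms_of minus_in_terms_of single_in_terms_of) auto
  moreover have "\<delta> = (\<beta> - single i u + single j u)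
      + (\<gamma> - single i (t - u) + single j (t - u))"
    unfolding \<delta> \<alpha>(1) using u ijt(2)
    by (intro poly_mapping_eqI) (auto simp: lookup_add lookup_minus lookup_single when_def)
  ultimately show "\<delta> \<in> term_span l n B"
    unfolding term_span_def by blast
qed


section \<open>Hilbert functions and Gotzmann's regularity theorem\<close>

definition hilbert_fun :: "nat \<Rightarrow> nat \<Rightarrow> pterm set \<Rightarrow> nat \<Rightarrow> nat" where
  "hilbert_fun l n A t = card {\<alpha> \<in> terms_of l n. tdeg \<alpha> = t \<and> \<alpha> \<notin> A}"

lemma finite_degree_Collect: "finite {\<alpha> \<in> terms_of l n. tdeg \<alpha> = t \<and> Q \<alpha>}"
  by (rule finite_subset[OF _ finite_terms_of_degree[of l n t]]) auto

lemma hilbert_fun_antimono: "A \<subseteq> B \<Longrightarrow> hilbert_fun l n B t \<le> hilbert_fun l n A t"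
  unfolding hilbert_fun_def by (rule card_mono[OF finite_degree_Collect]) auto

lemma hilbert_fun_cong:
  "(\<And>\<alpha>. \<alpha> \<in> terms_of l n \<Longrightarrow> tdeg \<alpha> = t \<Longrightarrow> \<alpha> \<in> A \<longleftrightarrow> \<alpha> \<in> B) \<Longrightarrow> hilbert_fun l n A t = hilbert_fun l n B t"
  unfolding hilbert_fun_def by (rule arg_cong[where f = card]) auto

lemma hilbert_fun_add:
  assumes "A \<subseteq> terms_of l n" "B \<subseteq> A"
  shows "hilbert_fun l n B t = hilbert_fun l n A t + card {\<alpha> \<in> A. tdeg \<alpha> = t \<and> \<alpha> \<notin> B}"
proof -
  have fin: "finite {\<alpha> \<in> A. tdeg \<alpha> = t \<and> \<alpha> \<notin> B}"
    by (rule finite_subset[OF _ finite_terms_of_degree[of l n t]]) (use assms in auto)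
  have "{\<alpha> \<in> terms_of l n. tdeg \<alpha> = t \<and> \<alpha> \<notin> B}
      = {\<alpha> \<in> terms_of l n. tdeg \<alpha> = t \<and> \<alpha> \<notin> A} \<union> {\<alpha> \<in> A. tdeg \<alpha> = t \<and> \<alpha> \<notin> B}"
    using assms by auto
  then show ?thesis
    unfolding hilbert_fun_def
    by (simp only:) (rule card_Un_disjoint[OF finite_degree_Collect fin], auto)
qed

lemma hilbert_fun_eqD:
  assumes "A \<subseteq> terms_of l n" "B \<subseteq> A" "hilbert_fun l n B t = hilbert_fun l n A t" "\<alpha> \<in> A" "tdeg \<alpha> = t"
  shows "\<alpha> \<in> B"
proof -
  have fin: "finite {\<alpha> \<in> A. tdeg \<alpha> = t \<and> \<alpha> \<notin> B}"
    by (rule finite_subset[OF _ finite_terms_of_degree[of l n t]]) (use assms(1) in auto)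
  have "card {\<alpha> \<in> A. tdeg \<alpha> = t \<and> \<alpha> \<notin> B} = 0"
    using hilbert_fun_add[OF assms(1,2), of t] assms(3) by simp
  then have "{\<alpha> \<in> A. tdeg \<alpha> = t \<and> \<alpha> \<notin> B} = {}"
    using fin by (simp only: card_0_eq)
  then show ?thesis
    using assms(4,5) by blast
qed

text \<open>A term of degree t is a term of some degree v \<le> t in the larger variables, filled up
  with x_l^(t - v); the filling does not affect membership in the extension.\<close>

lemma hilbert_fun_ext:
  assumes "l \<le> n"
  shows "hilbert_fun l n (term_ext l n B) t = (\<Sum>v\<le>t. hilbert_fun (Suc l) n B v)"
proof -
  let ?X = "{\<alpha> \<in> terms_of l n. tdeg \<alpha> = t \<and> \<alpha> \<notin> term_ext l n B}"
  let ?Y = "\<lambda>v. {\<gamma> \<in> terms_of (Suc l) n. tdeg \<gamma> = v \<and> \<gamma> \<notin> B}"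
  have "bij_betw (drop_var l) ?X (\<Union>v\<le>t. ?Y v)"
  proof (rule bij_betw_byWitness[where f' = "\<lambda>\<gamma>. \<gamma> + single l (t - tdeg \<gamma>)"])
    show "\<forall>\<alpha>\<in>?X. drop_var l \<alpha> + single l (t - tdeg (drop_var l \<alpha>)) = \<alpha>"
    proof
      fix \<alpha> assume "\<alpha> \<in> ?X"
      then have "t - tdeg (drop_var l \<alpha>) = lookup \<alpha> l"
        using tdeg_drop_var[of \<alpha> l] by auto
      then show "drop_var l \<alpha> + single l (t - tdeg (drop_var l \<alpha>)) = \<alpha>"
        by (simp add: drop_var_add_single)
    qed
    have drop: "drop_var l (\<gamma> + single l m) = \<gamma>" if "\<gamma> \<in> terms_of (Suc l) n" for \<gamma> m
      using that by (simp add: drop_var_add drop_var_id lookup_terms_of_Suc)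
    then show "\<forall>\<gamma>\<in>\<Union>v\<le>t. ?Y v. drop_var l (\<gamma> + single l (t - tdeg \<gamma>)) = \<gamma>"
      by auto
    show "drop_var l ` ?X \<subseteq> (\<Union>v\<le>t. ?Y v)"
    proof
      fix \<gamma> assume "\<gamma> \<in> drop_var l ` ?X"
      then obtain \<alpha> where \<alpha>: "\<alpha> \<in> terms_of l n" "tdeg \<alpha> = t" "\<alpha> \<notin> term_ext l n B" "\<gamma> = drop_var l \<alpha>"
        by auto
      then have "tdeg \<gamma> \<le> t" "\<gamma> \<notin> B" "\<gamma> \<in> terms_of (Suc l) n"
        using tdeg_drop_var[of \<alpha> l] drop_var_in_terms_of[of \<alpha> l n] by (auto simp: term_ext_def)
      then show "\<gamma> \<in> (\<Union>v\<le>t. ?Y v)"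
        by simp
    qed
    show "(\<lambda>\<gamma>. \<gamma> + single l (t - tdeg \<gamma>)) ` (\<Union>v\<le>t. ?Y v) \<subseteq> ?X"
    proof
      fix \<alpha> assume "\<alpha> \<in> (\<lambda>\<gamma>. \<gamma> + single l (t - tdeg \<gamma>)) ` (\<Union>v\<le>t. ?Y v)"
      then obtain \<gamma> where \<gamma>: "\<gamma> \<in> terms_of (Suc l) n" "tdeg \<gamma> \<le> t" "\<gamma> \<notin> B"
          "\<alpha> = \<gamma> + single l (t - tdeg \<gamma>)"
        by auto
      have "\<gamma> \<in> terms_of l n"
        using \<gamma>(1) terms_of_Suc_subset by blast
      then show "\<alpha> \<in> ?X"
        using \<gamma> drop[OF \<gamma>(1)] assms
        by (auto simp: term_ext_def tdeg_add_single add_in_terms_of_iff single_in_terms_of)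
    qed
  qed
  then have "card ?X = card (\<Union>v\<le>t. ?Y v)"
    by (rule bij_betw_same_card)
  also have "\<dots> = (\<Sum>v\<le>t. card (?Y v))"
    by (rule card_UN_disjoint) (auto simp: finite_degree_Collect)
  finally show ?thesis
    unfolding hilbert_fun_def .
qed

text \<open>Each additional variable sums the previous Hilbert function, and
  \<open>sum_choose_lower\<close> is the hockey-stick identity. The start is the ring without
  variables, whose only term is 1.\<close>

lemma hilbert_fun_empty: "l \<le> n \<Longrightarrow> hilbert_fun l n {} t = (n - l + t) choose t"
proof (induction "n - l" arbitrary: l t)
  case 0
  have "hilbert_fun (Suc n) n {} v = (if v = 0 then 1 else 0)" for v
    by (auto simp: hilbert_fun_def terms_of_trivial)
  then have "hilbert_fun n n (term_ext n n {}) t = 1"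
    by (subst hilbert_fun_ext) simp_all
  then show ?case
    using 0 by (simp add: term_ext_def)
next
  case (Suc k)
  then have k: "k = n - Suc l" "Suc l \<le> n"
    by auto
  have "hilbert_fun (Suc l) n {} v = (k + v) choose v" for v
    using Suc(1)[OF k, of v] unfolding k(1)[symmetric] .
  then have "hilbert_fun l n (term_ext l n {}) t = (\<Sum>v\<le>t. (k + v) choose v)"
    using Suc.prems by (subst hilbert_fun_ext) simp_all
  also have "\<dots> = Suc (k + t) choose t"
    by (rule sum_choose_lower)
  finally show ?case
    unfolding Suc(2)[symmetric] by (simp add: term_ext_def)
qed

lemma card_degree_component:
  assumes "A \<subseteq> terms_of l n" "l \<le> n"
  shows "card {\<alpha> \<in> A. tdeg \<alpha> = s} + hilbert_fun l n A s = (n + s - l) choose s"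
  using hilbert_fun_add[OF assms(1), of "{}" s] hilbert_fun_empty[OF assms(2), of s] assms(2)
  by (simp add: add.commute)


subsection \<open>Gotzmann sums\<close>

text \<open>The Gotzmann representation with summand i switched off before degree i. With this
  cutoff, summation over degrees raises every entry by exactly one and leaves no boundary terms
  (\<open>gotzmann_sum_map_Suc\<close>); from degree \<open>length as\<close> on the polynomial
  itself is obtained.\<close>

definition gotzmann_sum :: "nat list \<Rightarrow> nat \<Rightarrow> nat" where
  "gotzmann_sum as t = (\<Sum>i<length as. if i \<le> t then (t - i + as ! i) choose (as ! i) else 0)"

lemma gotzmann_sum_snoc:
  "gotzmann_sum (as @ [a]) t = gotzmann_sum as t + (if length as \<le> t then (t - length as + a) choose a else 0)"
proof -
  have "(\<Sum>i<length as. if i \<le> t then (t - i + (as @ [a]) ! i) choose ((as @ [a]) ! i) else 0)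
      = gotzmann_sum as t"
    unfolding gotzmann_sum_def by (rule sum.cong) (auto simp: nth_append)
  then show ?thesis
    by (simp add: gotzmann_sum_def)
qed

text \<open>The zeros sit at consecutive positions starting with \<open>length as\<close>, and each
  contributes 1 from the degree of its position on.\<close>

lemma gotzmann_sum_zeros:
  "gotzmann_sum (as @ replicate c 0) t = gotzmann_sum as t + min c (Suc t - length as)"
proof (induction c)
  case (Suc c)
  have "gotzmann_sum (as @ replicate (Suc c) 0) t = gotzmann_sum ((as @ replicate c 0) @ [0]) t"
    by (simp add: replicate_append_same)
  then show ?case
    unfolding gotzmann_sum_snoc Suc.IH by auto
qed simp

lemma hockey_stick_shifted:
  "(\<Sum>v\<le>t. if i \<le> v then (v - i + b) choose b else 0)
    = (if i \<le> t then (t - i + Suc b) choose Suc b else (0::nat))"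
proof (induction t)
  case (Suc t)
  show ?case
  proof (cases "i \<le> t")
    case True
    then show ?thesis
      using Suc by (simp add: Suc_diff_le)
  next
    case False
    then show ?thesis
      using Suc by (auto simp: not_le)
  qed
qed auto

lemma gotzmann_sum_map_Suc: "gotzmann_sum (map Suc bs) t = (\<Sum>v\<le>t. gotzmann_sum bs v)"
  unfolding gotzmann_sum_def
  by (subst sum.swap) (auto simp: hockey_stick_shifted intro!: sum.cong)

text \<open>Until d dies, it contributes at least 1 in every degree from r on. If c is its total, d
  must be exhausted by degree r + c. This is the origin of the c zeros in the Gotzmann
  representation.\<close>

lemma partial_sum_bounds:
  fixes d :: "nat \<Rightarrow> nat"
  assumes persist: "\<And>v. r \<le> v \<Longrightarrow> d v = 0 \<Longrightarrow> d (Suc v) = 0"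
    and fin: "\<And>v. V \<le> v \<Longrightarrow> d v = 0"
  obtains c where "\<And>u. min c (Suc u - r) \<le> (\<Sum>v\<le>u. d v)" "\<And>u. r + c \<le> u \<Longrightarrow> d u = 0"
    "\<And>u. r + c \<le> Suc u \<Longrightarrow> (\<Sum>v\<le>u. d v) = c"
proof -
  define c where "c = (\<Sum>v<V. d v)"
  have zero: "d v = 0" if "r \<le> u" "d u = 0" "u \<le> v" for u v
    using that(3) by (induction v rule: dec_induct) (use that persist in auto)
  have below: "(\<Sum>v\<le>u. d v) \<le> c" for u
  proof -
    have "(\<Sum>v\<le>u. d v) = (\<Sum>v\<in>{..u} \<inter> {..<V}. d v)"
      using fin by (intro sum.mono_neutral_right) (auto simp: not_less)
    also have "\<dots> \<le> c"
      unfolding c_def by (rule sum_mono2) auto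
    finally show ?thesis .
  qed
  have full: "(\<Sum>v\<le>u. d v) = c" if "\<And>v. u < v \<Longrightarrow> d v = 0" for u
  proof (rule antisym[OF below])
    have "c = (\<Sum>v\<in>{..<V} \<inter> {..u}. d v)"
      unfolding c_def using that by (intro sum.mono_neutral_right) (auto, metis neq0_conv not_le)
    also have "\<dots> \<le> (\<Sum>v\<le>u. d v)"
      by (rule sum_mono2) auto
    finally show "c \<le> (\<Sum>v\<le>u. d v)" .
  qed
  \<comment> \<open>Persistence, read backwards: if d is nonzero at u, it is nonzero on all of r,
    ..., u.\<close>
  have pos: "Suc u - r \<le> (\<Sum>v\<le>u. d v)" if "d u \<noteq> 0" for u
  proof -
    have "1 \<le> d v" if "v \<in> {r..u}" for v
      using zero[of v u] that \<open>d u \<noteq> 0\<close> by (cases "d v") auto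
    then have "(\<Sum>v\<in>{r..u}. 1) \<le> (\<Sum>v\<in>{r..u}. d v)"
      by (intro sum_mono) auto
    also have "\<dots> \<le> (\<Sum>v\<le>u. d v)"
      by (rule sum_mono2) auto
    finally show ?thesis
      by simp
  qed
  show thesis
  proof (rule that)
    fix u
    show "min c (Suc u - r) \<le> (\<Sum>v\<le>u. d v)"
    \<comment> \<open>Either d has died and the sum is already the total c, or all the degrees r,
      ..., u contribute.\<close>
    proof (cases "d u = 0 \<and> r \<le> u")
      case True
      then have "d v = 0" if "u < v" for v
        using zero[of u v] that by simp
      then show ?thesis
        using full[of u] by simp
    next
      case False
      then show ?thesis
        using pos[of u] by (cases "r \<le> u") auto
    qed
  next
    fix u assume u: "r + c \<le> u"
    show "d u = 0"
    proof (rule ccontr)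
      assume "d u \<noteq> 0"
      then show False
        using pos[of u] below[of u] u by auto
    qed
  next
    fix u assume u: "r + c \<le> Suc u"
    \<comment> \<open>The sum up to u is complete as soon as d vanishes from u + 1 on, hence the
      bound on \<open>Suc u\<close>.\<close>
    have "d (Suc u) = 0"
    proof (rule ccontr)
      assume "d (Suc u) \<noteq> 0"
      then show False
        using pos[of "Suc u"] below[of "Suc u"] u by auto
    qed
    then have "d v = 0" if "u < v" for v
      using zero[of "Suc u" v] that u by simp
    then show "(\<Sum>v\<le>u. d v) = c"
      by (rule full)
  qed
qed

section \<open>Comparison with the saturation, and the regularity theorem\<close>

lemma split_degree: "k \<le> tdeg \<beta> \<Longrightarrow> \<exists>\<beta>1 \<beta>2. \<beta> = \<beta>1 + \<beta>2 \<and> tdeg \<beta>1 = k"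
proof (induction k)
  case 0
  then show ?case
    by (intro exI[of _ 0] exI[of _ \<beta>]) simp
next
  case (Suc k)
  then obtain \<beta>1 \<beta>2 where \<beta>: "\<beta> = \<beta>1 + \<beta>2" "tdeg \<beta>1 = k"
    by auto
  then have "0 < tdeg \<beta>2"
    using Suc.prems by (simp add: tdeg_add)
  then obtain i where "lookup \<beta>2 i \<noteq> 0"
    using ex_factor by blast
  then have "\<beta>2 = single i 1 + (\<beta>2 - single i 1)"
    using pterm_diff_add[of 1 \<beta>2 i] by (simp add: add.commute)
  then have "\<beta> = (\<beta>1 + single i 1) + (\<beta>2 - single i 1)"
    using \<beta>(1) by (simp add: add.assoc)
  then show ?case
    using \<beta>(2) tdeg_add_single[of \<beta>1 i 1] by (metis Suc_eq_plus1)
qed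

text \<open>From degree r on the saturation is generated by its finitely many terms of degree r. If
  M bounds the degrees that carry each of these into A, then everything of degree at least r + M
  lies in A.\<close>

lemma eventually_eq_sat:
  assumes "term_ideal l n A" "stably_generated n r (term_sat l n A)"
  obtains V where "\<And>\<alpha>. \<alpha> \<in> term_sat l n A \<Longrightarrow> V \<le> tdeg \<alpha> \<Longrightarrow> \<alpha> \<in> A"
proof -
  let ?B = "{\<alpha> \<in> term_sat l n A. tdeg \<alpha> = r}"
  have fin: "finite ?B"
    by (rule finite_subset[OF _ finite_terms_of_degree[of l n r]]) (auto simp: term_sat_def)
  have "\<forall>\<alpha>\<in>?B. \<exists>m. \<forall>\<beta>\<in>terms_of l n. tdeg \<beta> = m \<longrightarrow> \<alpha> + \<beta> \<in> A"
    by (simp add: term_sat_def)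
  then obtain m where "\<forall>\<alpha>\<in>?B. \<forall>\<beta>\<in>terms_of l n. tdeg \<beta> = m \<alpha> \<longrightarrow> \<alpha> + \<beta> \<in> A"
    by (rule bchoice[THEN exE])
  then have m: "\<alpha> + \<beta> \<in> A" if "\<alpha> \<in> ?B" "\<beta> \<in> terms_of l n" "tdeg \<beta> = m \<alpha>" for \<alpha> \<beta>
    using that by blast
  define M where "M = Max (insert 0 (m ` ?B))"
  have M: "m \<alpha> \<le> M" if "\<alpha> \<in> ?B" for \<alpha>
    unfolding M_def using fin that by (intro Max_ge) auto
  define C where "C = {\<gamma> \<in> terms_of l n. \<forall>\<beta>\<in>terms_of l n. M \<le> tdeg \<beta> \<longrightarrow> \<gamma> + \<beta> \<in> A}"
  have base: "\<alpha> \<in> C" if "\<alpha> \<in> term_sat l n A" "tdeg \<alpha> = r" for \<alpha>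
    unfolding C_def
  proof (intro CollectI conjI ballI impI)
    show "\<alpha> \<in> terms_of l n"
      using that(1) by (simp add: term_sat_def)
    fix \<beta> assume \<beta>: "\<beta> \<in> terms_of l n" "M \<le> tdeg \<beta>"
    then have "m \<alpha> \<le> tdeg \<beta>"
      using M[of \<alpha>] that by simp
    then obtain \<beta>1 \<beta>2 where \<beta>12: "\<beta> = \<beta>1 + \<beta>2" "tdeg \<beta>1 = m \<alpha>"
      using split_degree by blast
    then have "\<beta>1 \<in> terms_of l n" "\<beta>2 \<in> terms_of l n"
      using \<beta>(1) by (auto simp: add_in_terms_of_iff)
    then have "\<alpha> + \<beta>1 + \<beta>2 \<in> A"
      using term_idealD[OF assms(1) m] that \<beta>12(2) by blast
    then show "\<alpha> + \<beta> \<in> A"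
      by (simp add: \<beta>12(1) add.assoc)
  qed
  have "\<alpha> \<in> A" if big: "\<alpha> \<in> term_sat l n A" "r + M \<le> tdeg \<alpha>" for \<alpha>
  proof -
    \<comment> \<open>Dividing by one variable at a time inside the saturation reaches a divisor of
      degree r.\<close>
    have *: "\<exists>\<beta> \<gamma>. \<alpha> = \<beta> + \<gamma> \<and> \<beta> \<in> term_sat l n A \<and> tdeg \<beta> = r" if "\<alpha> \<in> term_sat l n A" "r \<le> tdeg \<alpha>" for \<alpha>
      using that
    proof (induction "tdeg \<alpha> - r" arbitrary: \<alpha>)
      case 0
      then show ?case
        by (intro exI[of _ \<alpha>] exI[of _ 0]) simp
    next
      case (Suc k)
      then have "r < tdeg \<alpha>"
        by simp
      with Suc.prems(1) obtain i \<delta> where \<delta>: "\<delta> \<in> term_sat l n A" "\<alpha> = \<delta> + single i 1"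
        by (rule stably_generated_divisor[OF assms(2)])
      have "k = tdeg \<delta> - r" "r \<le> tdeg \<delta>"
        using Suc(2) \<open>r < tdeg \<alpha>\<close> unfolding \<delta>(2) tdeg_add_single by linarith+
      then obtain \<beta> \<gamma> where "\<delta> = \<beta> + \<gamma>" "\<beta> \<in> term_sat l n A" "tdeg \<beta> = r"
        using Suc(1)[of \<delta>] \<delta>(1) by blast
      then show ?case
        using \<delta>(2) add.assoc by blast
    qed
    obtain \<beta> \<gamma> where \<beta>: "\<alpha> = \<beta> + \<gamma>" "\<beta> \<in> term_sat l n A" "tdeg \<beta> = r"
      using *[OF big(1)] big(2) by force
    moreover have "\<gamma> \<in> terms_of l n"
      using big(1) \<beta>(1) by (auto simp: term_sat_def add_in_terms_of_iff)
    moreover have "M \<le> tdeg \<gamma>"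
      using big(2) \<beta> by (simp add: tdeg_add)
    ultimately show ?thesis
      using base[OF \<beta>(2,3)] by (auto simp: C_def)
  qed
  then show thesis
    using that by blast
qed

text \<open>The length of \<open>as\<close> is the Gotzmann number.  In the induction step the restriction of the
  ideal to the larger variables has colength \<open>c\<close> in its saturation, to which \<open>bs\<close> belongs; as
  the latter is generated in degree \<open>length bs\<close>, the two differ in every degree from there on
  until they agree, so that they agree from degree \<open>length bs + c\<close> on.\<close>

lemma gotzmann_regularity:
  assumes "term_ideal l n A" "move_closed p l n A" "p \<noteq> 1" "term_sat l n A = A"
  shows "\<exists>as. sorted_wrt (\<ge>) as \<and> (\<forall>t. gotzmann_sum as t \<le> hilbert_fun l n A t) \<and>
    (\<forall>t\<ge>length as. hilbert_fun l n A t = gotzmann_sum as t) \<and> stably_generated n (length as) A"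
  using assms
proof (induction "Suc n - l" arbitrary: l A)
  case 0
  then have "A = {0}"
    using term_sat_trivial[of n l A] terms_of_trivial[of n l] by simp
  then show ?case
    using 0(1) by (intro exI[of _ "[]"])
      (auto simp: gotzmann_sum_def hilbert_fun_def terms_of_trivial stably_generated_def)
next
  case (Suc k)
  note A = Suc.prems
  have l: "l \<le> n" and k: "k = Suc n - Suc l"
    using Suc(2) by auto
  define A' where "A' = term_slice l A"
  define J where "J = term_sat (Suc l) n A'"
  have A': "term_ideal (Suc l) n A'" "move_closed p (Suc l) n A'"
    unfolding A'_def by (rule term_ideal_slice[OF A(1)] move_closed_slice[OF A(2)])+
  have J: "term_ideal (Suc l) n J" "move_closed p (Suc l) n J" "term_sat (Suc l) n J = J"
    unfolding J_def
    using term_ideal_sat[OF A'(1)] move_closed_sat[OF A' A(3)] term_sat_idem[OF A' A(3)] by auto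
  obtain bs where bs: "sorted_wrt (\<ge>) bs" "\<And>t. gotzmann_sum bs t \<le> hilbert_fun (Suc l) n J t"
    "\<And>t. length bs \<le> t \<Longrightarrow> hilbert_fun (Suc l) n J t = gotzmann_sum bs t"
    "stably_generated n (length bs) J"
    using Suc(1)[OF k J(1,2) A(3) J(3)] by auto
  have A'J: "A' \<subseteq> J"
    unfolding J_def by (rule subset_term_sat[OF A'(1)])
  have JT: "J \<subseteq> terms_of (Suc l) n"
    by (rule term_ideal_subset[OF J(1)])
  \<comment> \<open>Excess of the Hilbert function of the slice over the Gotzmann sum of its
    saturation. The subtraction is exact because the Gotzmann sum is a lower bound in every degree;
    the induction carries that bound along for this purpose.\<close>
  define d where "d v = hilbert_fun (Suc l) n A' v - gotzmann_sum bs v" for v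
  have d: "hilbert_fun (Suc l) n A' v = gotzmann_sum bs v + d v" for v
    unfolding d_def using bs(2)[of v] hilbert_fun_antimono[OF A'J, of "Suc l" n v] by simp
  have d0: "(\<alpha> \<in> A' \<longleftrightarrow> \<alpha> \<in> J)" if "length bs \<le> v" "d v = 0" "tdeg \<alpha> = v" for v \<alpha>
  proof -
    have "hilbert_fun (Suc l) n A' v = hilbert_fun (Suc l) n J v"
      using d[of v] bs(3)[OF that(1)] that(2) by simp
    then show ?thesis
      using hilbert_fun_eqD[OF JT A'J _ _ that(3)] A'J by blast
  qed
  have eq_d0: "d v = 0" if "length bs \<le> v" "\<And>\<alpha>. \<alpha> \<in> J \<Longrightarrow> tdeg \<alpha> = v \<Longrightarrow> \<alpha> \<in> A'" for v
  proof -
    have "hilbert_fun (Suc l) n A' v = hilbert_fun (Suc l) n J v"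
      using that(2) A'J by (intro hilbert_fun_cong) auto
    then show ?thesis
      using d[of v] bs(3)[OF that(1)] by simp
  qed
  \<comment> \<open>Agreement in degree v passes to degree v + 1, since beyond
    \<open>length bs\<close> every term of J is a variable times a term of J.\<close>
  have persist: "d (Suc v) = 0" if "length bs \<le> v" "d v = 0" for v
  proof (rule eq_d0)
    fix \<alpha> assume \<alpha>: "\<alpha> \<in> J" "tdeg \<alpha> = Suc v"
    with that(1) have "length bs < tdeg \<alpha>"
      by simp
    with \<alpha>(1) obtain i \<beta> where \<beta>: "\<beta> \<in> J" "\<alpha> = \<beta> + single i 1"
      by (rule stably_generated_divisor[OF bs(4)])
    then have "tdeg \<beta> = v" "single i 1 \<in> terms_of (Suc l) n"
      using \<alpha> JT by (auto simp: tdeg_add_single add_in_terms_of_iff)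
    then show "\<alpha> \<in> A'"
      using d0[OF that, of \<beta>] \<beta> term_idealD[OF A'(1), of \<beta>] by auto
  qed (use that in simp)
  obtain V where V: "\<And>\<alpha>. \<alpha> \<in> J \<Longrightarrow> V \<le> tdeg \<alpha> \<Longrightarrow> \<alpha> \<in> A'"
    using eventually_eq_sat[OF A'(1)] bs(4) unfolding J_def by blast
  have "d v = 0" if "length bs + V \<le> v" for v
    using that V by (intro eq_d0) auto
  \<comment> \<open>c sums d over all degrees: besides the colength of \<open>A'\<close> in J it
    counts the excess of the Hilbert function of J over \<open>gotzmann_sum bs\<close> in degrees
    below \<open>length bs\<close>.\<close>
  then obtain c where c: "\<And>u. min c (Suc u - length bs) \<le> (\<Sum>v\<le>u. d v)"
      "\<And>u. length bs + c \<le> u \<Longrightarrow> d u = 0"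
      "\<And>u. length bs + c \<le> Suc u \<Longrightarrow> (\<Sum>v\<le>u. d v) = c"
    using partial_sum_bounds[of "length bs" d "length bs + V"] persist by blast
  have sum: "hilbert_fun l n A t = gotzmann_sum (map Suc bs) t + (\<Sum>v\<le>t. d v)" for t
    using hilbert_fun_ext[OF l, of A' t] term_ext_slice[OF A l]
    by (simp add: A'_def[symmetric] d sum.distrib gotzmann_sum_map_Suc)
  have len: "length (map Suc bs @ replicate c 0) = length bs + c"
    by simp
  show ?case
  \<comment> \<open>Summation over degrees raises each entry of \<open>bs\<close> by one, and the
    total excess c becomes c entries 0.\<close>
  proof (intro exI[of _ "map Suc bs @ replicate c 0"] conjI allI impI)
    show "sorted_wrt (\<ge>) (map Suc bs @ replicate c 0)"
      using bs(1) by (auto simp: sorted_wrt_append sorted_wrt_map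
          sorted_wrt_iff_nth_less[of _ "replicate c 0"])
    fix t
    show "gotzmann_sum (map Suc bs @ replicate c 0) t \<le> hilbert_fun l n A t"
      using c(1)[of t] by (simp add: sum gotzmann_sum_zeros)
    show "hilbert_fun l n A t = gotzmann_sum (map Suc bs @ replicate c 0) t"
      if "length (map Suc bs @ replicate c 0) \<le> t"
      using c(3)[of t] that by (simp add: sum gotzmann_sum_zeros)
  next
    have same: "\<alpha> \<in> A' \<longleftrightarrow> \<alpha> \<in> J" if "length bs + c \<le> tdeg \<alpha>" for \<alpha>
      using d0[of "tdeg \<alpha>" \<alpha>] c(2)[OF that] that by simp
    have Jc: "stably_generated n (length bs + c) J"
      by (rule stably_generated_mono[OF bs(4)]) simp
    \<comment> \<open>From degree \<open>length bs + c\<close> on the slice equals J, and all terms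
      occurring in the two conditions have at least that degree.\<close>
    have "stably_generated n (length bs + c) A'"
      unfolding stably_generated_def
    proof (intro conjI ballI allI impI)
      fix \<alpha> j assume \<alpha>: "\<alpha> \<in> A'"
        and *: "length bs + c \<le> tdeg \<alpha> \<and> \<alpha> \<noteq> 0 \<and> tmin \<alpha> < j \<and> j \<le> n"
      have "\<alpha> - single (tmin \<alpha>) 1 + single j 1 \<in> J"
        using stably_generated_stable[OF Jc, of \<alpha> j] \<alpha> A'J * by auto
      moreover have "tdeg (\<alpha> - single (tmin \<alpha>) 1 + single j 1) = tdeg \<alpha>"
        using tdeg_move[of 1 \<alpha> "tmin \<alpha>" j] lookup_tmin[of \<alpha>] * by (simp add: increasing_move_def)
      ultimately show "\<alpha> - single (tmin \<alpha>) 1 + single j 1 \<in> A'"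
        using same * by simp
    next
      fix \<alpha> assume \<alpha>: "\<alpha> \<in> A'" "length bs + c < tdeg \<alpha>"
      then have "\<exists>i. lookup \<alpha> i \<noteq> 0 \<and> \<alpha> - single i 1 \<in> J"
        using Jc A'J unfolding stably_generated_def by blast
      then obtain i where i: "lookup \<alpha> i \<noteq> 0" "\<alpha> - single i 1 \<in> J"
        by blast
      have "tdeg (\<alpha> - single i 1) + 1 = tdeg \<alpha>"
        using arg_cong[OF pterm_diff_add[of 1 \<alpha> i], of tdeg] i(1) by (simp add: tdeg_add_single)
      then show "\<exists>i. lookup \<alpha> i \<noteq> 0 \<and> \<alpha> - single i 1 \<in> A'"
        using i same[of "\<alpha> - single i 1"] \<alpha>(2) by auto
    qed
    then show "stably_generated n (length (map Suc bs @ replicate c 0)) A"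
      unfolding len A'_def by (rule stably_generated_of_slice[OF A l])
  qed
qed


subsection \<open>Uniqueness of the Gotzmann representation\<close>

text \<open>Separates the positive entries, which come from summing over the degrees, from the
  constant part.\<close>

lemma sorted_desc_decomp:
  "sorted_wrt (\<ge>) (as :: nat list) \<Longrightarrow> \<exists>bs c. as = map Suc bs @ replicate c 0 \<and> sorted_wrt (\<ge>) bs"
proof (induction as)
  case Nil
  then show ?case
    by (intro exI[of _ "[]"] exI[of _ 0]) simp
next
  case (Cons a as)
  then obtain bs c where bs: "as = map Suc bs @ replicate c 0" "sorted_wrt (\<ge>) bs"
    by auto
  show ?case
  proof (cases a)
    case 0
    then have "bs = []"
      using Cons.prems bs(1) by (cases bs) auto
    then show ?thesis
      using 0 bs(1) by (intro exI[of _ "[]"] exI[of _ "Suc c"]) simp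
  next
    case (Suc b)
    then show ?thesis
      using Cons.prems bs by (intro exI[of _ "b # bs"] exI[of _ c]) auto
  qed
qed

lemma gotzmann_sum_decomp:
  "gotzmann_sum (map Suc bs @ replicate c 0) t
    = (\<Sum>v\<le>t. gotzmann_sum bs v) + min c (Suc t - length bs)"
  by (simp add: gotzmann_sum_zeros gotzmann_sum_map_Suc)

text \<open>A difference of consecutive values deletes the zeros and lowers the other entries by
  one, so induction on a bound for the entries applies. Once the positive parts agree, the values
  determine the number of zeros.\<close>

lemma gotzmann_sum_unique:
  assumes "sorted_wrt (\<ge>) as" "sorted_wrt (\<ge>) as'"
    "\<And>t. T \<le> t \<Longrightarrow> gotzmann_sum as t = gotzmann_sum as' t"
  shows "as = as'"
proof -
  have "\<lbrakk>\<forall>a\<in>set as \<union> set as'. a < m; sorted_wrt (\<ge>) as; sorted_wrt (\<ge>) as';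
      \<And>t. T \<le> t \<Longrightarrow> gotzmann_sum as t = gotzmann_sum as' t\<rbrakk> \<Longrightarrow> as = as'" for m T
  proof (induction m arbitrary: as as' T)
    case 0
    then show ?case
      by (cases as; cases as') auto
  next
    case (Suc m)
    obtain bs c where bs: "as = map Suc bs @ replicate c 0" "sorted_wrt (\<ge>) bs"
      using sorted_desc_decomp[OF Suc.prems(2)] by blast
    obtain bs' c' where bs': "as' = map Suc bs' @ replicate c' 0" "sorted_wrt (\<ge>) bs'"
      using sorted_desc_decomp[OF Suc.prems(3)] by blast
    \<comment> \<open>Far enough out for all zeros to be active and for the two sums to
      agree.\<close>
    define T' where "T' = T + length bs + length bs' + c + c'"
    have eq: "(\<Sum>v\<le>t. gotzmann_sum bs v) + c = (\<Sum>v\<le>t. gotzmann_sum bs' v) + c'"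
      if "T' \<le> t" for t
    proof -
      have "min c (Suc t - length bs) = c" "min c' (Suc t - length bs') = c'" "T \<le> t"
        using that unfolding T'_def by auto
      then show ?thesis
        using Suc.prems(4)[of t] unfolding bs(1) bs'(1) gotzmann_sum_decomp by simp
    qed
    have "gotzmann_sum bs t = gotzmann_sum bs' t" if "Suc T' \<le> t" for t
      using eq[of t] eq[of "t - 1"] that by (cases t) auto
    moreover have "\<forall>a\<in>set bs \<union> set bs'. a < m"
      using Suc.prems(1) unfolding bs(1) bs'(1) by auto
    ultimately have "bs = bs'"
      using Suc.IH[OF _ bs(2) bs'(2)] by blast
    moreover from this have "c = c'"
      using eq[of T'] by simp
    ultimately show ?case
      using bs(1) bs'(1) by simp
  qed
  moreover obtain m where "\<forall>a\<in>set as \<union> set as'. a < m"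
    using finite_nat_set_iff_bounded[of "set as \<union> set as'"] by auto
  ultimately show ?thesis
    using assms by blast
qed

lemma of_nat_gotzmann_sum:
  assumes "length as \<le> t"
  shows "of_nat (gotzmann_sum as t)
    = (\<Sum>i<length as. (of_nat t + of_nat (as ! i) - of_nat i :: rat) gchoose (as ! i))"
  unfolding gotzmann_sum_def of_nat_sum
proof (rule sum.cong)
  fix i assume "i \<in> {..<length as}"
  then have "of_nat (t - i + as ! i) = (of_nat t + of_nat (as ! i) - of_nat i :: rat)" "i \<le> t"
    using assms by (simp_all add: of_nat_diff)
  then show "of_nat (if i \<le> t then (t - i + as ! i) choose (as ! i) else 0)
      = (of_nat t + of_nat (as ! i) - of_nat i :: rat) gchoose (as ! i)"
    by (simp add: binomial_gbinomial)
qed simp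

lemma gotzmann_number_sum:
  assumes "is_gotzmann_number P r"
  shows "\<exists>as. length as = r \<and> sorted_wrt (\<ge>) as \<and>
    (\<forall>t\<ge>r. poly P (of_nat t) = of_nat (gotzmann_sum as t))"
  using assms of_nat_gotzmann_sum unfolding is_gotzmann_number_def by metis

text \<open>By Pascal's rule the difference lowers the positive entries by one, and the zero entries
  cancel. So a bound s for the Gotzmann number remains one in the recursive call.\<close>

lemma gotzmann_number_backward_diff:
  assumes "is_gotzmann_number P r"
  obtains r' where "r' \<le> r" "is_gotzmann_number (backward_diff P) r'"
proof -
  obtain as where as: "length as = r" "sorted_wrt (\<ge>) as"
      "\<And>z. poly P z = (\<Sum>i<r. (z + of_nat (as ! i) - of_nat i) gchoose (as ! i))"
    using assms by (auto simp: is_gotzmann_number_def)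
  obtain bs c where bs: "as = map Suc bs @ replicate c 0" "sorted_wrt (\<ge>) bs"
    using sorted_desc_decomp[OF as(2)] by blast
  have r: "r = length bs + c"
    using as(1) bs(1) by simp
  have P: "poly P z = (\<Sum>i<length bs. (z + of_nat (Suc (bs ! i)) - of_nat i) gchoose Suc (bs ! i))
      + of_nat c" for z
  proof -
    have "poly P z = (\<Sum>i<length bs. (z + of_nat (as ! i) - of_nat i) gchoose (as ! i))
        + (\<Sum>i<c. (z + of_nat (as ! (length bs + i)) - of_nat (length bs + i)) gchoose (as ! (length bs + i)))"
      unfolding as(3) r by (induction c) (simp_all add: add.assoc)
    then show ?thesis
      unfolding bs(1) by (simp add: nth_append)
  qed
  have "poly (backward_diff P) z = (\<Sum>i<length bs. (z + of_nat (bs ! i) - of_nat i) gchoose (bs ! i))"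
    for z
  proof -
    have "(z + of_nat (Suc (bs ! i)) - of_nat i gchoose Suc (bs ! i))
        - (z - 1 + of_nat (Suc (bs ! i)) - of_nat i gchoose Suc (bs ! i))
        = (z + of_nat (bs ! i) - of_nat i) gchoose (bs ! i)" for i
      using gbinomial_Suc_Suc[of "z + of_nat (bs ! i) - of_nat i" "bs ! i"]
      by (simp add: algebra_simps)
    then show ?thesis
      by (simp add: backward_diff_def poly_pcompose P add.commute[of "-1"]
          flip: sum_subtractf diff_conv_add_uminus)
  qed
  then have "is_gotzmann_number (backward_diff P) (length bs)"
    using bs(2) unfolding is_gotzmann_number_def by blast
  then show thesis
    using that[of "length bs"] r by simp
qed

text \<open>A nonzero P has at least one summand; in degrees from r on all summands are natural
  numbers, and the first is positive.\<close>

lemma gotzmann_poly_pos: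
  assumes "is_gotzmann_number P r" "P \<noteq> 0" "r \<le> s"
  shows "0 < poly P (of_nat s)"
proof -
  obtain as where as: "length as = r" "sorted_wrt (\<ge>) as"
      "\<And>t. r \<le> t \<Longrightarrow> poly P (of_nat t) = of_nat (gotzmann_sum as t)"
    using gotzmann_number_sum[OF assms(1)] by auto
  have "r \<noteq> 0"
  proof
    assume "r = 0"
    then have "poly P z = 0" for z
      using assms(1) by (simp add: is_gotzmann_number_def)
    then show False
      using assms(2) poly_all_0_iff_0 by blast
  qed
  then have "0 < gotzmann_sum as s"
    unfolding gotzmann_sum_def using as(1) by (intro sum_pos2[of _ 0]) auto
  then show ?thesis
    using as(3)[OF assms(3)] by simp
qed


subsection \<open>Hilbert polynomials\<close>

definition has_hilbert_poly :: "nat \<Rightarrow> nat \<Rightarrow> pterm set \<Rightarrow> rat poly \<Rightarrow> bool" where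
  "has_hilbert_poly l n A P \<longleftrightarrow>
     (\<forall>\<^sub>F t in sequentially. of_nat (hilbert_fun l n A t) = poly P (of_nat t))"

text \<open>The list found for A and the one representing P give the same values in high degrees, so
  they are equal and the regularity of A is governed by r.\<close>

lemma hilbert_poly_regularity:
  assumes "term_ideal l n A" "move_closed p l n A" "p \<noteq> 1" "term_sat l n A = A"
    "has_hilbert_poly l n A P" "is_gotzmann_number P r"
  shows "stably_generated n r A" "r \<le> t \<Longrightarrow> of_nat (hilbert_fun l n A t) = poly P (of_nat t)"
proof -
  obtain as where as: "sorted_wrt (\<ge>) as"
    "\<And>t. gotzmann_sum as t \<le> hilbert_fun l n A t"
    "\<And>t. length as \<le> t \<Longrightarrow> hilbert_fun l n A t = gotzmann_sum as t"
    "stably_generated n (length as) A"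
    using gotzmann_regularity[OF assms(1-4)] by auto
  obtain bs where bs: "length bs = r" "sorted_wrt (\<ge>) bs"
      "\<And>t. r \<le> t \<Longrightarrow> poly P (of_nat t) = of_nat (gotzmann_sum bs t)"
    using gotzmann_number_sum[OF assms(6)] by auto
  obtain T where "\<And>t. T \<le> t \<Longrightarrow> of_nat (hilbert_fun l n A t) = poly P (of_nat t)"
    using assms(5) by (auto simp: has_hilbert_poly_def eventually_sequentially)
  then have "gotzmann_sum as t = gotzmann_sum bs t" if "T + r + length as \<le> t" for t
    using as(3)[of t] bs(3)[of t] that by (metis add_leD1 add_leD2 of_nat_eq_iff)
  then have "as = bs"
    using gotzmann_sum_unique[OF as(1) bs(2)] by blast
  then show "stably_generated n r A" "r \<le> t \<Longrightarrow> of_nat (hilbert_fun l n A t) = poly P (of_nat t)"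
    using as bs by auto
qed

text \<open>The ideal and its saturation agree in all high degrees.\<close>

lemma has_hilbert_poly_sat:
  assumes "term_ideal l n A" "move_closed p l n A" "p \<noteq> 1"
  shows "has_hilbert_poly l n (term_sat l n A) P \<longleftrightarrow> has_hilbert_poly l n A P"
proof -
  obtain r where "stably_generated n r (term_sat l n A)"
    using gotzmann_regularity[OF term_ideal_sat[OF assms(1)] move_closed_sat[OF assms] assms(3)
        term_sat_idem[OF assms]] by blast
  with assms(1) obtain V where V: "\<And>\<alpha>. \<alpha> \<in> term_sat l n A \<Longrightarrow> V \<le> tdeg \<alpha> \<Longrightarrow> \<alpha> \<in> A"
    by (rule eventually_eq_sat) blast
  have "hilbert_fun l n (term_sat l n A) t = hilbert_fun l n A t" if "V \<le> t" for t
    using that V subset_term_sat[OF assms(1)] by (intro hilbert_fun_cong) auto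
  then have "\<forall>\<^sub>F t in sequentially. hilbert_fun l n (term_sat l n A) t = hilbert_fun l n A t"
    by (auto simp: eventually_sequentially)
  then show ?thesis
    unfolding has_hilbert_poly_def
    by (intro eventually_subst) (auto elim: eventually_mono)
qed

lemma poly_backward_diff_Suc:
  "poly (backward_diff P) (of_nat (Suc t)) = poly P (of_nat (Suc t)) - poly P (of_nat t)"
  by (simp add: backward_diff_def poly_pcompose)

text \<open>A saturated ideal is the extension of its slice, so the Hilbert function of the slice is
  the first difference of that of the ideal.\<close>

lemma has_hilbert_poly_slice:
  assumes "term_ideal l n A" "move_closed p l n A" "p \<noteq> 1" "term_sat l n A = A" "l \<le> n"
    "has_hilbert_poly l n A P"
  shows "has_hilbert_poly (Suc l) n (term_slice l A) (backward_diff P)"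
proof -
  obtain T where T: "\<And>t. T \<le> t \<Longrightarrow> of_nat (hilbert_fun l n A t) = poly P (of_nat t)"
    using assms(6) by (auto simp: has_hilbert_poly_def eventually_sequentially)
  have "of_nat (hilbert_fun (Suc l) n (term_slice l A) t) = poly (backward_diff P) (of_nat t)"
    if t: "Suc T \<le> t" for t
  proof -
    obtain u where u: "t = Suc u" "T \<le> u"
      using t by (cases t) auto
    have "hilbert_fun l n A (Suc u) = hilbert_fun l n A u + hilbert_fun (Suc l) n (term_slice l A) (Suc u)"
      using hilbert_fun_ext[OF assms(5), of "term_slice l A"] term_ext_slice[OF assms(1-5)] by simp
    then show ?thesis
      using T[of u] T[of "Suc u"] u(2) unfolding u(1) poly_backward_diff_Suc
      by (metis add_diff_cancel_left' le_SucI of_nat_add)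
  qed
  then show ?thesis
    by (auto simp: has_hilbert_poly_def eventually_sequentially)
qed


section \<open>Removing a term\<close>

lemma less_p_invariants:
  assumes "less_p p l n \<alpha> \<beta>"
  shows "tdeg \<beta> = tdeg \<alpha>" "weight \<alpha> < weight \<beta>" "move_closed p l n C \<Longrightarrow> \<alpha> \<in> C \<Longrightarrow> \<beta> \<in> C"
proof -
  have step: "tdeg \<gamma> = tdeg \<beta> \<and> weight \<beta> < weight \<gamma>" if "admissible_step p l n \<beta> \<gamma>" for \<beta> \<gamma>
    using that by (auto simp: admissible_step_def tdeg_move weight_move)
  show "tdeg \<beta> = tdeg \<alpha>"
    using assms unfolding less_p_def by (induction rule: tranclp_induct) (auto dest: step)
  show "weight \<alpha> < weight \<beta>"
    using assms unfolding less_p_def by (induction rule: tranclp_induct) (auto dest: step)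
  show "\<beta> \<in> C" if "move_closed p l n C" "\<alpha> \<in> C"
    using assms unfolding less_p_def
    by (induction rule: tranclp_induct) (use that in \<open>auto simp: move_closed_def\<close>)
qed

text \<open>Stability absorbs all multiples of the removed term \<open>\<alpha>\<close> except its products with
  powers of the smallest variable, and these leave the ideal because an ideal that is stable and
  generated in degree \<open>s\<close> is saturated from degree \<open>s\<close> on.\<close>

lemma remove_term_span:
  assumes A: "term_ideal l n A" "move_closed p l n A" "stably_generated n s A" "l \<le> n"
    and \<alpha>: "\<alpha> \<in> A" "tdeg \<alpha> = s" "lookup \<alpha> l \<noteq> 0"
    and pmin: "\<And>\<beta>. \<beta> \<in> A \<Longrightarrow> tdeg \<beta> = s \<Longrightarrow> \<not> admissible_step p l n \<beta> \<alpha>"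
    and stmin: "\<And>\<beta> j. \<beta> \<in> A \<Longrightarrow> tdeg \<beta> = s \<Longrightarrow> \<beta> \<noteq> 0 \<Longrightarrow> tmin \<beta> < j \<Longrightarrow> j \<le> n \<Longrightarrow>
      \<beta> - single (tmin \<beta>) 1 + single j 1 \<noteq> \<alpha>"
    and A'_def: "A' = term_span l n ({\<beta> \<in> A. tdeg \<beta> = s} - {\<alpha>})"
  shows "term_ideal l n A'" "move_closed p l n A'" "stably_generated n s A'"
    "\<And>\<beta>. tdeg \<beta> = s \<Longrightarrow> \<beta> \<in> A' \<longleftrightarrow> \<beta> \<in> A \<and> \<beta> \<noteq> \<alpha>"
    "\<And>t. s \<le> t \<Longrightarrow> hilbert_fun l n A' t = hilbert_fun l n A t + 1"
proof -
  define B where "B = {\<beta> \<in> A. tdeg \<beta> = s} - {\<alpha>}"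
  have A': "A' = term_span l n B"
    by (simp add: A'_def B_def)
  have AT: "A \<subseteq> terms_of l n"
    by (rule term_ideal_subset[OF A(1)])
  have BT: "B \<subseteq> terms_of l n" and Bs: "\<And>\<beta>. \<beta> \<in> B \<Longrightarrow> tdeg \<beta> = s"
    using AT by (auto simp: B_def)
  show ideal: "term_ideal l n A'"
    unfolding A' by (rule term_ideal_span[OF BT])
  show "move_closed p l n A'"
    unfolding A'
  proof (rule move_closed_span[OF BT])
    show "move_closed p l n B"
      unfolding move_closed_def
    proof (intro ballI allI impI)
      fix \<beta> \<gamma> assume \<beta>: "\<beta> \<in> B" and step: "admissible_step p l n \<beta> \<gamma>"
      have "\<gamma> \<in> A"
        using A(2) \<beta> step unfolding move_closed_def B_def by blast
      moreover have "tdeg \<gamma> = s"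
        using step Bs[OF \<beta>] by (auto simp: admissible_step_def tdeg_move)
      moreover have "\<gamma> \<noteq> \<alpha>"
        using pmin \<beta> step by (auto simp: B_def)
      ultimately show "\<gamma> \<in> B"
        by (simp add: B_def)
    qed
  qed
  show stable: "stably_generated n s A'"
    unfolding A'
  proof (rule stably_generated_span[OF BT Bs])
    fix \<beta> j assume \<beta>: "\<beta> \<in> B" "\<beta> \<noteq> 0" "tmin \<beta> < j" "j \<le> n"
    have "\<beta> - single (tmin \<beta>) 1 + single j 1 \<in> A"
      using stably_generated_stable[OF A(3) _ _ \<beta>(2-4)] \<beta>(1) by (auto simp: B_def)
    moreover have "tdeg (\<beta> - single (tmin \<beta>) 1 + single j 1) = s"
      using tdeg_move[of 1 \<beta> "tmin \<beta>" j] lookup_tmin[OF \<beta>(2)] Bs[OF \<beta>(1)]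
      by (simp add: increasing_move_def)
    moreover have "\<beta> - single (tmin \<beta>) 1 + single j 1 \<noteq> \<alpha>"
      using stmin[OF _ _ \<beta>(2-4)] \<beta>(1) by (simp add: B_def)
    ultimately show "\<beta> - single (tmin \<beta>) 1 + single j 1 \<in> B"
      by (simp add: B_def)
  qed
  show deg_s: "\<beta> \<in> A' \<longleftrightarrow> \<beta> \<in> A \<and> \<beta> \<noteq> \<alpha>" if "tdeg \<beta> = s" for \<beta>
    using term_span_same_degree[of B s \<beta> l n] Bs that unfolding A' B_def by blast
  have A'A: "A' \<subseteq> A"
    unfolding A' by (rule term_span_subset[OF A(1)]) (auto simp: B_def)
  have \<alpha>T: "\<alpha> \<in> terms_of l n"
    using AT \<alpha>(1) by blast
  have lost: "\<alpha> + single l m \<notin> A'" for m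
    using stably_generated_cancel[OF stable ideal, of \<alpha> m] deg_s[OF \<alpha>(2)] \<alpha>(2) by auto
  have kept: "\<delta> \<in> A'" if "\<delta> \<in> A" "s \<le> tdeg \<delta>" "\<And>m. \<delta> \<noteq> \<alpha> + single l m" for \<delta>
    using that
  proof (induction "tdeg \<delta> - s" arbitrary: \<delta>)
    case 0
    then show ?case
      using deg_s[of \<delta>] 0(4)[of 0] by simp
  next
    case (Suc k)
    then have "s < tdeg \<delta>"
      by simp
    with Suc.prems(1) obtain i \<gamma> where \<gamma>: "\<gamma> \<in> A" "\<delta> = \<gamma> + single i 1"
      by (rule stably_generated_divisor[OF A(3)])
    have iT: "single i 1 \<in> terms_of l n"
      using Suc.prems(1) AT \<gamma>(2) by (auto simp: add_in_terms_of_iff)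
    have deg: "k = tdeg \<gamma> - s" "s \<le> tdeg \<gamma>"
      using Suc(2) \<open>s < tdeg \<delta>\<close> unfolding \<gamma>(2) tdeg_add_single by linarith+
    show ?case
    proof (cases "\<exists>m. \<gamma> = \<alpha> + single l m")
      case False
      then have "\<gamma> \<in> A'"
        using Suc(1)[OF deg(1) \<gamma>(1) deg(2)] by blast
      then show ?thesis
        unfolding \<gamma>(2) by (rule term_idealD[OF ideal _ iT])
    next
      case True
      then obtain m where m: "\<gamma> = \<alpha> + single l m"
        by blast
      have "i \<noteq> l"
      proof
        assume "i = l"
        then have "\<delta> = \<alpha> + single l (Suc m)"
          unfolding \<gamma>(2) m by (simp add: add.assoc flip: single_add)
        then show False
          using Suc.prems(3) by blast
      qed
      then have i: "l < i" "i \<le> n"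
        using iT by (auto simp: terms_of_def)
      \<comment> \<open>One x_l of \<alpha> is exchanged for x_i. The result survives the removal,
        and \<delta> is its multiple by x_l^(m+1).\<close>
      let ?\<beta> = "\<alpha> - single l 1 + single i 1"
      have "tmin \<alpha> = l" "\<alpha> \<noteq> 0"
        using tmin_eq_bottom[OF \<alpha>T \<alpha>(3)] \<alpha>(3) by auto
      then have "?\<beta> \<in> A"
        using stably_generated_stable[OF A(3) \<alpha>(1), of i] \<alpha>(2) i by simp
      moreover have "tdeg ?\<beta> = s"
        using tdeg_move[of 1 \<alpha> l i] \<alpha>(2,3) by (simp add: increasing_move_def)
      moreover have "lookup ?\<beta> i \<noteq> lookup \<alpha> i"
        using \<open>i \<noteq> l\<close> by (simp add: lookup_add lookup_minus lookup_single)
      then have "?\<beta> \<noteq> \<alpha>"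
        by metis
      ultimately have "?\<beta> \<in> A'"
        using deg_s by blast
      moreover have "\<delta> = ?\<beta> + single l (Suc m)"
        unfolding \<gamma>(2) m using \<alpha>(3) \<open>i \<noteq> l\<close>
        by (intro poly_mapping_eqI) (auto simp: lookup_add lookup_minus lookup_single when_def)
      ultimately show ?thesis
        using term_idealD[OF ideal] single_in_terms_of[of l l n] A(4) by simp
    qed
  qed
  show "hilbert_fun l n A' t = hilbert_fun l n A t + 1" if "s \<le> t" for t
  proof -
    have "{\<delta> \<in> A. tdeg \<delta> = t \<and> \<delta> \<notin> A'} = {\<alpha> + single l (t - s)}"
    proof (intro equalityI subsetI)
      fix \<delta> assume \<delta>: "\<delta> \<in> {\<delta> \<in> A. tdeg \<delta> = t \<and> \<delta> \<notin> A'}"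
      then obtain m where m: "\<delta> = \<alpha> + single l m"
        using kept[of \<delta>] \<open>s \<le> t\<close> by blast
      then have "m = t - s"
        using \<delta> \<alpha>(2) by (auto simp: tdeg_add_single)
      then show "\<delta> \<in> {\<alpha> + single l (t - s)}"
        using m by simp
    next
      fix \<delta> assume "\<delta> \<in> {\<alpha> + single l (t - s)}"
      then show "\<delta> \<in> {\<delta> \<in> A. tdeg \<delta> = t \<and> \<delta> \<notin> A'}"
        using lost term_idealD[OF A(1) \<alpha>(1)] single_in_terms_of[of l l n] A(4) \<open>s \<le> t\<close> \<alpha>(2)
        by (simp add: tdeg_add_single)
    qed
    then show ?thesis
      using hilbert_fun_add[OF AT A'A, of t] by simp
  qed
qed


section \<open>Monomial ideals of polynomials\<close>

definition poly_of :: "pterm set \<Rightarrow> 'k::field mpol set" where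
  "poly_of A = {f. keys f \<subseteq> A}"

lemma mono_in_poly_of [simp]: "(mono_of \<alpha> :: 'k::field mpol) \<in> poly_of A \<longleftrightarrow> \<alpha> \<in> A"
  by (simp add: poly_of_def)

lemma single_in_poly_of: "\<alpha> \<in> A \<Longrightarrow> single \<alpha> (c::'k::field) \<in> poly_of A"
  by (simp add: poly_of_def)

lemma poly_of_subset_iff [simp]: "(poly_of A :: 'k::field mpol set) \<subseteq> poly_of B \<longleftrightarrow> A \<subseteq> B"
proof
  assume *: "(poly_of A :: 'k mpol set) \<subseteq> poly_of B"
  show "A \<subseteq> B"
  proof
    fix \<alpha> assume "\<alpha> \<in> A"
    then have "(mono_of \<alpha> :: 'k mpol) \<in> poly_of B"
      using * by (meson mono_in_poly_of subsetD)
    then show "\<alpha> \<in> B"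
      by simp
  qed
qed (auto simp: poly_of_def)

lemma poly_of_eq_iff [simp]: "(poly_of A :: 'k::field mpol set) = poly_of B \<longleftrightarrow> A = B"
  by (metis order_antisym order_refl poly_of_subset_iff)

lemma zero_in_poly_of [simp]: "0 \<in> poly_of A"
  by (simp add: poly_of_def)

lemma add_in_poly_of: "f \<in> poly_of A \<Longrightarrow> g \<in> poly_of A \<Longrightarrow> f + g \<in> poly_of A"
  using Poly_Mapping.keys_add[of f g] by (auto simp: poly_of_def)

lemma uminus_in_poly_of: "f \<in> poly_of A \<Longrightarrow> - f \<in> poly_of A"
  by (auto simp: poly_of_def in_keys_iff)

lemma mult_in_poly_of:
  assumes "f \<in> poly_of A" "g \<in> poly_of B" "\<And>\<alpha> \<beta>. \<alpha> \<in> A \<Longrightarrow> \<beta> \<in> B \<Longrightarrow> \<alpha> + \<beta> \<in> C"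
  shows "f * g \<in> poly_of C"
  using Poly_Mapping.keys_mult[of f g] assms by (fastforce simp: poly_of_def)

lemma scal_single: "scal c (single \<alpha> d) = single \<alpha> (c * d)"
  by (simp add: scal_def mult_single)

lemma scal_mono_of: "scal c (mono_of \<alpha>) = single \<alpha> c"
  by (simp add: scal_single)

lemma lookup_scal: "lookup (scal c f) \<alpha> = c * lookup f \<alpha>"
  by (simp add: scal_def Poly_Mapping.map.rep_eq when_def flip: mult_map_scale_conv_mult)

lemma scal_in_poly_of: "f \<in> poly_of A \<Longrightarrow> scal c f \<in> poly_of A"
  by (auto simp: poly_of_def in_keys_iff lookup_scal)

lemma mpol_eq_sum_single:
  "f = (\<Sum>\<alpha>\<in>keys f. single \<alpha> (lookup f \<alpha>))"
  by (rule poly_mapping_eqI) (simp add: lookup_sum lookup_single when_def in_keys_iff)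

lemma subspace_poly_of: "mpol.subspace (poly_of A)"
  by (simp add: mpol.subspace_def add_in_poly_of scal_in_poly_of)

lemma sum_in_closed:
  assumes "0 \<in> I" "\<And>f g. f \<in> I \<Longrightarrow> g \<in> I \<Longrightarrow> f + g \<in> I" "\<And>x. x \<in> S \<Longrightarrow> h x \<in> I"
  shows "sum h S \<in> (I :: 'a::comm_monoid_add set)"
  using assms(3) by (induction S rule: infinite_finite_induct) (auto intro: assms(1,2))

lemma poly_of_induct:
  assumes "f \<in> poly_of A" "0 \<in> I" "\<And>f g. f \<in> I \<Longrightarrow> g \<in> I \<Longrightarrow> f + g \<in> I"
    "\<And>\<alpha> c. \<alpha> \<in> A \<Longrightarrow> single \<alpha> c \<in> I"
  shows "f \<in> I"
  by (subst mpol_eq_sum_single, rule sum_in_closed) (use assms in \<open>auto simp: poly_of_def\<close>)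

lemma mpol_span_UN:
  "mpol_span (\<Union>i\<in>I. poly_of (A i)) = (poly_of (\<Union>i\<in>I. A i) :: 'k::field mpol set)"
proof (rule equalityI)
  show "mpol_span (\<Union>i\<in>I. poly_of (A i)) \<subseteq> (poly_of (\<Union>i\<in>I. A i) :: 'k mpol set)"
    by (rule mpol.span_minimal[OF _ subspace_poly_of]) (auto simp: poly_of_def)
  show "(poly_of (\<Union>i\<in>I. A i) :: 'k mpol set) \<subseteq> mpol_span (\<Union>i\<in>I. poly_of (A i))"
  proof
    fix f :: "'k mpol" assume "f \<in> poly_of (\<Union>i\<in>I. A i)"
    then show "f \<in> mpol_span (\<Union>i\<in>I. poly_of (A i))"
      by (rule poly_of_induct)
        (auto intro: mpol.span_zero mpol.span_add mpol.span_base single_in_poly_of)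
  qed
qed

lemma carrier_polyring: "carrier (polyring l n) = poly_of (terms_of l n)"
  by (simp add: polyring_def poly_of_def)

lemma polyring_simps [simp]:
  "x \<otimes>\<^bsub>polyring l n\<^esub> y = x * y" "x \<oplus>\<^bsub>polyring l n\<^esub> y = x + y"
  "\<zero>\<^bsub>polyring l n\<^esub> = 0" "\<one>\<^bsub>polyring l n\<^esub> = 1"
  by (simp_all add: polyring_def)

lemma cring_polyring: "cring (polyring l n)"
proof (rule cringI)
  show "abelian_group (polyring l n)"
    by (rule abelian_groupI)
      (auto simp: carrier_polyring add_in_poly_of ac_simps intro!: bexI[of _ "- _"] uminus_in_poly_of)
  show "comm_monoid (polyring l n)"
    by (rule comm_monoidI)
      (auto simp: carrier_polyring ac_simps poly_of_def[of "terms_of l n"]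
        dest!: set_mp[OF Poly_Mapping.keys_mult] intro!: add_in_terms_of)
qed (simp add: distrib_right)

lemma ring_polyring: "ring (polyring l n)"
  using cring_polyring by (rule cring.axioms)

lemma ideal_polyringD:
  assumes "ideal I (polyring l n)"
  shows "0 \<in> I" "f \<in> I \<Longrightarrow> g \<in> I \<Longrightarrow> f + g \<in> I"
    "f \<in> I \<Longrightarrow> g \<in> poly_of (terms_of l n) \<Longrightarrow> g * f \<in> I"
    "I \<subseteq> poly_of (terms_of l n)"
proof -
  interpret ideal I "polyring l n" by fact
  show "0 \<in> I" "f \<in> I \<Longrightarrow> g \<in> I \<Longrightarrow> f + g \<in> I"
    "f \<in> I \<Longrightarrow> g \<in> poly_of (terms_of l n) \<Longrightarrow> g * f \<in> I"
    using additive_subgroup.zero_closed[OF is_additive_subgroup]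
      additive_subgroup.a_closed[OF is_additive_subgroup, of f g] I_l_closed[of f g]
    by (simp_all add: carrier_polyring)
  show "I \<subseteq> poly_of (terms_of l n)"
    using a_subset by (simp add: carrier_polyring)
qed

lemma single_mult_in_ideal:
  assumes "ideal I (polyring l n)" "mono_of \<alpha> \<in> I" "\<beta> \<in> terms_of l n"
  shows "single (\<alpha> + \<beta>) c \<in> I"
  using ideal_polyringD(3)[OF assms(1,2) single_in_poly_of[OF assms(3), of c]]
  by (simp add: mult_single add.commute)

lemma ideal_poly_of:
  assumes "term_ideal l n A"
  shows "ideal (poly_of A :: 'k::field mpol set) (polyring l n)"
proof (rule idealI[OF ring_polyring])
  show "subgroup (poly_of A :: 'k mpol set) (add_monoid (polyring l n))"
  proof (rule group.subgroupI)
    show "Group.group (add_monoid (polyring l n))"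
      by (rule abelian_group.a_group[OF ring.axioms(1)[OF ring_polyring]])
    show "poly_of A \<subseteq> carrier (add_monoid (polyring l n))"
      using term_ideal_subset[OF assms] by (simp add: carrier_polyring)
    show "poly_of A \<noteq> {}"
      using zero_in_poly_of by blast
    fix f :: "'k mpol" assume f: "f \<in> poly_of A"
    have "inv\<^bsub>add_monoid (polyring l n)\<^esub> f = - f"
    proof -
      interpret ring "polyring l n :: 'k mpol ring" by (rule ring_polyring)
      have "f \<in> poly_of (terms_of l n)"
        using f term_ideal_subset[OF assms] poly_of_subset_iff by blast
      then have "\<ominus>\<^bsub>polyring l n\<^esub> f = - f"
        using minus_equality[of "- f" f] uminus_in_poly_of[of f "terms_of l n"]
        by (simp add: carrier_polyring)
      then show ?thesis
        by (simp add: a_inv_def)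
    qed
    then show "inv\<^bsub>add_monoid (polyring l n)\<^esub> f \<in> poly_of A"
      using f uminus_in_poly_of by metis
    show "f \<otimes>\<^bsub>add_monoid (polyring l n)\<^esub> g \<in> poly_of A" if "g \<in> poly_of A" for g
      using f that by (simp add: add_in_poly_of)
  qed
next
  fix a x :: "'k mpol" assume "a \<in> poly_of A" "x \<in> carrier (polyring l n)"
  then show "x \<otimes>\<^bsub>polyring l n\<^esub> a \<in> poly_of A" "a \<otimes>\<^bsub>polyring l n\<^esub> x \<in> poly_of A"
    using mult_in_poly_of[of a A x "terms_of l n" A] term_idealD[OF assms]
    by (simp_all add: carrier_polyring mult.commute)
qed

text \<open>Stated for any S between the monomials of B and their linear span, to cover sets of
  monomials, {1}, and a whole ideal of the smaller ring.\<close>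

lemma genideal_poly_of:
  fixes S :: "'k::field mpol set"
  assumes "B \<subseteq> terms_of l n" "mono_of ` B \<subseteq> S" "S \<subseteq> poly_of B"
  shows "genideal (polyring l n) S = poly_of (term_span l n B)"
proof (rule equalityI)
  interpret ring "polyring l n :: 'k mpol ring" by (rule ring_polyring)
  show "genideal (polyring l n) S \<subseteq> poly_of (term_span l n B)"
  proof (rule genideal_minimal[OF ideal_poly_of[OF term_ideal_span[OF assms(1)]]])
    show "S \<subseteq> poly_of (term_span l n B)"
      using assms(3) subset_term_span[of B l n] by (meson order_trans poly_of_subset_iff)
  qed
  have "S \<subseteq> carrier (polyring l n)"
    using assms(1,3) by (auto simp: carrier_polyring poly_of_def)
  then have ideal: "ideal (genideal (polyring l n) S) (polyring l n)"
    and S: "S \<subseteq> genideal (polyring l n) S"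
    by (rule genideal_ideal genideal_self)+
  show "poly_of (term_span l n B) \<subseteq> genideal (polyring l n) S"
  proof
    fix f :: "'k mpol" assume "f \<in> poly_of (term_span l n B)"
    then show "f \<in> genideal (polyring l n) S"
    proof (rule poly_of_induct)
      fix \<alpha> and c :: 'k assume "\<alpha> \<in> term_span l n B"
      then obtain \<beta> \<gamma> where "\<alpha> = \<beta> + \<gamma>" "\<beta> \<in> B" "\<gamma> \<in> terms_of l n"
        by (auto simp: term_span_def)
      then show "single \<alpha> c \<in> genideal (polyring l n) S"
        using single_mult_in_ideal[OF ideal] S assms(2) by blast
    qed (use ideal_polyringD[OF ideal] in auto)
  qed
qed

lemma genideal_mono_of:
  "B \<subseteq> terms_of l n \<Longrightarrow> genideal (polyring l n) (mono_of ` B) = poly_of (term_span l n B)"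
  by (rule genideal_poly_of) auto

lemma term_span_ideal: "term_ideal l n A \<Longrightarrow> term_span l n A = A"
  using term_span_subset[of l n A A] subset_term_span[of A l n] by auto

lemma genideal_one: "genideal (polyring l n) {1} = poly_of (terms_of l n)"
proof -
  have "genideal (polyring l n) {1} = poly_of (term_span l n {0})"
    by (rule genideal_poly_of) (auto simp: poly_of_def)
  then show ?thesis
    by (simp add: term_span_def)
qed

lemma term_span_Suc_eq_ext:
  assumes "term_ideal (Suc l) n B" "l \<le> n"
  shows "term_span l n B = term_ext l n B"
proof (intro equalityI subsetI)
  fix \<alpha> assume "\<alpha> \<in> term_span l n B"
  then obtain \<beta> \<gamma> where \<alpha>: "\<alpha> = \<beta> + \<gamma>" "\<beta> \<in> B" "\<gamma> \<in> terms_of l n"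
    by (auto simp: term_span_def)
  have "\<beta> \<in> terms_of (Suc l) n"
    using \<alpha>(2) term_ideal_subset[OF assms(1)] by blast
  then have "\<beta> \<in> terms_of l n" "drop_var l \<beta> = \<beta>"
    using terms_of_Suc_subset lookup_terms_of_Suc drop_var_id by blast+
  then show "\<alpha> \<in> term_ext l n B"
    using \<alpha> term_idealD[OF assms(1) \<alpha>(2) drop_var_in_terms_of[OF \<alpha>(3)]]
    by (simp add: term_ext_def drop_var_add add_in_terms_of)
next
  fix \<alpha> assume "\<alpha> \<in> term_ext l n B"
  then have "drop_var l \<alpha> \<in> B" "\<alpha> = drop_var l \<alpha> + single l (lookup \<alpha> l)"
    by (simp_all add: term_ext_def drop_var_add_single)
  then show "\<alpha> \<in> term_span l n B"
    using single_in_terms_of[of l l n] assms(2) unfolding term_span_def by blast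
qed

lemma genideal_ext:
  assumes "term_ideal (Suc l) n B" "l \<le> n"
  shows "genideal (polyring l n) (poly_of B) = poly_of (term_ext l n B)"
proof -
  have "B \<subseteq> terms_of l n"
    using term_ideal_subset[OF assms(1)] terms_of_Suc_subset[of l n] by blast
  then have "genideal (polyring l n) (poly_of B) = poly_of (term_span l n B)"
    by (rule genideal_poly_of) auto
  then show ?thesis
    by (simp add: term_span_Suc_eq_ext[OF assms])
qed

lemma component_poly_of: "component (poly_of A) t = poly_of {\<alpha> \<in> A. tdeg \<alpha> = t}"
  by (auto simp: component_def poly_of_def)

lemma truncation_poly_of: "truncation (poly_of A) s = poly_of {\<alpha> \<in> A. s \<le> tdeg \<alpha>}"
  unfolding truncation_def component_poly_of mpol_span_UN by (rule arg_cong[where f = poly_of]) auto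

lemma homogeneous_poly_of: "term_ideal l n A \<Longrightarrow> homogeneous_ideal l n (poly_of A)"
  by (auto simp: homogeneous_ideal_def component_poly_of mpol_span_UN ideal_poly_of
      intro!: arg_cong[where f = poly_of])

lemma independent_mono_of: "mpol.independent (mono_of ` A :: 'k::field mpol set)"
proof -
  have "mono_of \<alpha> \<notin> mpol_span (mono_of ` A - {mono_of \<alpha>} :: 'k mpol set)" for \<alpha>
  proof
    assume *: "mono_of \<alpha> \<in> mpol_span (mono_of ` A - {mono_of \<alpha>} :: 'k mpol set)"
    have "mpol_span (mono_of ` A - {mono_of \<alpha>} :: 'k mpol set) \<subseteq> poly_of (A - {\<alpha>})"
      by (rule mpol.span_minimal[OF _ subspace_poly_of]) auto
    then show False
      using * by (auto simp: poly_of_def)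
  qed
  then show ?thesis
    by (auto simp: mpol.dependent_def)
qed

lemma span_mono_of: "mpol_span (mono_of ` A) = (poly_of A :: 'k::field mpol set)"
proof (rule equalityI)
  show "mpol_span (mono_of ` A) \<subseteq> (poly_of A :: 'k mpol set)"
    by (rule mpol.span_minimal[OF _ subspace_poly_of]) auto
  show "(poly_of A :: 'k mpol set) \<subseteq> mpol_span (mono_of ` A)"
  proof
    fix f :: "'k mpol" assume "f \<in> poly_of A"
    then show "f \<in> mpol_span (mono_of ` A)"
    proof (rule poly_of_induct)
      fix \<alpha> and c :: 'k assume "\<alpha> \<in> A"
      then show "single \<alpha> c \<in> mpol_span (mono_of ` A)"
        by (subst scal_mono_of[symmetric]) (intro mpol.span_scale mpol.span_base, simp)
    qed (auto intro: mpol.span_zero mpol.span_add)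
  qed
qed

lemma inj_mono_of: "inj_on (mono_of :: pterm \<Rightarrow> 'k::field mpol) A"
  by (auto simp: inj_on_def dest: arg_cong[of _ _ keys])

lemma dim_poly_of: "mpol_dim (poly_of A :: 'k::field mpol set) = card A"
proof -
  have "mpol_dim (poly_of A :: 'k mpol set) = card (mono_of ` A :: 'k mpol set)"
    unfolding span_mono_of[symmetric] mpol.dim_span
    by (rule mpol.dim_eq_card_independent[OF independent_mono_of])
  then show ?thesis
    by (simp add: card_image inj_mono_of)
qed


subsection \<open>Dimensions of quotients\<close>

text \<open>The monomials of X outside Y give existence. The description operator also needs
  uniqueness: any admissible set together with the monomials of Y is a basis of
  \<open>poly_of X\<close>, so the dimension forces its size.\<close>

lemma quotient_dim_poly_of:
  assumes "finite X" "Y \<subseteq> X"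
  shows "quotient_dim (poly_of X :: 'k::field mpol set) (poly_of Y) = card (X - Y)"
  unfolding quotient_dim_def
proof (rule the_equality)
  let ?rep = "\<lambda>(B :: 'k mpol set) v c. (\<forall>b. b \<notin> B \<longrightarrow> c b = 0) \<and> v - (\<Sum>b\<in>B. scal (c b) b) \<in> poly_of Y"
  define B :: "'k mpol set" where "B = mono_of ` (X - Y)"
  have finB: "finite B"
    using assms by (simp add: B_def)
  have sumB: "(\<Sum>b\<in>B. scal (c b) b) = (\<Sum>\<alpha>\<in>X - Y. single \<alpha> (c (mono_of \<alpha>)))" for c
    unfolding B_def by (subst sum.reindex[OF inj_mono_of]) (simp add: scal_mono_of)
  have look: "lookup (\<Sum>b\<in>B. scal (c b) b) \<alpha> = (if \<alpha> \<in> X - Y then c (mono_of \<alpha>) else 0)" for c \<alpha>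
    unfolding sumB lookup_sum using assms(1) by (simp add: lookup_single when_def)
  have ex1: "\<exists>!c. ?rep B v c" if v: "v \<in> poly_of X" for v
  proof (rule ex1I)
    let ?c = "\<lambda>b. if b \<in> B then lookup v (inv_into UNIV mono_of b) else 0"
    have c: "?c (mono_of \<alpha>) = lookup v \<alpha>" if "\<alpha> \<in> X - Y" for \<alpha>
      using that by (simp add: B_def inv_f_f[OF inj_mono_of])
    have v0: "lookup v \<alpha> = 0" if "\<alpha> \<notin> X" for \<alpha>
      using v that by (auto simp: poly_of_def in_keys_iff)
    have "\<alpha> \<in> Y" if "lookup (v - (\<Sum>b\<in>B. scal (?c b) b)) \<alpha> \<noteq> 0" for \<alpha>
      using that v0[of \<alpha>] c[of \<alpha>] unfolding lookup_minus look by (cases "\<alpha> \<in> X - Y") auto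
    then show "?rep B v ?c"
      by (auto simp: poly_of_def in_keys_iff)
    fix c assume rep: "?rep B v c"
    show "c = ?c"
    proof
      fix b
      show "c b = ?c b"
      proof (cases "b \<in> B")
        case True
        then obtain \<alpha> where \<alpha>: "b = mono_of \<alpha>" "\<alpha> \<in> X - Y"
          by (auto simp: B_def)
        have "lookup (v - (\<Sum>b\<in>B. scal (c b) b)) \<alpha> = 0"
          using rep \<alpha>(2) by (auto simp: poly_of_def in_keys_iff)
        then show ?thesis
          using \<alpha>(2) c[OF \<alpha>(2)] unfolding \<alpha>(1) lookup_minus look by simp
      qed (use rep in auto)
    qed
  qed
  have card: "card B = card (X - Y)" "B \<subseteq> poly_of X"
    by (auto simp: B_def card_image inj_mono_of)
  show "\<exists>B. finite B \<and> card B = card (X - Y) \<and> B \<subseteq> poly_of X \<and> (\<forall>v\<in>poly_of X. \<exists>!c. ?rep B v c)"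
    by (rule exI[of _ B], intro conjI ballI finB card) (rule ex1)
next
  let ?rep = "\<lambda>(B :: 'k mpol set) v c. (\<forall>b. b \<notin> B \<longrightarrow> c b = 0) \<and> v - (\<Sum>b\<in>B. scal (c b) b) \<in> poly_of Y"
  fix d assume "\<exists>B. finite B \<and> card B = d \<and> B \<subseteq> poly_of X \<and> (\<forall>v\<in>poly_of X. \<exists>!c. ?rep B v c)"
  then obtain B where B: "finite B" "card B = d" "B \<subseteq> poly_of X"
      and ex1: "\<forall>v\<in>poly_of X. \<exists>!c. ?rep B v c"
    by (elim exE conjE)
  \<comment> \<open>Uniqueness of the representation of the vector 0, with coefficients reset to 0
    outside B as a representation demands.\<close>
  have zero: "c b = 0" if "(\<Sum>b\<in>B. scal (c b) b) \<in> poly_of Y" "b \<in> B" for c b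
  proof -
    let ?c = "\<lambda>b. if b \<in> B then c b else 0"
    have "(\<Sum>b\<in>B. scal (?c b) b) = (\<Sum>b\<in>B. scal (c b) b)"
      by (rule sum.cong) auto
    then have rep: "?rep B 0 ?c"
      using uminus_in_poly_of[OF that(1)] by simp
    have rep0: "?rep B 0 (\<lambda>_. 0)"
      by simp
    note unique = the1_equality[OF bspec[OF ex1 zero_in_poly_of]]
    have "?c = (\<lambda>_. 0)"
      by (rule trans[OF sym[OF unique[OF rep]] unique[OF rep0]])
    then show ?thesis
      using that(2) by (auto dest: fun_cong[of _ _ b])
  qed
  define D where "D = B \<union> mono_of ` Y"
  have disj: "B \<inter> mono_of ` Y = {}"
  proof (rule equals0I)
    fix b assume b: "b \<in> B \<inter> mono_of ` Y"
    have "(\<Sum>b'\<in>B. scal (if b' = b then 1 else 0) b') = (\<Sum>b'\<in>B. if b' = b then b else 0)"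
      by (rule sum.cong) auto
    also have "\<dots> = b"
      using B(1) b by simp
    finally have "(1::'k) = 0"
      using zero[of "\<lambda>b'. if b' = b then 1 else 0" b] b by auto
    then show False
      by simp
  qed
  have finY: "finite (mono_of ` Y :: 'k mpol set)"
    using assms finite_subset by blast
  have finD: "finite D"
    using B(1) finY by (simp add: D_def)
  have "mpol.independent D"
  proof (rule mpol.independent_if_scalars_zero[OF finD])
    fix c b assume sum: "(\<Sum>b\<in>D. scal (c b) b) = 0" and b: "b \<in> D"
    have split: "(\<Sum>b\<in>B. scal (c b) b) + (\<Sum>b\<in>mono_of ` Y. scal (c b) b) = 0"
      using sum unfolding D_def by (simp add: sum.union_disjoint[OF B(1) finY disj])
    have Y: "(\<Sum>b\<in>mono_of ` Y. scal (c b) b) \<in> poly_of Y"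
      by (rule sum_in_closed) (auto intro!: scal_in_poly_of add_in_poly_of)
    then have "(\<Sum>b\<in>B. scal (c b) b) \<in> poly_of Y"
      using split uminus_in_poly_of[OF Y] by (simp add: eq_neg_iff_add_eq_0[symmetric])
    then have cB: "c b = 0" if "b \<in> B" for b
      using zero that by blast
    then have "(\<Sum>b\<in>mono_of ` Y. scal (c b) b) = 0"
      using split by simp
    then have "c b = 0" if "b \<in> mono_of ` Y" for b
      using mpol.independentD[OF independent_mono_of[of Y] finY order_refl _ that] by blast
    then show "c b = 0"
      using b cB by (auto simp: D_def)
  qed
  moreover have "mpol_span D = poly_of X"
  proof (rule equalityI)
    have "D \<subseteq> poly_of X"
      using B(3) assms(2) by (auto simp: D_def)
    then show "mpol_span D \<subseteq> poly_of X"
      by (rule mpol.span_minimal[OF _ subspace_poly_of])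
    show "poly_of X \<subseteq> mpol_span D"
    proof
      fix v :: "'k mpol" assume "v \<in> poly_of X"
      then obtain c where "v - (\<Sum>b\<in>B. scal (c b) b) \<in> poly_of Y"
        using ex1_implies_ex[OF bspec[OF ex1]] by blast
      then have "v - (\<Sum>b\<in>B. scal (c b) b) \<in> mpol_span D"
        unfolding span_mono_of[symmetric] using mpol.span_mono[of "mono_of ` Y" D] by (auto simp: D_def)
      moreover have "(\<Sum>b\<in>B. scal (c b) b) \<in> mpol_span D"
        by (intro mpol.span_sum mpol.span_scale mpol.span_base) (simp add: D_def)
      ultimately show "v \<in> mpol_span D"
        using mpol.span_add[of "v - (\<Sum>b\<in>B. scal (c b) b)" D "\<Sum>b\<in>B. scal (c b) b"] by simp
    qed
  qed
  ultimately have "card D = mpol_dim (poly_of X :: 'k mpol set)"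
    using mpol.dim_eq_card_independent[of D] by (metis mpol.dim_span)
  then have "card X = d + card Y"
    using card_Un_disjoint[OF B(1) finY disj] B(2)
    by (simp add: dim_poly_of D_def card_image inj_mono_of)
  then show "d = card (X - Y)"
    using assms by (simp add: card_Diff_subset finite_subset)
qed

lemma hilbert_polynomial_poly_of:
  assumes "term_ideal l n A"
  shows "hilbert_polynomial l n (poly_of A :: 'k::field mpol set) P \<longleftrightarrow> has_hilbert_poly l n A P"
proof -
  have "quotient_dim (component (carrier (polyring l n)) t) (component (poly_of A :: 'k mpol set) t)
      = hilbert_fun l n A t" for t
  proof -
    have "{\<alpha> \<in> terms_of l n. tdeg \<alpha> = t} - {\<alpha> \<in> A. tdeg \<alpha> = t} = {\<alpha> \<in> terms_of l n. tdeg \<alpha> = t \<and> \<alpha> \<notin> A}"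
      by auto
    then show ?thesis
      unfolding carrier_polyring component_poly_of hilbert_fun_def
      using term_ideal_subset[OF assms]
      by (subst quotient_dim_poly_of[OF finite_terms_of_degree]) auto
  qed
  then show ?thesis
    by (simp add: hilbert_polynomial_def has_hilbert_poly_def)
qed


subsection \<open>Saturation of monomial ideals\<close>

lemma lookup_mult_mono:
  "lookup (f * mono_of \<beta>) (\<alpha> + \<beta>) = (lookup f \<alpha> :: 'k::field)"
proof -
  have "f * mono_of \<beta>
      = (\<Sum>\<gamma>\<in>keys f. single (\<gamma> + \<beta>) (lookup f \<gamma>))"
    by (subst mpol_eq_sum_single) (simp add: sum_distrib_right mult_single)
  then show ?thesis
    by (simp add: lookup_sum lookup_single when_def in_keys_iff)
qed

lemma ideal_prod_poly_of:
  "ideal_prod (polyring l n) (poly_of A) (poly_of B)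
    = (poly_of {\<alpha> + \<beta> |\<alpha> \<beta>. \<alpha> \<in> A \<and> \<beta> \<in> B} :: 'k::field mpol set)"
proof (intro equalityI subsetI)
  fix f :: "'k mpol" assume "f \<in> ideal_prod (polyring l n) (poly_of A) (poly_of B)"
  then show "f \<in> poly_of {\<alpha> + \<beta> |\<alpha> \<beta>. \<alpha> \<in> A \<and> \<beta> \<in> B}"
  proof induction
    case (prod i j)
    have "i * j \<in> poly_of {\<alpha> + \<beta> |\<alpha> \<beta>. \<alpha> \<in> A \<and> \<beta> \<in> B}"
      by (rule mult_in_poly_of[OF prod]) blast
    then show ?case
      by simp
  qed (simp add: add_in_poly_of)
next
  fix f :: "'k mpol" assume f: "f \<in> poly_of {\<alpha> + \<beta> |\<alpha> \<beta>. \<alpha> \<in> A \<and> \<beta> \<in> B}"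
  show "f \<in> ideal_prod (polyring l n) (poly_of A) (poly_of B)"
    using f
  proof (rule poly_of_induct)
    show "0 \<in> ideal_prod (polyring l n) (poly_of A) (poly_of B :: 'k mpol set)"
      using ideal_prod.prod[of 0 "poly_of A" "0 :: 'k mpol" "poly_of B" "polyring l n"] by simp
    fix f g :: "'k mpol"
    assume "f \<in> ideal_prod (polyring l n) (poly_of A) (poly_of B)"
      "g \<in> ideal_prod (polyring l n) (poly_of A) (poly_of B)"
    then show "f + g \<in> ideal_prod (polyring l n) (poly_of A) (poly_of B)"
      using ideal_prod.sum[of f "polyring l n" "poly_of A" "poly_of B" g] by simp
  next
    fix \<gamma> and c :: 'k assume "\<gamma> \<in> {\<alpha> + \<beta> |\<alpha> \<beta>. \<alpha> \<in> A \<and> \<beta> \<in> B}"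
    then obtain \<alpha> \<beta> where "\<gamma> = \<alpha> + \<beta>" "\<alpha> \<in> A" "\<beta> \<in> B"
      by blast
    then show "single \<gamma> c \<in> ideal_prod (polyring l n) (poly_of A) (poly_of B)"
      using ideal_prod.prod[OF single_in_poly_of[of \<alpha> A c] single_in_poly_of[of \<beta> B 1], of "polyring l n"]
      by (simp add: mult_single)
  qed
qed

lemma irrelevant_ideal:
  "genideal (polyring l n) (xvar ` {l..n}) = (poly_of {\<alpha> \<in> terms_of l n. 1 \<le> tdeg \<alpha>} :: 'k::field mpol set)"
proof -
  let ?B = "(\<lambda>i. single i 1) ` {l..n} :: pterm set"
  have "?B \<subseteq> terms_of l n"
    by (auto intro: single_in_terms_of)
  then have "genideal (polyring l n) (mono_of ` ?B) = (poly_of (term_span l n ?B) :: 'k mpol set)"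
    by (rule genideal_mono_of)
  moreover have "term_span l n ?B = {\<alpha> \<in> terms_of l n. 1 \<le> tdeg \<alpha>}"
  proof (intro equalityI subsetI)
    fix \<alpha> assume "\<alpha> \<in> term_span l n ?B"
    then show "\<alpha> \<in> {\<alpha> \<in> terms_of l n. 1 \<le> tdeg \<alpha>}"
      by (auto simp: term_span_def tdeg_add add_in_terms_of_iff single_in_terms_of)
  next
    fix \<alpha> assume \<alpha>: "\<alpha> \<in> {\<alpha> \<in> terms_of l n. 1 \<le> tdeg \<alpha>}"
    then obtain i where i: "lookup \<alpha> i \<noteq> 0"
      using ex_factor[of \<alpha>] by auto
    then have "i \<in> {l..n}"
      using \<alpha> by (auto simp: terms_of_iff)
    moreover have "\<alpha> = single i 1 + (\<alpha> - single i 1)"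
      using pterm_diff_add[of 1 \<alpha> i] i by (simp add: add.commute)
    moreover have "\<alpha> - single i 1 \<in> terms_of l n"
      using \<alpha> by (auto intro: minus_in_terms_of)
    ultimately show "\<alpha> \<in> term_span l n ?B"
      unfolding term_span_def by blast
  qed
  ultimately show ?thesis
    by (simp add: image_image)
qed

lemma irrelevant_power_eq:
  "irrelevant_power l n N = (poly_of {\<alpha> \<in> terms_of l n. N \<le> tdeg \<alpha>} :: 'k::field mpol set)"
proof (induction N)
  case 0
  then show ?case
    by (simp add: irrelevant_power_def carrier_polyring)
next
  case (Suc N)
  have "irrelevant_power l n (Suc N) = ideal_prod (polyring l n)
      (genideal (polyring l n) (xvar ` {l..n})) (irrelevant_power l n N :: 'k mpol set)"
    by (simp add: irrelevant_power_def)
  also have "\<dots> = poly_of {\<alpha> + \<beta> |\<alpha> \<beta>. \<alpha> \<in> {\<alpha> \<in> terms_of l n. 1 \<le> tdeg \<alpha>} \<and>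
      \<beta> \<in> {\<alpha> \<in> terms_of l n. N \<le> tdeg \<alpha>}}"
    unfolding Suc.IH irrelevant_ideal by (rule ideal_prod_poly_of)
  also have "{\<alpha> + \<beta> |\<alpha> \<beta>. \<alpha> \<in> {\<alpha> \<in> terms_of l n. 1 \<le> tdeg \<alpha>} \<and>
      \<beta> \<in> {\<alpha> \<in> terms_of l n. N \<le> tdeg \<alpha>}} = {\<alpha> \<in> terms_of l n. Suc N \<le> tdeg \<alpha>}" (is "?X = ?Y")
  proof (intro equalityI subsetI)
    fix \<alpha> assume "\<alpha> \<in> ?X"
    then show "\<alpha> \<in> ?Y"
      by (auto simp: tdeg_add add_in_terms_of_iff)
  next
    fix \<alpha> assume \<alpha>: "\<alpha> \<in> ?Y"
    then have "1 \<le> tdeg \<alpha>"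
      by simp
    then obtain \<beta> \<gamma> where "\<alpha> = \<beta> + \<gamma>" "tdeg \<beta> = 1"
      using split_degree by blast
    moreover from this \<alpha> have "\<beta> \<in> terms_of l n" "\<gamma> \<in> terms_of l n" "N \<le> tdeg \<gamma>"
      by (auto simp: tdeg_add add_in_terms_of_iff)
    ultimately show "\<alpha> \<in> ?X"
      by (intro CollectI exI[of _ \<beta>] exI[of _ \<gamma>]) simp
  qed
  finally show ?case .
qed

text \<open>A term of degree at least m has a factor of degree exactly m.\<close>

lemma term_sat_bound:
  assumes "term_ideal l n A" "\<alpha> \<in> term_sat l n A"
  shows "\<exists>m. \<forall>\<beta>\<in>terms_of l n. m \<le> tdeg \<beta> \<longrightarrow> \<alpha> + \<beta> \<in> A"
proof -
  obtain m where m: "\<And>\<beta>. \<beta> \<in> terms_of l n \<Longrightarrow> tdeg \<beta> = m \<Longrightarrow> \<alpha> + \<beta> \<in> A"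
    using assms(2) by (auto simp: term_sat_def)
  have "\<alpha> + \<beta> \<in> A" if \<beta>: "\<beta> \<in> terms_of l n" "m \<le> tdeg \<beta>" for \<beta>
  proof -
    obtain \<beta>1 \<beta>2 where \<beta>12: "\<beta> = \<beta>1 + \<beta>2" "tdeg \<beta>1 = m"
      using split_degree[OF \<beta>(2)] by blast
    then have "\<beta>1 \<in> terms_of l n" "\<beta>2 \<in> terms_of l n"
      using \<beta>(1) by (auto simp: add_in_terms_of_iff)
    then have "\<alpha> + \<beta>1 + \<beta>2 \<in> A"
      using term_idealD[OF assms(1) m] \<beta>12(2) by blast
    then show ?thesis
      by (simp add: \<beta>12(1) add.assoc)
  qed
  then show ?thesis
    by blast
qed

lemma saturation_poly_of:
  assumes "term_ideal l n A"
  shows "saturation l n (poly_of A) = (poly_of (term_sat l n A) :: 'k::field mpol set)"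
proof (intro equalityI subsetI)
  fix f :: "'k mpol" assume "f \<in> saturation l n (poly_of A)"
  then obtain N where f: "f \<in> poly_of (terms_of l n)"
      and N: "\<And>g. g \<in> poly_of {\<alpha> \<in> terms_of l n. N \<le> tdeg \<alpha>} \<Longrightarrow> f * g \<in> poly_of A"
    by (auto simp: saturation_def carrier_polyring irrelevant_power_eq)
  show "f \<in> poly_of (term_sat l n A)"
    unfolding poly_of_def
  proof (intro CollectI subsetI)
    fix \<alpha> assume \<alpha>: "\<alpha> \<in> keys f"
    have "\<alpha> + \<beta> \<in> A" if "\<beta> \<in> terms_of l n" "tdeg \<beta> = N" for \<beta>
    proof -
      have "f * mono_of \<beta> \<in> poly_of A"
        using that by (intro N) simp
      \<comment> \<open>Multiplication by a monomial merely shifts the terms of f, so nothing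
        cancels and each term of f is tested separately.\<close>
      moreover have "\<alpha> + \<beta> \<in> keys (f * mono_of \<beta>)"
        using \<alpha> by (simp add: in_keys_iff lookup_mult_mono)
      ultimately show ?thesis
        by (auto simp: poly_of_def)
    qed
    moreover have "\<alpha> \<in> terms_of l n"
      using f \<alpha> by (auto simp: poly_of_def)
    ultimately show "\<alpha> \<in> term_sat l n A"
      by (auto simp: term_sat_def)
  qed
next
  fix f :: "'k mpol" assume f: "f \<in> poly_of (term_sat l n A)"
  then have "\<forall>\<alpha>\<in>keys f. \<exists>m. \<forall>\<beta>\<in>terms_of l n. m \<le> tdeg \<beta> \<longrightarrow> \<alpha> + \<beta> \<in> A"
    using term_sat_bound[OF assms] by (auto simp: poly_of_def)
  then obtain m where m: "\<forall>\<alpha>\<in>keys f. \<forall>\<beta>\<in>terms_of l n. m \<alpha> \<le> tdeg \<beta> \<longrightarrow> \<alpha> + \<beta> \<in> A"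
    by (rule bchoice[THEN exE])
  define N where "N = Max (insert 0 (m ` keys f))"
  have N: "m \<alpha> \<le> N" if "\<alpha> \<in> keys f" for \<alpha>
    unfolding N_def using that by (intro Max_ge) auto
  have "f * g \<in> poly_of A" if "g \<in> irrelevant_power l n N" for g
  proof (rule mult_in_poly_of)
    show "f \<in> poly_of (keys f)"
      by (simp add: poly_of_def)
    show "g \<in> poly_of {\<beta> \<in> terms_of l n. N \<le> tdeg \<beta>}"
      using that by (simp add: irrelevant_power_eq)
    show "\<alpha> + \<beta> \<in> A" if "\<alpha> \<in> keys f" "\<beta> \<in> {\<beta> \<in> terms_of l n. N \<le> tdeg \<beta>}" for \<alpha> \<beta>
      using m N[OF that(1)] that by auto
  qed
  moreover have "f \<in> carrier (polyring l n)"
    using f by (auto simp: carrier_polyring poly_of_def term_sat_def)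
  ultimately show "f \<in> saturation l n (poly_of A)"
    by (auto simp: saturation_def)
qed

lemma saturated_poly_of:
  "term_ideal l n A \<Longrightarrow> saturated l n (poly_of A :: 'k::field mpol set) \<longleftrightarrow> term_sat l n A = A"
  by (auto simp: saturated_def saturation_poly_of)


section \<open>Borel-fixed ideals\<close>

text \<open>The linear form substituted for x_i: variables are numbered from l, rows and columns
  from 0.\<close>

definition row_form :: "nat \<Rightarrow> 'k::field mat \<Rightarrow> nat \<Rightarrow> 'k mpol" where
  "row_form l g i = (\<Sum>j<dim_col g. scal (g $$ (i - l, j)) (xvar (l + j)))"

definition act_term :: "nat \<Rightarrow> 'k::field mat \<Rightarrow> pterm \<Rightarrow> 'k mpol" where
  "act_term l g \<alpha> = (\<Prod>i\<in>keys \<alpha>. row_form l g i ^ lookup \<alpha> i)"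

lemma linear_action_eq:
  "linear_action l g f = (\<Sum>\<alpha>\<in>keys f. scal (lookup f \<alpha>) (act_term l g \<alpha>))"
  by (simp add: linear_action_def act_term_def row_form_def)

lemma linear_action_superset:
  assumes "finite S" "keys f \<subseteq> S"
  shows "linear_action l g f = (\<Sum>\<alpha>\<in>S. scal (lookup f \<alpha>) (act_term l g \<alpha>))"
  unfolding linear_action_eq using assms by (intro sum.mono_neutral_left) (auto simp: in_keys_iff)

lemma linear_action_add: "linear_action l g (f + h) = linear_action l g f + linear_action l g h"
proof -
  let ?S = "keys f \<union> keys h"
  have "linear_action l g (f + h) = (\<Sum>\<alpha>\<in>?S. scal (lookup (f + h) \<alpha>) (act_term l g \<alpha>))"
    using Poly_Mapping.keys_add[of f h] by (intro linear_action_superset) auto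
  then show ?thesis
    using linear_action_superset[of ?S f l g] linear_action_superset[of ?S h l g]
    by (simp add: lookup_add mpol.scale_left_distrib sum.distrib)
qed

lemma linear_action_scal: "linear_action l g (scal c f) = scal c (linear_action l g f)"
proof -
  have "keys (scal c f) \<subseteq> keys f"
    by (auto simp: in_keys_iff lookup_scal)
  then have "linear_action l g (scal c f)
      = (\<Sum>\<alpha>\<in>keys f. scal (lookup (scal c f) \<alpha>) (act_term l g \<alpha>))"
    by (intro linear_action_superset) auto
  then show ?thesis
    by (simp add: linear_action_eq lookup_scal mpol.scale_sum_right)
qed

lemma linear_action_mono: "linear_action l g (mono_of \<alpha>) = act_term l g \<alpha>"
  by (simp add: linear_action_eq)

lemma linear_action_zero: "linear_action l g 0 = 0"
  by (simp add: linear_action_eq)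

lemma single_power:
  "single (single i a :: pterm) (c::'k::field) ^ m
    = single (single i (a * m)) (c ^ m)"
  by (induction m) (simp_all add: mult_single algebra_simps flip: single_add)

lemma prod_single:
  "finite S \<Longrightarrow> (\<Prod>i\<in>S. single (a i :: pterm) (c i :: 'k::field))
    = single (\<Sum>i\<in>S. a i) (\<Prod>i\<in>S. c i)"
  by (induction S rule: finite_induct) (simp_all add: mult_single)

lemma pterm_eq_sum_single:
  "(\<alpha> :: pterm) = (\<Sum>i\<in>keys \<alpha>. single i (lookup \<alpha> i))"
  by (rule poly_mapping_eqI) (simp add: lookup_sum lookup_single when_def in_keys_iff)

lemma row_form_interval:
  assumes "g \<in> carrier_mat (Suc n - l) (Suc n - l)" "l \<le> n"
  shows "row_form l g i = (\<Sum>j\<in>{l..n}. single (single j 1) (g $$ (i - l, j - l)))"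
proof -
  have "dim_col g = Suc n - l"
    using assms by auto
  then have "row_form l g i
      = (\<Sum>j\<in>{..<Suc n - l}. single (single (l + j) 1) (g $$ (i - l, j)))"
    by (simp add: row_form_def scal_mono_of)
  also have "\<dots> = (\<Sum>j\<in>{l..n}. single (single j 1) (g $$ (i - l, j - l)))"
    using assms(2)
    by (intro sum.reindex_bij_witness[where i = "\<lambda>j. j - l" and j = "\<lambda>j. l + j"]) auto
  finally show ?thesis .
qed

lemma invertible_mat_iff_det:
  assumes "A \<in> carrier_mat n n"
  shows "invertible_mat A \<longleftrightarrow> det A \<noteq> (0::'k::field)"
proof
  assume "invertible_mat A"
  then obtain B where B: "A * B = 1\<^sub>m n" "B * A = 1\<^sub>m (dim_row B)"
    using assms by (auto simp: invertible_mat_def inverts_mat_def)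
  have "dim_col B = n" "dim_row B = n"
    using arg_cong[OF B(1), of dim_col] arg_cong[OF B(2), of dim_col] assms by auto
  then have "B \<in> carrier_mat n n"
    by auto
  then show "det A \<noteq> 0"
    using det_mult[OF assms, of B] B(1) by auto
next
  assume "det A \<noteq> 0"
  then have "A \<in> Units (ring_mat TYPE('k) n undefined)"
    by (rule det_non_zero_imp_unit[OF assms])
  then obtain B where "B \<in> carrier_mat n n" "A * B = 1\<^sub>m n" "B * A = 1\<^sub>m n"
    by (auto simp: Units_def ring_mat_def)
  then show "invertible_mat A"
    using assms by (auto simp: invertible_mat_def inverts_mat_def)
qed

lemma invertible_triangular_iff:
  assumes "A \<in> carrier_mat n n" "upper_triangular A"
  shows "invertible_mat A \<longleftrightarrow> (\<forall>i<n. A $$ (i, i) \<noteq> (0::'k::field))"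
  unfolding invertible_mat_iff_det[OF assms(1)] det_upper_triangular[OF assms(2,1)] prod_list_zero_iff
  using assms(1) by (auto simp: diag_mat_def)


subsection \<open>Borel-fixed ideals are closed under admissible moves\<close>

text \<open>The matrix scales the variable with index \<open>i0\<close> by d and fixes the
  others.\<close>

lemma act_term_diagonal:
  assumes "\<alpha> \<in> terms_of l n" "l \<le> i0" "i0 \<le> n"
  shows "act_term l (mat (Suc n - l) (Suc n - l)
      (\<lambda>(i, j). if i = j then (if i = i0 - l then d else 1) else (0::'k::field))) \<alpha>
    = scal (d ^ lookup \<alpha> i0) (mono_of \<alpha>)" (is "act_term l ?g \<alpha> = _")
proof -
  have row: "row_form l ?g i = single (single i 1) (if i = i0 then d else 1)"
    if "i \<in> {l..n}" for i
  proof -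
    have "row_form l ?g i
        = (\<Sum>j\<in>{l..n}. single (single j 1) (?g $$ (i - l, j - l)))"
      using assms(2,3) by (intro row_form_interval) auto
    also have "\<dots>
        = (\<Sum>j\<in>{l..n}. if j = i then single (single i 1) (if i = i0 then d else 1) else 0)"
      by (rule sum.cong) (use that assms(2,3) in \<open>auto simp: eq_diff_iff\<close>)
    finally have "row_form l ?g i
        = (\<Sum>j\<in>{l..n}. if j = i then single (single i 1) (if i = i0 then d else 1) else 0)" .
    then show ?thesis
      using that by simp
  qed
  have "act_term l ?g \<alpha> = (\<Prod>i\<in>keys \<alpha>.
      single (single i (lookup \<alpha> i)) ((if i = i0 then d else 1) ^ lookup \<alpha> i))"
    unfolding act_term_def using assms(1) by (intro prod.cong) (auto simp: row terms_of_def single_power)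
  also have "\<dots> = single \<alpha> (\<Prod>i\<in>keys \<alpha>. (if i = i0 then d else 1) ^ lookup \<alpha> i)"
    by (subst prod_single) (simp_all flip: pterm_eq_sum_single)
  also have "(\<Prod>i\<in>keys \<alpha>. (if i = i0 then d else 1) ^ lookup \<alpha> i)
      = (\<Prod>i\<in>keys \<alpha>. if i = i0 then d ^ lookup \<alpha> i0 else 1)"
    by (rule prod.cong) auto
  also have "\<dots> = d ^ lookup \<alpha> i0"
    by (simp add: in_keys_iff)
  finally show ?thesis
    by (simp add: scal_mono_of)
qed

text \<open>The matrix adds the variable \<open>j0\<close> to the variable \<open>i0\<close>, and
  the binomial theorem gives the coefficients. The resulting terms differ in their exponent of
  \<open>j0\<close>, so no two of them combine.\<close>

lemma act_term_elementary:
  assumes "\<alpha> \<in> terms_of l n" "l \<le> i0" "i0 < j0" "j0 \<le> n" "t \<le> lookup \<alpha> i0"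
  shows "lookup (act_term l (mat (Suc n - l) (Suc n - l)
      (\<lambda>(i, j). if i = j \<or> (i = i0 - l \<and> j = j0 - l) then 1 else (0::'k::field))) \<alpha>)
      (increasing_move i0 j0 t \<alpha>) = of_nat (lookup \<alpha> i0 choose t)"
    (is "lookup (act_term l ?g \<alpha>) _ = _")
proof -
  define a where "a = lookup \<alpha> i0"
  have row: "row_form l ?g i = xvar i + (if i = i0 then xvar j0 else 0)" if "i \<in> {l..n}" for i
  proof -
    have "row_form l ?g i
        = (\<Sum>j\<in>{l..n}. single (single j 1) (?g $$ (i - l, j - l)))"
      using assms(2-4) by (intro row_form_interval) auto
    also have "\<dots> = (\<Sum>j\<in>{l..n}. (if j = i then xvar i else 0) + (if j = j0 then (if i = i0 then xvar j0 else 0) else 0))"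
      by (rule sum.cong) (use that assms(2-4) in \<open>auto simp: eq_diff_iff\<close>)
    finally have "row_form l ?g i
        = (\<Sum>j\<in>{l..n}. (if j = i then xvar i else 0) + (if j = j0 then (if i = i0 then xvar j0 else 0) else 0))" .
    then show ?thesis
      using that assms(2-4) by (simp add: sum.distrib)
  qed
  have key: "keys \<alpha> \<subseteq> {l..n}"
    using assms(1) by (simp add: terms_of_def)
  have rest: "(\<Prod>i\<in>keys \<alpha> - {i0}. row_form l ?g i ^ lookup \<alpha> i) = mono_of (drop_var i0 \<alpha>)"
  proof -
    have "(\<Prod>i\<in>keys \<alpha> - {i0}. row_form l ?g i ^ lookup \<alpha> i)
        = (\<Prod>i\<in>keys \<alpha> - {i0}. single (single i (lookup \<alpha> i)) 1)"
      using key by (intro prod.cong) (auto simp: row single_power)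
    also have "\<dots> = mono_of (\<Sum>i\<in>keys \<alpha> - {i0}. single i (lookup \<alpha> i))"
      by (subst prod_single) simp_all
    also have "(\<Sum>i\<in>keys \<alpha> - {i0}. single i (lookup \<alpha> i)) = drop_var i0 \<alpha>"
      by (rule poly_mapping_eqI) (auto simp: lookup_sum lookup_single when_def lookup_drop_var in_keys_iff)
    finally show ?thesis .
  qed
  have "act_term l ?g \<alpha> = row_form l ?g i0 ^ a * mono_of (drop_var i0 \<alpha>)"
  proof (cases "i0 \<in> keys \<alpha>")
    case True
    then show ?thesis
      unfolding act_term_def by (subst prod.remove[OF _ True]) (simp_all add: rest a_def)
  next
    case False
    then have "a = 0" "keys \<alpha> - {i0} = keys \<alpha>"
      by (auto simp: a_def in_keys_iff)
    then show ?thesis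
      using rest by (simp add: act_term_def)
  qed
  also have "row_form l ?g i0 = xvar j0 + xvar i0"
    using row[of i0] assms(2-4) by (simp add: add.commute)
  also have "(xvar j0 + xvar i0) ^ a * mono_of (drop_var i0 \<alpha>)
      = (\<Sum>u\<le>a. single (single j0 u + single i0 (a - u) + drop_var i0 \<alpha>)
          (of_nat (a choose u) :: 'k))"
    by (simp add: binomial_ring sum_distrib_right single_power mult_single flip: single_of_nat)
  also have "lookup \<dots> (increasing_move i0 j0 t \<alpha>) = (\<Sum>u\<le>a. if u = t then of_nat (a choose t) else 0)"
    unfolding lookup_sum
  proof (rule sum.cong)
    fix u assume u: "u \<in> {..a}"
    have "single j0 t + single i0 (a - t) + drop_var i0 \<alpha> = increasing_move i0 j0 t \<alpha>"
      using assms(3,5)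
      by (intro poly_mapping_eqI)
        (auto simp: increasing_move_def lookup_add lookup_minus lookup_single when_def lookup_drop_var a_def)
    moreover have "single j0 u + single i0 (a - u) + drop_var i0 \<alpha> \<noteq> increasing_move i0 j0 t \<alpha>"
      if "u \<noteq> t"
    proof
      assume "single j0 u + single i0 (a - u) + drop_var i0 \<alpha> = increasing_move i0 j0 t \<alpha>"
      from arg_cong[OF this, of "\<lambda>\<beta>. lookup \<beta> j0"] that assms(3) show False
        by (simp add: increasing_move_def lookup_add lookup_minus lookup_single lookup_drop_var)
    qed
    ultimately show "lookup (single (single j0 u + single i0 (a - u) + drop_var i0 \<alpha>)
        (of_nat (a choose u) :: 'k)) (increasing_move i0 j0 t \<alpha>) = (if u = t then of_nat (a choose t) else 0)"
      by (cases "u = t") (simp_all add: lookup_single_not_eq)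
  qed simp
  also have "\<dots> = of_nat (a choose t)"
    using assms(5) by (simp add: a_def)
  finally show ?thesis
    by (simp add: a_def)
qed

text \<open>Ties the combinatorial order to coefficients in k; in characteristic 0 the binomial
  coefficient is nonzero exactly for t \<le> a.\<close>

lemma prec_p_iff: "CHAR('k::field) = p \<Longrightarrow> prec_p p t a \<longleftrightarrow> of_nat (a choose t) \<noteq> (0::'k::field)"
  by (auto simp: prec_p_def of_nat_eq_0_iff_char_dvd binomial_eq_0_iff)

lemma borel_fixed_act_term:
  assumes "borel_fixed l n I" "g \<in> carrier_mat (Suc n - l) (Suc n - l)"
    "upper_triangular g" "\<And>i. i < Suc n - l \<Longrightarrow> g $$ (i, i) \<noteq> (0::'k::field)"
  shows "f \<in> I \<Longrightarrow> linear_action l g f \<in> I"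
  using assms(1) assms(2,3) invertible_triangular_iff[OF assms(2,3)] assms(4)
  unfolding borel_fixed_def by blast

text \<open>Adding x_j to x_i produces the moved term with a binomial coefficient that admissibility
  makes nonzero, and \<open>poly_of A\<close> contains every term of its elements.\<close>

lemma borel_fixed_move_closed:
  assumes "borel_fixed l n (poly_of A :: 'k::field mpol set)" "A \<subseteq> terms_of l n" "CHAR('k) = p"
  shows "move_closed p l n A"
  unfolding move_closed_def
proof (intro ballI allI impI)
  fix \<alpha> \<beta> assume \<alpha>: "\<alpha> \<in> A" and "admissible_step p l n \<alpha> \<beta>"
  then obtain i j t where ijt: "l \<le> i" "i < j" "j \<le> n" "t \<le> lookup \<alpha> i"
      "prec_p p t (lookup \<alpha> i)" and \<beta>: "\<beta> = increasing_move i j t \<alpha>"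
    by (auto simp: admissible_step_def)
  define g where "g = mat (Suc n - l) (Suc n - l)
      (\<lambda>(i', j'). if i' = j' \<or> (i' = i - l \<and> j' = j - l) then 1 else (0::'k))"
  have "linear_action l g (mono_of \<alpha>) \<in> poly_of A"
    using \<alpha> ijt(1,2)
    by (intro borel_fixed_act_term[OF assms(1)]) (auto simp: g_def upper_triangular_def)
  moreover have "lookup (linear_action l g (mono_of \<alpha>)) \<beta> \<noteq> 0"
    using act_term_elementary[of \<alpha> l n i j t, where ?'k = 'k] \<alpha> assms(2) ijt prec_p_iff[OF assms(3)]
    unfolding linear_action_mono g_def \<beta> by auto
  ultimately show "\<beta> \<in> A"
    by (auto simp: poly_of_def in_keys_iff)
qed

text \<open>The nonzero polynomial X^a - X^b has only finitely many roots.\<close>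

lemma infinite_field_separates:
  fixes a b :: nat
  assumes "infinite (UNIV :: 'k::field set)" "a \<noteq> b"
  obtains d :: "'k::field" where "d \<noteq> 0" "d ^ a \<noteq> d ^ b"
proof -
  have "monom (1::'k) a - monom 1 b \<noteq> 0"
    using assms(2) by (auto simp: monom_eq_iff' dest!: arg_cong[of _ _ "\<lambda>q. poly.coeff q a"])
  then have "finite {d :: 'k. poly (monom 1 a - monom 1 b) d = 0}"
    by (rule poly_roots_finite)
  then have "finite (insert 0 {d :: 'k. d ^ a = d ^ b})"
    by (simp add: poly_monom)
  then obtain d where "d \<notin> insert 0 {d :: 'k. d ^ a = d ^ b}"
    using ex_new_if_finite[OF assms(1)] by blast
  then show thesis
    using that by blast
qed

text \<open>Subtracting from a scaled copy of \<open>f\<close> a multiple of \<open>f\<close> kills one chosen term while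
  keeping another one.\<close>

lemma borel_fixed_monomials:
  assumes I: "borel_fixed l n (I :: 'k::field mpol set)" and inf: "infinite (UNIV :: 'k set)"
  shows "f \<in> I \<Longrightarrow> \<alpha> \<in> keys f \<Longrightarrow> mono_of \<alpha> \<in> I"
proof (induction "card (keys f)" arbitrary: f rule: less_induct)
  case less
  have ideal: "ideal I (polyring l n)"
    using I by (simp add: borel_fixed_def homogeneous_ideal_def)
  have scal: "scal c h \<in> I" if "h \<in> I" for c h
    using ideal_polyringD(3)[OF ideal that, of "single 0 c"]
    by (simp add: scal_def single_in_poly_of)
  have keys: "\<beta> \<in> terms_of l n" if "\<beta> \<in> keys f" for \<beta>
    using ideal_polyringD(4)[OF ideal] less.prems(1) that by (auto simp: poly_of_def)
  show ?case
  proof (cases "keys f = {\<alpha>}")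
    case True
    have "f = single \<alpha> (lookup f \<alpha>)"
      by (subst mpol_eq_sum_single) (simp add: True)
    moreover have "lookup f \<alpha> \<noteq> 0"
      using less.prems(2) by (simp add: in_keys_iff)
    ultimately have "scal (1 / lookup f \<alpha>) f = mono_of \<alpha>"
      by (metis nonzero_divide_eq_eq scal_single)
    then show ?thesis
      using scal[OF less.prems(1)] by metis
  next
    case False
    then obtain \<beta> where \<beta>: "\<beta> \<in> keys f" "\<beta> \<noteq> \<alpha>"
      using less.prems(2) by blast
    then obtain i where i: "lookup \<alpha> i \<noteq> lookup \<beta> i"
      by (metis poly_mapping_eqI)
    have in_range: "l \<le> i" "i \<le> n"
      using i keys[OF \<beta>(1)] keys[OF less.prems(2)] by (cases "lookup \<alpha> i = 0"; force simp: terms_of_iff)+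
    obtain d :: 'k where d: "d \<noteq> 0" "d ^ lookup \<alpha> i \<noteq> d ^ lookup \<beta> i"
      using infinite_field_separates[OF inf i] by blast
    define g where "g = mat (Suc n - l) (Suc n - l)
      (\<lambda>(i', j'). if i' = j' then (if i' = i - l then d else 1) else (0::'k))"
    define h where "h = linear_action l g f + scal (- (d ^ lookup \<beta> i)) f"
    have "linear_action l g f \<in> I"
      using d(1) by (intro borel_fixed_act_term[OF I _ _ _ less.prems(1)]) (auto simp: g_def upper_triangular_def)
    then have "h \<in> I"
      unfolding h_def by (intro ideal_polyringD(2)[OF ideal] scal less.prems(1))
    have "linear_action l g f = (\<Sum>\<gamma>\<in>keys f.
        single \<gamma> (lookup f \<gamma> * d ^ lookup \<gamma> i))"
      unfolding linear_action_eq g_def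
      using keys in_range by (intro sum.cong) (simp_all add: act_term_diagonal scal_single)
    then have "lookup (linear_action l g f) \<gamma> = lookup f \<gamma> * d ^ lookup \<gamma> i" for \<gamma>
      by (simp add: lookup_sum lookup_single when_def in_keys_iff)
    then have look: "lookup h \<gamma>
        = lookup f \<gamma> * (d ^ lookup \<gamma> i - d ^ lookup \<beta> i)" for \<gamma>
      unfolding h_def lookup_add lookup_scal by (simp add: algebra_simps)
    have "keys h \<subseteq> keys f - {\<beta>}"
      by (auto simp: in_keys_iff look)
    then have "card (keys h) < card (keys f)"
      using \<beta>(1) by (intro psubset_card_mono) auto
    moreover have "\<alpha> \<in> keys h"
      using less.prems(2) d(2) by (simp add: in_keys_iff look)
    ultimately show ?thesis
      using less.hyps \<open>h \<in> I\<close> by blast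
  qed
qed

text \<open>Over a finite field being monomial is part of \<open>p_Borel\<close>; over an infinite
  one it follows from the diagonal matrices.\<close>

lemma p_Borel_imp_terms:
  assumes "p_Borel p l n (I :: 'k::field mpol set)"
  obtains A where "I = poly_of A" "term_ideal l n A" "move_closed p l n A"
proof -
  have char: "CHAR('k) = p" and borel: "borel_fixed l n I"
    and fin: "finite (UNIV :: 'k set) \<Longrightarrow> monomial_ideal l n I"
    using assms by (auto simp: p_Borel_def)
  have ideal: "ideal I (polyring l n)"
    using borel by (simp add: borel_fixed_def homogeneous_ideal_def)
  define A where "A = {\<alpha> \<in> terms_of l n. (mono_of \<alpha> :: 'k mpol) \<in> I}"
  have "term_ideal l n A"
    unfolding term_ideal_def A_def using single_mult_in_ideal[OF ideal] by (auto intro: add_in_terms_of)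
  moreover have "I = poly_of A"
  proof (intro equalityI subsetI)
    fix f assume f: "f \<in> I"
    show "f \<in> poly_of A"
    proof (cases "finite (UNIV :: 'k set)")
      case True
      then obtain B where B: "B \<subseteq> terms_of l n" "I = poly_of (term_span l n B)"
        using fin genideal_mono_of by (metis monomial_ideal_def)
      then have "term_span l n B \<subseteq> A"
        using term_ideal_subset[OF term_ideal_span[OF B(1)]] by (auto simp: A_def)
      then show ?thesis
        using f by (auto simp: poly_of_def B(2))
    next
      case False
      then show ?thesis
        using borel_fixed_monomials[OF borel False f] ideal_polyringD(4)[OF ideal] f
        by (auto simp: poly_of_def A_def)
    qed
  next
    fix f :: "'k mpol" assume "f \<in> poly_of A"
    then show "f \<in> I"
    proof (rule poly_of_induct)
      fix \<alpha> and c :: 'k assume "\<alpha> \<in> A"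
      then show "single \<alpha> c \<in> I"
        using single_mult_in_ideal[OF ideal, of \<alpha> 0 c] by (simp add: A_def)
    qed (use ideal_polyringD[OF ideal] in auto)
  qed
  moreover from this have "move_closed p l n A"
    using borel_fixed_move_closed[of l n A p, where ?'k = 'k] borel char by (auto simp: A_def)
  ultimately show thesis
    using that by blast
qed


subsection \<open>Ideals closed under admissible moves are Borel-fixed\<close>

text \<open>The room for error terms: an upper triangular matrix sends \<alpha> to a multiple of
  \<alpha> plus a combination of these.\<close>

definition higher_terms :: "pterm set \<Rightarrow> pterm \<Rightarrow> pterm set" where
  "higher_terms C \<alpha> = {\<beta> \<in> C. tdeg \<beta> = tdeg \<alpha> \<and> weight \<alpha> < weight \<beta>}"

lemma higher_terms_trans: "\<beta> \<in> higher_terms C \<alpha> \<Longrightarrow> higher_terms C \<beta> \<subseteq> higher_terms C \<alpha>"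
  by (auto simp: higher_terms_def)

lemma add_single_in_poly_of:
  "f - single \<alpha> c \<in> poly_of B \<Longrightarrow> \<alpha> \<in> B' \<Longrightarrow> B \<subseteq> B' \<Longrightarrow> f \<in> poly_of B'"
  for f :: "'k::field mpol"
proof -
  assume f: "f - single \<alpha> c \<in> poly_of B" and "\<alpha> \<in> B'" "B \<subseteq> B'"
  have "(f - single \<alpha> c) + single \<alpha> c \<in> poly_of B'"
  proof (rule add_in_poly_of)
    show "f - single \<alpha> c \<in> poly_of B'"
      using f \<open>B \<subseteq> B'\<close> poly_of_subset_iff by blast
    show "single \<alpha> c \<in> poly_of B'"
      using \<open>\<alpha> \<in> B'\<close> by (rule single_in_poly_of)
  qed
  then show ?thesis
    by simp
qed

text \<open>The multinomial coefficients of a power of a linear form factor into binomial coefficients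
  $\binom at$, one for each variable, so that the terms that occur are reached by admissible
  moves.\<close>

lemma power_linear_form:
  fixes c :: "nat \<Rightarrow> 'k::field"
  assumes "CHAR('k) = p" "finite J" "\<And>j. j \<in> J \<Longrightarrow> i < j \<and> j \<le> n"
    and moves: "\<And>\<alpha> j t. \<alpha> \<in> C \<Longrightarrow> i < j \<Longrightarrow> j \<le> n \<Longrightarrow> 0 < t \<Longrightarrow> t \<le> lookup \<alpha> i \<Longrightarrow>
      prec_p p t (lookup \<alpha> i) \<Longrightarrow>
      \<alpha> - single i t + single j t \<in> C"
  shows "\<gamma> + single i a \<in> C \<Longrightarrow> lookup \<gamma> i = 0 \<Longrightarrow>
    mono_of \<gamma> * (single (single i 1) d
        + (\<Sum>j\<in>J. single (single j 1) (c j))) ^ a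
      - single (\<gamma> + single i a) (d ^ a)
    \<in> poly_of (higher_terms C (\<gamma> + single i a))"
  using assms(2,3)
proof (induction J arbitrary: \<gamma> a rule: finite_induct)
  case empty
  then show ?case
    by (simp add: single_power mult_single)
next
  case (insert j J)
  define L :: "'k mpol" where "L = single (single i 1) d
      + (\<Sum>j\<in>J. single (single j 1) (c j))"
  let ?\<alpha> = "\<gamma> + single i a"
  let ?\<gamma> = "\<lambda>t. \<gamma> + single j t"
  have j: "i < j" "j \<le> n"
    using insert.prems(3)[of j] by auto
  have IH: "mono_of (?\<gamma> t) * L ^ (a - t) - single (?\<gamma> t + single i (a - t)) (d ^ (a - t))
      \<in> poly_of (higher_terms C (?\<gamma> t + single i (a - t)))"
    if "?\<gamma> t + single i (a - t) \<in> C" for t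
    unfolding L_def using that insert.prems(2,3) j
    by (intro insert.IH) (auto simp: lookup_add lookup_single when_def)
  \<comment> \<open>The summand that sends t of the a copies of x_i to x_j; the other a - t copies
    are left to the smaller set of variables.\<close>
  define T where "T t = single (?\<gamma> t) (of_nat (a choose t) * c j ^ t) * L ^ (a - t)" for t
  have T: "T t \<in> poly_of (higher_terms C ?\<alpha>)" if t: "0 < t" "t \<le> a" for t
  \<comment> \<open>A nonzero coefficient says that moving t copies is admissible, so the
    intermediate term stays in C.\<close>
  proof (cases "of_nat (a choose t) = (0::'k)")
    case True
    then show ?thesis
      by (simp add: T_def)
  next
    case False
    let ?\<beta> = "?\<gamma> t + single i (a - t)"
    have look: "lookup ?\<alpha> i = a"
      using insert.prems(2) by (simp add: lookup_add)
    have \<beta>: "?\<beta> = ?\<alpha> - single i t + single j t"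
      using t j insert.prems(2)
      by (intro poly_mapping_eqI) (auto simp: lookup_add lookup_minus lookup_single when_def)
    have "?\<beta> \<in> C"
      unfolding \<beta> using moves[OF insert.prems(1) j t(1)] False t(2) prec_p_iff[OF assms(1)]
      by (simp add: look)
    moreover have "tdeg ?\<beta> = tdeg ?\<alpha>" "weight ?\<alpha> < weight ?\<beta>"
      using tdeg_move[of t ?\<alpha> i j] weight_move[of t ?\<alpha> i j] t j unfolding \<beta> increasing_move_def look
      by auto
    ultimately have high: "?\<beta> \<in> higher_terms C ?\<alpha>"
      by (simp add: higher_terms_def)
    have "mono_of (?\<gamma> t) * L ^ (a - t) \<in> poly_of (higher_terms C ?\<alpha>)"
      by (rule add_single_in_poly_of[OF IH[OF \<open>?\<beta> \<in> C\<close>] high higher_terms_trans[OF high]])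
    then have "scal (of_nat (a choose t) * c j ^ t) (mono_of (?\<gamma> t) * L ^ (a - t)) \<in> poly_of (higher_terms C ?\<alpha>)"
      by (rule scal_in_poly_of)
    then show ?thesis
      by (simp add: T_def scal_def mult_single flip: mult.assoc)
  qed
  have "single (single i 1) d
        + (\<Sum>j\<in>insert j J. single (single j 1) (c j))
      = single (single j 1) (c j) + L"
    using insert.hyps by (simp add: L_def add.commute add.left_commute)
  then have "mono_of \<gamma> * (single (single i 1) d
        + (\<Sum>j\<in>insert j J. single (single j 1) (c j))) ^ a = (\<Sum>t\<le>a. T t)"
    unfolding T_def
    by (simp add: binomial_ring sum_distrib_left single_power mult_single flip: single_of_nat mult.assoc)
  also have "\<dots> = T 0 + (\<Sum>t\<in>{0<..a}. T t)"
    unfolding atMost_atLeast0 by (rule sum.head) simp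
  finally have "mono_of \<gamma> * (single (single i 1) d
        + (\<Sum>j\<in>insert j J. single (single j 1) (c j))) ^ a
      - single ?\<alpha> (d ^ a) = (T 0 - single ?\<alpha> (d ^ a)) + (\<Sum>t\<in>{0<..a}. T t)"
    by simp
  moreover have "T 0 - single ?\<alpha> (d ^ a) \<in> poly_of (higher_terms C ?\<alpha>)"
    using IH[of 0] insert.prems(1) by (simp add: T_def)
  moreover have "(\<Sum>t\<in>{0<..a}. T t) \<in> poly_of (higher_terms C ?\<alpha>)"
    by (rule sum_in_closed) (auto intro: T add_in_poly_of)
  ultimately show ?case
    using add_in_poly_of by metis
qed

text \<open>The variables are substituted from the largest to the smallest, so that the exponent of the
  variable being substituted is still the original one.\<close>

lemma triangular_product:
  fixes d :: "nat \<Rightarrow> 'k::field" and c :: "nat \<Rightarrow> nat \<Rightarrow> 'k"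
  assumes "CHAR('k) = p"
    and L: "\<And>i. L i = single (single i 1) (d i)
      + (\<Sum>j\<in>{i<..n}. single (single j 1) (c i j))"
  shows "C \<subseteq> terms_of m n \<Longrightarrow> move_closed p m n C \<Longrightarrow> \<alpha> \<in> C \<Longrightarrow>
    (\<Prod>i\<in>{m..n}. L i ^ lookup \<alpha> i)
      - single \<alpha> (\<Prod>i\<in>{m..n}. d i ^ lookup \<alpha> i)
    \<in> poly_of (higher_terms C \<alpha>)"
proof (induction "Suc n - m" arbitrary: m C \<alpha>)
  case 0
  then have "\<alpha> = 0" "n < m"
    using terms_of_trivial[of n m] by auto
  then show ?case
    by simp
next
  case (Suc k)
  then have m: "m \<le> n"
    by simp
  have \<alpha>T: "\<alpha> \<in> terms_of m n"
    using Suc.prems by blast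
  define a where "a = lookup \<alpha> m"
  define \<alpha>' where "\<alpha>' = drop_var m \<alpha>"
  \<comment> \<open>Terms in the larger variables that lie in C once x_m^a is attached; the later
    substitution for x_m then meets the exponent a unchanged.\<close>
  define C' where "C' = {\<beta> \<in> terms_of (Suc m) n. \<beta> + single m a \<in> C}"
  have \<alpha>: "\<alpha>' + single m a = \<alpha>"
    by (simp add: \<alpha>'_def a_def drop_var_add_single)
  have "\<alpha>' \<in> C'"
    using \<alpha> Suc.prems(3) drop_var_in_terms_of[OF \<alpha>T] by (simp add: C'_def \<alpha>'_def)
  have "move_closed p (Suc m) n C'"
    unfolding move_closed_def
  proof (intro ballI allI impI)
    fix \<beta> \<delta> assume \<beta>: "\<beta> \<in> C'" and step: "admissible_step p (Suc m) n \<beta> \<delta>"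
    then obtain i j t where ijt: "Suc m \<le> i" "i < j" "j \<le> n" "0 < t" "t \<le> lookup \<beta> i"
        "prec_p p t (lookup \<beta> i)"
      and \<delta>: "\<delta> = \<beta> - single i t + single j t"
      by (auto simp: admissible_step_def increasing_move_def)
    have "(\<beta> + single m a) - single i t + single j t \<in> C"
      using \<beta> ijt by (intro move_closedD[OF Suc.prems(2)]) (auto simp: C'_def lookup_add lookup_single)
    also have "(\<beta> + single m a) - single i t + single j t
        = \<delta> + single m a"
      unfolding \<delta> using ijt
      by (intro poly_mapping_eqI) (auto simp: lookup_add lookup_minus lookup_single when_def)
    finally show "\<delta> \<in> C'"
      using admissible_step_in_terms_of[OF step] \<beta> by (simp add: C'_def)
  qed
  define R where "R = (\<Prod>i\<in>{Suc m..n}. L i ^ lookup \<alpha>' i)"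
  define e where "e = (\<Prod>i\<in>{Suc m..n}. d i ^ lookup \<alpha>' i)"
  have IH: "R - single \<alpha>' e \<in> poly_of (higher_terms C' \<alpha>')"
    unfolding R_def e_def
    using Suc(1)[of "Suc m" C' \<alpha>'] Suc(2) \<open>\<alpha>' \<in> C'\<close> \<open>move_closed p (Suc m) n C'\<close> by (auto simp: C'_def)
  have power: "mono_of \<beta> * L m ^ a - single (\<beta> + single m a) (d m ^ a)
      \<in> poly_of (higher_terms C (\<beta> + single m a))" if "\<beta> \<in> C'" for \<beta>
    unfolding L
  proof (rule power_linear_form[OF assms(1)])
    show "\<gamma> - single m t + single j t \<in> C"
      if "\<gamma> \<in> C" "m < j" "j \<le> n" "0 < t" "t \<le> lookup \<gamma> m" "prec_p p t (lookup \<gamma> m)"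
      for \<gamma> j t
      using that by (intro move_closedD[OF Suc.prems(2)]) auto
    show "\<beta> + single m a \<in> C" "lookup \<beta> m = 0"
      using that lookup_terms_of_Suc by (auto simp: C'_def)
  qed auto
  have range: "{m..n} = insert m {Suc m..n}"
    using m by auto
  have eq: "lookup \<alpha>' i = lookup \<alpha> i" if "i \<in> {Suc m..n}" for i
    using that by (simp add: \<alpha>'_def lookup_drop_var)
  have R: "R = (\<Prod>i\<in>{Suc m..n}. L i ^ lookup \<alpha> i)"
    "e = (\<Prod>i\<in>{Suc m..n}. d i ^ lookup \<alpha> i)"
    unfolding R_def e_def by (rule prod.cong; simp add: eq)+
  have prods: "(\<Prod>i\<in>{m..n}. L i ^ lookup \<alpha> i) = L m ^ a * R"
    "(\<Prod>i\<in>{m..n}. d i ^ lookup \<alpha> i) = d m ^ a * e"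
    unfolding range R by (simp_all add: a_def)
  \<comment> \<open>Two errors: one from substituting for x_m in the leading term, one from
    multiplying the earlier error in the larger variables by the power of
    \<open>L m\<close>.\<close>
  have split: "L m ^ a * R - single \<alpha> (d m ^ a * e)
      = scal e (mono_of \<alpha>' * L m ^ a - single \<alpha> (d m ^ a))
        + L m ^ a * (R - single \<alpha>' e)"
    by (simp add: scal_def algebra_simps mult_single flip: mult.assoc)
  have "scal e (mono_of \<alpha>' * L m ^ a - single \<alpha> (d m ^ a)) \<in> poly_of (higher_terms C \<alpha>)"
    using power[OF \<open>\<alpha>' \<in> C'\<close>] unfolding \<alpha> by (rule scal_in_poly_of)
  moreover have "L m ^ a * f \<in> poly_of (higher_terms C \<alpha>)" if "f \<in> poly_of (higher_terms C' \<alpha>')" for f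
  proof -
    have "f \<in> {f. L m ^ a * f \<in> poly_of (higher_terms C \<alpha>)}"
      using that
    proof (rule poly_of_induct)
      fix \<beta> and c :: 'k assume \<beta>: "\<beta> \<in> higher_terms C' \<alpha>'"
      then have "\<beta> \<in> C'"
        by (simp add: higher_terms_def)
      have high: "\<beta> + single m a \<in> higher_terms C \<alpha>"
        using \<beta> unfolding \<alpha>[symmetric] by (auto simp: higher_terms_def C'_def tdeg_add weight_add)
      have "mono_of \<beta> * L m ^ a \<in> poly_of (higher_terms C \<alpha>)"
        by (rule add_single_in_poly_of[OF power[OF \<open>\<beta> \<in> C'\<close>] high higher_terms_trans[OF high]])
      then have "scal c (mono_of \<beta> * L m ^ a) \<in> poly_of (higher_terms C \<alpha>)"
        by (rule scal_in_poly_of)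
      then show "single \<beta> c \<in> {f. L m ^ a * f \<in> poly_of (higher_terms C \<alpha>)}"
        by (simp add: scal_def mult_single mult.commute flip: mult.assoc)
    qed (auto simp: distrib_left intro: add_in_poly_of)
    then show ?thesis
      by simp
  qed
  ultimately show ?case
    unfolding prods split using IH by (intro add_in_poly_of)
qed

lemma act_term_triangular:
  fixes g :: "'k::field mat"
  assumes "CHAR('k) = p" "g \<in> carrier_mat (Suc n - l) (Suc n - l)" "upper_triangular g"
    "A \<subseteq> terms_of l n" "move_closed p l n A" "\<alpha> \<in> A"
  shows "act_term l g \<alpha>
      - single \<alpha> (\<Prod>i\<in>{l..n}. (g $$ (i - l, i - l)) ^ lookup \<alpha> i)
    \<in> poly_of (higher_terms A \<alpha>)"
proof -
  define L :: "nat \<Rightarrow> 'k mpol" where "L i = single (single i 1) (g $$ (i - l, i - l))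
      + (\<Sum>j\<in>{i<..n}. single (single j 1) (g $$ (i - l, j - l)))" for i
  have row: "row_form l g i = L i" if "i \<in> {l..n}" for i
  proof -
    have "row_form l g i = (\<Sum>j\<in>{l..n}. single (single j 1) (g $$ (i - l, j - l)))"
      using that by (intro row_form_interval[OF assms(2)]) auto
    also have "\<dots> = (\<Sum>j\<in>{i..n}. single (single j 1) (g $$ (i - l, j - l)))"
      using that assms(2) upper_triangularD[OF assms(3)] by (intro sum.mono_neutral_right) auto
    also have "{i..n} = insert i {i<..n}"
      using that by auto
    finally show ?thesis
      by (simp add: L_def)
  qed
  have "act_term l g \<alpha> = (\<Prod>i\<in>{l..n}. L i ^ lookup \<alpha> i)"
    unfolding act_term_def
  proof (rule prod.mono_neutral_cong_left)
    show "keys \<alpha> \<subseteq> {l..n}"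
      using assms(4,6) by (auto simp: terms_of_def)
    then show "row_form l g i ^ lookup \<alpha> i = L i ^ lookup \<alpha> i"
      if "i \<in> keys \<alpha>" for i
      using row that by auto
  qed (auto simp: in_keys_iff)
  then show ?thesis
    using triangular_product[OF assms(1) L_def assms(4-6)] by simp
qed

text \<open>The action is triangular with respect to weight, with diagonal entries that are products
  of powers of the nonzero diagonal of g. So it preserves the ideal, and it is onto by solving from
  the largest weight downward.\<close>

lemma borel_fixed_poly_of:
  assumes "CHAR('k::field) = p" "term_ideal l n A" "move_closed p l n A"
  shows "borel_fixed l n (poly_of A :: 'k mpol set)"
  unfolding borel_fixed_def
proof (intro conjI ballI impI)
  show "homogeneous_ideal l n (poly_of A :: 'k mpol set)"
    by (rule homogeneous_poly_of[OF assms(2)])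
  fix g :: "'k mat" assume g: "g \<in> carrier_mat (Suc n - l) (Suc n - l)"
    and *: "invertible_mat g \<and> upper_triangular g"
  have AT: "A \<subseteq> terms_of l n"
    by (rule term_ideal_subset[OF assms(2)])
  define e where "e \<alpha> = (\<Prod>i\<in>{l..n}. (g $$ (i - l, i - l)) ^ lookup \<alpha> i)" for \<alpha>
  have act: "act_term l g \<alpha> - single \<alpha> (e \<alpha>) \<in> poly_of (higher_terms A \<alpha>)" if "\<alpha> \<in> A" for \<alpha>
    unfolding e_def using act_term_triangular[OF assms(1) g _ AT assms(3) that] * by blast
  have diag: "g $$ (i, i) \<noteq> 0" if "i < Suc n - l" for i
    using invertible_triangular_iff[OF g] * that by blast
  then have e: "e \<alpha> \<noteq> 0" for \<alpha>
    by (auto simp: e_def)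
  have high: "higher_terms A \<alpha> \<subseteq> A" for \<alpha>
    by (auto simp: higher_terms_def)
  have "linear_action l g f \<in> poly_of A" if "f \<in> poly_of A" for f
    unfolding linear_action_eq
  proof (rule sum_in_closed)
    fix \<alpha> assume "\<alpha> \<in> keys f"
    then have "\<alpha> \<in> A"
      using that by (auto simp: poly_of_def)
    then show "scal (lookup f \<alpha>) (act_term l g \<alpha>) \<in> poly_of A"
      by (intro scal_in_poly_of add_single_in_poly_of[OF act _ high])
  qed (auto intro: add_in_poly_of)
  moreover have "f \<in> linear_action l g ` poly_of A" if "f \<in> poly_of A" for f
  proof -
    let ?X = "linear_action l g ` (poly_of A :: 'k mpol set)"
    have zero: "0 \<in> ?X"
      using linear_action_zero[of l g] zero_in_poly_of by (metis image_eqI)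
    have add: "f + h \<in> ?X" if "f \<in> ?X" "h \<in> ?X" for f h
      using that by (auto simp: linear_action_add[symmetric] intro: add_in_poly_of)
    have scal: "scal c f \<in> ?X" if "f \<in> ?X" for c f
      using that by (auto simp: linear_action_scal[symmetric] intro: scal_in_poly_of)
    have mono: "mono_of \<alpha> \<in> ?X" if "\<alpha> \<in> A" for \<alpha>
      using that
    \<comment> \<open>Weights in a fixed degree are at most \<open>n * tdeg \<alpha>\<close>, so
      this difference drops as the weight rises.\<close>
    proof (induction "n * tdeg \<alpha> - weight \<alpha>" arbitrary: \<alpha> rule: less_induct)
      case less
      define h where "h = act_term l g \<alpha> - single \<alpha> (e \<alpha>)"
      have "h \<in> ?X"
        using act[OF less.prems] unfolding h_def
      proof (rule poly_of_induct)
        fix \<beta> and c :: 'k assume "\<beta> \<in> higher_terms A \<alpha>"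
        then have "\<beta> \<in> A" "tdeg \<beta> = tdeg \<alpha>" "weight \<alpha> < weight \<beta>"
          by (auto simp: higher_terms_def)
        moreover have "weight \<beta> \<le> n * tdeg \<beta>"
          using \<open>\<beta> \<in> A\<close> AT by (intro weight_le) auto
        ultimately have "mono_of \<beta> \<in> ?X"
          by (intro less.hyps) auto
        then show "single \<beta> c \<in> ?X"
          using scal[of "mono_of \<beta>" c] by (simp add: scal_mono_of)
      qed (use zero add in auto)
      moreover have "act_term l g \<alpha> \<in> ?X"
        using less.prems linear_action_mono[of l g \<alpha>] by (metis image_eqI mono_in_poly_of)
      ultimately have "scal (1 / e \<alpha>) (act_term l g \<alpha> + scal (- 1) h) \<in> ?X"
        by (intro scal add)
      also have "scal (1 / e \<alpha>) (act_term l g \<alpha> + scal (- 1) h) = mono_of \<alpha>"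
        using e[of \<alpha>] by (simp add: h_def scal_single)
      finally show ?case .
    qed
    show ?thesis
      using that
    proof (rule poly_of_induct)
      fix \<alpha> and c :: 'k assume "\<alpha> \<in> A"
      then show "single \<alpha> c \<in> ?X"
        using scal[OF mono, of \<alpha> c] by (simp add: scal_mono_of)
    qed (use zero add in auto)
  qed
  ultimately show "linear_action l g ` poly_of A = (poly_of A :: 'k mpol set)"
    by blast
qed

lemma p_Borel_poly_of:
  assumes "CHAR('k::field) = p" "term_ideal l n A" "move_closed p l n A"
  shows "p_Borel p l n (poly_of A :: 'k mpol set)"
  using assms borel_fixed_poly_of[OF assms] genideal_mono_of[OF term_ideal_subset[OF assms(2)]]
    term_span_ideal[OF assms(2)] term_ideal_subset[OF assms(2)]
  unfolding p_Borel_def monomial_ideal_def by metis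


section \<open>The algorithm\<close>

lemma removable_terms_poly_of:
  assumes "A \<subseteq> terms_of l n"
  shows "\<alpha> \<in> removable_terms p (poly_of A :: 'k::field mpol set) l n s \<longleftrightarrow>
    \<alpha> \<in> A \<and> tdeg \<alpha> = s \<and> \<alpha> \<noteq> 0 \<and> tmin \<alpha> = l \<and>
    \<not> (\<exists>\<beta>. \<beta> \<noteq> \<alpha> \<and> \<beta> \<in> A \<and> s \<le> tdeg \<beta> \<and> less_p p l n \<beta> \<alpha>) \<and>
    (\<forall>\<beta> j. \<beta> \<in> A \<and> s \<le> tdeg \<beta> \<and> \<beta> \<noteq> 0 \<and> tmin \<beta> < j \<and> j \<le> n \<longrightarrow>
      \<beta> - single (tmin \<beta>) 1 + single j 1 \<noteq> \<alpha>)"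
  using assms
  unfolding removable_terms_def p_minimal_def St_minimal_def truncation_poly_of component_poly_of
    mono_in_poly_of mem_Collect_eq by auto

lemma remove_term_poly_of:
  assumes "A \<subseteq> terms_of l n"
  shows "remove_term (poly_of A :: 'k::field mpol set) l n s \<alpha>
    = poly_of (term_span l n ({\<beta> \<in> A. tdeg \<beta> = s} - {\<alpha>}))"
proof -
  have "{\<beta> \<in> terms_of l n. (mono_of \<beta> :: 'k mpol) \<in> component (poly_of A) s} - {\<alpha>}
      = {\<beta> \<in> A. tdeg \<beta> = s} - {\<alpha>}"
    using assms by (auto simp: component_poly_of)
  moreover have "{\<beta> \<in> A. tdeg \<beta> = s} - {\<alpha>} \<subseteq> terms_of l n"
    using assms by auto
  ultimately show ?thesis
    unfolding remove_term_def by (simp only: genideal_mono_of)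
qed

lemma remove_term_removable:
  assumes A: "term_ideal l n A" "move_closed p l n A" "stably_generated n s A" "l \<le> n"
    and \<alpha>: "\<alpha> \<in> removable_terms p (poly_of A :: 'k::field mpol set) l n s"
  obtains A' where "remove_term (poly_of A :: 'k mpol set) l n s \<alpha> = poly_of A'"
    "term_ideal l n A'" "move_closed p l n A'" "stably_generated n s A'"
    "\<forall>\<beta>. tdeg \<beta> = s \<longrightarrow> (\<beta> \<in> A' \<longleftrightarrow> \<beta> \<in> A \<and> \<beta> \<noteq> \<alpha>)"
    "\<forall>t\<ge>s. hilbert_fun l n A' t = hilbert_fun l n A t + 1"
proof -
  have AT: "A \<subseteq> terms_of l n"
    by (rule term_ideal_subset[OF A(1)])
  have \<alpha>A: "\<alpha> \<in> A" "tdeg \<alpha> = s" "\<alpha> \<noteq> 0" "tmin \<alpha> = l"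
    and pmin: "\<And>\<beta>. \<beta> \<noteq> \<alpha> \<Longrightarrow> \<beta> \<in> A \<Longrightarrow> s \<le> tdeg \<beta> \<Longrightarrow> \<not> less_p p l n \<beta> \<alpha>"
    and stmin: "\<And>\<beta> j. \<beta> \<in> A \<Longrightarrow> s \<le> tdeg \<beta> \<Longrightarrow> \<beta> \<noteq> 0 \<Longrightarrow> tmin \<beta> < j \<Longrightarrow> j \<le> n \<Longrightarrow>
      \<beta> - single (tmin \<beta>) 1 + single j 1 \<noteq> \<alpha>"
    using \<alpha> unfolding removable_terms_poly_of[OF AT] by blast+
  have "lookup \<alpha> l \<noteq> 0"
    using lookup_tmin[OF \<alpha>A(3)] \<alpha>A(4) by simp
  moreover have "\<not> admissible_step p l n \<beta> \<alpha>" if "\<beta> \<in> A" "tdeg \<beta> = s" for \<beta>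
  proof
    assume "admissible_step p l n \<beta> \<alpha>"
    then have "less_p p l n \<beta> \<alpha>"
      by (simp add: less_p_def)
    moreover from this have "\<beta> \<noteq> \<alpha>"
      using less_p_invariants(2) by blast
    ultimately show False
      using pmin that by simp
  qed
  moreover have "\<beta> - single (tmin \<beta>) 1 + single j 1 \<noteq> \<alpha>"
    if "\<beta> \<in> A" "tdeg \<beta> = s" "\<beta> \<noteq> 0" "tmin \<beta> < j" "j \<le> n" for \<beta> j
    using stmin that by simp
  ultimately show thesis
    using remove_term_span[OF A \<alpha>A(1,2) _ _ _ refl] remove_term_poly_of[OF AT, where ?'k = 'k]
    by (intro that) auto
qed

text \<open>Each removal keeps the invariants and adds 1 to the Hilbert function in all degrees from
  s on, so q removals add q.\<close>

lemma p_Remove_sound: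
  assumes "term_ideal l n A" "move_closed p l n A" "stably_generated n s A" "l \<le> n"
    "I \<in> p_Remove p (poly_of A :: 'k::field mpol set) l n s q"
  shows "\<exists>A'. I = poly_of (term_sat l n A') \<and> term_ideal l n A' \<and> move_closed p l n A' \<and>
    stably_generated n s A' \<and> (\<forall>t\<ge>s. hilbert_fun l n A' t = hilbert_fun l n A t + q)"
  using assms
proof (induction q arbitrary: A)
  case 0
  then show ?case
    by (auto simp: saturation_poly_of)
next
  case (Suc q)
  obtain \<alpha> where \<alpha>: "\<alpha> \<in> removable_terms p (poly_of A :: 'k mpol set) l n s"
    and I: "I \<in> p_Remove p (remove_term (poly_of A) l n s \<alpha>) l n s q"
    using Suc.prems(5) by auto
  obtain A1 where A1: "remove_term (poly_of A :: 'k mpol set) l n s \<alpha> = poly_of A1"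
    "term_ideal l n A1" "move_closed p l n A1" "stably_generated n s A1"
    "\<forall>t\<ge>s. hilbert_fun l n A1 t = hilbert_fun l n A t + 1"
    using remove_term_removable[OF Suc.prems(1-4) \<alpha>] by metis
  show ?case
    using Suc.IH[OF A1(2-4) Suc.prems(4) I[unfolded A1(1)]] A1(5) by auto
qed

text \<open>Multiples of high degree decide membership in the saturation, so a comparison from
  degree s on is enough.\<close>

lemma term_sat_subsetI:
  assumes "term_ideal l n A" "\<And>\<alpha>. \<alpha> \<in> A \<Longrightarrow> s \<le> tdeg \<alpha> \<Longrightarrow> \<alpha> \<in> C"
  shows "term_sat l n A \<subseteq> term_sat l n C"
proof
  fix \<alpha> assume \<alpha>: "\<alpha> \<in> term_sat l n A"
  then obtain m where m: "\<forall>\<beta>\<in>terms_of l n. m \<le> tdeg \<beta> \<longrightarrow> \<alpha> + \<beta> \<in> A"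
    using term_sat_bound[OF assms(1)] by blast
  have "\<forall>\<beta>\<in>terms_of l n. tdeg \<beta> = m + s \<longrightarrow> \<alpha> + \<beta> \<in> C"
    using m by (auto intro!: assms(2) simp: tdeg_add)
  then show "\<alpha> \<in> term_sat l n C"
    using \<alpha> by (auto simp: term_sat_def)
qed

text \<open>Among the terms still to be removed one of minimal weight is removable, because increasing
  moves increase the weight and the target \<open>C\<close> is closed under them.\<close>

lemma p_Remove_complete:
  assumes C: "term_ideal l n C" "move_closed p l n C" "stably_generated n s C"
    and "l \<le> n" "0 < s"
  shows "\<lbrakk>term_ideal l n A; move_closed p l n A; stably_generated n s A;
    \<forall>\<alpha>. tdeg \<alpha> = s \<longrightarrow> \<alpha> \<in> C \<longrightarrow> \<alpha> \<in> A;
    \<forall>\<alpha>. tdeg \<alpha> = s \<longrightarrow> \<alpha> \<in> A \<longrightarrow> lookup \<alpha> l = 0 \<longrightarrow> \<alpha> \<in> C;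
    card {\<alpha> \<in> A. tdeg \<alpha> = s \<and> \<alpha> \<notin> C} = q\<rbrakk>
    \<Longrightarrow> poly_of (term_sat l n C) \<in> p_Remove p (poly_of A :: 'k::field mpol set) l n s q"
proof (induction q arbitrary: A)
  case 0
  have "finite {\<alpha> \<in> A. tdeg \<alpha> = s \<and> \<alpha> \<notin> C}"
    by (rule finite_subset[OF _ finite_terms_of_degree[of l n s]])
      (use term_ideal_subset[OF 0(1)] in auto)
  then have "\<alpha> \<in> C" if "\<alpha> \<in> A" "tdeg \<alpha> = s" for \<alpha>
    using 0(6) that by auto
  \<comment> \<open>A and C agree in degree s, hence by generation in all higher degrees, hence
    after saturation.\<close>
  then have "term_sat l n A = term_sat l n C"
    using stably_generated_subset[OF 0(3,1) C(1)] stably_generated_subset[OF C(3,1) 0(1)] 0(4)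
    by (intro equalityI term_sat_subsetI[of l n _ s] 0(1) C(1)) blast+
  then show ?case
    by (simp add: saturation_poly_of[OF 0(1)])
next
  case (Suc q)
  note A = Suc.prems(1-3)
  have AT: "A \<subseteq> terms_of l n"
    by (rule term_ideal_subset[OF A(1)])
  let ?D = "{\<alpha> \<in> A. tdeg \<alpha> = s \<and> \<alpha> \<notin> C}"
  have "?D \<noteq> {}"
    using Suc.prems(6) by (intro notI) simp
  then obtain \<alpha> where \<alpha>: "\<alpha> \<in> ?D" and least: "\<And>\<beta>. \<beta> \<in> ?D \<Longrightarrow> weight \<alpha> \<le> weight \<beta>"
    using ex_has_least_nat[of "\<lambda>\<beta>. \<beta> \<in> ?D" _ weight] by blast
  \<comment> \<open>The algorithm removes only terms divisible by x_l; agreement on the terms free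
    of x_l guarantees that \<alpha> is one of them.\<close>
  have \<alpha>l: "lookup \<alpha> l \<noteq> 0"
    using Suc.prems(5) \<alpha> by blast
  have "tmin \<alpha> = l" "\<alpha> \<noteq> 0"
    using tmin_eq_bottom[OF _ \<alpha>l] \<alpha>l AT \<alpha> by auto
  moreover have "\<not> less_p p l n \<beta> \<alpha>" if "\<beta> \<in> A" for \<beta>
  proof
    assume less: "less_p p l n \<beta> \<alpha>"
    have "tdeg \<beta> = s" "weight \<beta> < weight \<alpha>"
      using less_p_invariants(1,2)[OF less] \<alpha> by auto
    \<comment> \<open>Otherwise \<beta> would be a term still to be removed that is lighter than
      \<alpha>.\<close>
    then have "\<beta> \<in> C"
      using least[of \<beta>] that by force
    then show False
      using less_p_invariants(3)[OF less C(2)] \<alpha> by blast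
  qed
  moreover have "\<beta> - single (tmin \<beta>) 1 + single j 1 \<noteq> \<alpha>"
    if \<beta>: "\<beta> \<in> A" "s \<le> tdeg \<beta>" "\<beta> \<noteq> 0" "tmin \<beta> < j" "j \<le> n" for \<beta> j
  proof
    assume eq: "\<beta> - single (tmin \<beta>) 1 + single j 1 = \<alpha>"
    have "tdeg \<beta> = s" "weight \<beta> < weight \<alpha>"
      using tdeg_move[of 1 \<beta> "tmin \<beta>" j] weight_move[of 1 \<beta> "tmin \<beta>" j] lookup_tmin[OF \<beta>(3)] \<beta>(4) \<alpha> eq
      by (auto simp: increasing_move_def)
    then have "\<beta> \<in> C"
      using least[of \<beta>] \<beta>(1) by force
    then show False
      using stably_generated_stable[OF C(3) _ \<beta>(2-5)] eq \<alpha> by auto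
  qed
  ultimately have rem: "\<alpha> \<in> removable_terms p (poly_of A :: 'k mpol set) l n s"
    unfolding removable_terms_poly_of[OF AT] using \<alpha> by blast
  obtain A1 where A1: "remove_term (poly_of A :: 'k mpol set) l n s \<alpha> = poly_of A1"
    "term_ideal l n A1" "move_closed p l n A1" "stably_generated n s A1"
    "\<forall>\<beta>. tdeg \<beta> = s \<longrightarrow> (\<beta> \<in> A1 \<longleftrightarrow> \<beta> \<in> A \<and> \<beta> \<noteq> \<alpha>)"
    using remove_term_removable[OF A assms(4) rem] by metis
  have "{\<beta> \<in> A1. tdeg \<beta> = s \<and> \<beta> \<notin> C} = ?D - {\<alpha>}"
    using A1(5) by auto
  then have "card {\<beta> \<in> A1. tdeg \<beta> = s \<and> \<beta> \<notin> C} = q"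
    using Suc.prems(6) \<alpha> by (simp add: card_Diff_singleton)
  then have "poly_of (term_sat l n C) \<in> p_Remove p (poly_of A1 :: 'k mpol set) l n s q"
    using A1 Suc.prems(4,5) \<alpha> by (intro Suc.IH) auto
  then show ?case
    using rem by (auto simp flip: A1(1))
qed

section \<open>Correctness of the recursion over the variables\<close>

lemma p_Borel_saturated_iff:
  assumes "CHAR('k::field) = p"
  shows "{I :: 'k mpol set. p_Borel p l n I \<and> saturated l n I \<and> hilbert_polynomial l n I P}
    = poly_of ` {A. term_ideal l n A \<and> move_closed p l n A \<and> term_sat l n A = A \<and> has_hilbert_poly l n A P}"
proof (intro equalityI subsetI)
  fix I :: "'k mpol set"
  assume "I \<in> {I. p_Borel p l n I \<and> saturated l n I \<and> hilbert_polynomial l n I P}"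
  then have I: "p_Borel p l n I" "saturated l n I" "hilbert_polynomial l n I P"
    by auto
  obtain A where "I = poly_of A" "term_ideal l n A" "move_closed p l n A"
    using p_Borel_imp_terms[OF I(1)] by blast
  then show "I \<in> poly_of ` {A. term_ideal l n A \<and> move_closed p l n A \<and> term_sat l n A = A \<and> has_hilbert_poly l n A P}"
    using I saturated_poly_of hilbert_polynomial_poly_of by blast
next
  fix I :: "'k mpol set"
  assume "I \<in> poly_of ` {A. term_ideal l n A \<and> move_closed p l n A \<and> term_sat l n A = A \<and> has_hilbert_poly l n A P}"
  then obtain A where "I = poly_of A" "term_ideal l n A" "move_closed p l n A" "term_sat l n A = A"
      "has_hilbert_poly l n A P"
    by blast
  then show "I \<in> {I. p_Borel p l n I \<and> saturated l n I \<and> hilbert_polynomial l n I P}"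
    by (simp add: p_Borel_poly_of[OF assms] saturated_poly_of hilbert_polynomial_poly_of)
qed

text \<open>All terms of high degree lie in A, so the saturation contains every term.\<close>

lemma saturated_zero_poly:
  assumes "term_ideal l n A" "term_sat l n A = A" "has_hilbert_poly l n A 0"
  shows "A = terms_of l n"
proof -
  obtain T where T: "\<And>t. T \<le> t \<Longrightarrow> hilbert_fun l n A t = 0"
    using assms(3) by (auto simp: has_hilbert_poly_def eventually_sequentially)
  have "\<alpha> \<in> A" if "\<alpha> \<in> terms_of l n" "T \<le> tdeg \<alpha>" for \<alpha>
  proof -
    have "{\<beta> \<in> terms_of l n. tdeg \<beta> = tdeg \<alpha> \<and> \<beta> \<notin> A} = {}"
      using T[OF that(2)] finite_degree_Collect unfolding hilbert_fun_def by (simp only: card_0_eq)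
    then show ?thesis
      using that(1) by blast
  qed
  then have "terms_of l n \<subseteq> term_sat l n A"
    by (auto simp: term_sat_def tdeg_add add_in_terms_of intro!: exI[of _ T])
  then show ?thesis
    using assms(2) term_ideal_subset[OF assms(1)] by auto
qed

lemma hilbert_fun_terms_of: "hilbert_fun l n (terms_of l n) t = 0"
  unfolding hilbert_fun_def by (rule card_eq_0_iff[THEN iffD2]) auto

text \<open>Induction on the termination measure of \<open>Borel\<close>, with l arbitrary because
  it grows with each call and may pass n; the Gotzmann bound is what passes to
  \<open>backward_diff P\<close>.\<close>

lemma Borel_correct:
  assumes "CHAR('k::field) = p" "0 < s"
  shows "is_gotzmann_number P r \<Longrightarrow> r \<le> s \<Longrightarrow> Borel l n P s p =
    {I :: 'k mpol set. p_Borel p l n I \<and> saturated l n I \<and> hilbert_polynomial l n I P}"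
proof (induction "if P = 0 then 0 else Suc (degree P)" arbitrary: P l r rule: less_induct)
  case less
  have p: "p \<noteq> 1"
    using assms(1) by auto
  define S where "S l P = {A. term_ideal l n A \<and> move_closed p l n A \<and> term_sat l n A = A \<and> has_hilbert_poly l n A P}" for l P
  have target: "{I :: 'k mpol set. p_Borel p l n I \<and> saturated l n I \<and> hilbert_polynomial l n I P} = poly_of ` S l P" for l P
    unfolding S_def by (rule p_Borel_saturated_iff[OF assms(1)])
  show ?case
  proof (cases "P = 0")
    case True
    have "S l P = {terms_of l n}"
      using saturated_zero_poly subset_term_sat[OF term_ideal_terms_of[of l n]] True
      by (auto simp: S_def term_ideal_terms_of move_closed_terms_of has_hilbert_poly_def
          hilbert_fun_terms_of term_sat_def)
    then show ?thesis
      unfolding target using True by (subst Borel.simps) (simp add: genideal_one)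
  next
    case False
    obtain r' where r': "r' \<le> r" "is_gotzmann_number (backward_diff P) r'"
      using gotzmann_number_backward_diff[OF less.prems(1)] by blast
    have "(if backward_diff P = 0 then 0 else Suc (degree (backward_diff P))) < (if P = 0 then 0 else Suc (degree P))"
      using degree_backward_diff_less[OF False] False by auto
    then have "Borel (Suc l) n (backward_diff P) s p = (poly_of ` S (Suc l) (backward_diff P) :: 'k mpol set set)"
      using less.hyps[OF _ r'(2), of "Suc l"] r'(1) less.prems(2) by (simp add: target)
    then have rec: "(Borel l n P s p :: 'k mpol set set) = (\<Union>B\<in>S (Suc l) (backward_diff P).
        let I = genideal (polyring l n) (poly_of B);
            q = poly P (of_nat s) - of_nat ((n + s - l) choose s) + of_nat (mpol_dim (component I s))
        in if q \<ge> 0 then p_Remove p I l n s (nat \<lfloor>q\<rfloor>) else {})"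
      using False by (subst Borel.simps) simp
    obtain k where k: "poly P (of_nat s) = of_nat k"
      using gotzmann_number_sum[OF less.prems(1)] less.prems(2) by blast
    have "0 < k"
      using gotzmann_poly_pos[OF less.prems(1) False less.prems(2)] k by simp
    show ?thesis
    proof (cases "l \<le> n")
      \<comment> \<open>Without variables the only saturated ideal is the whole ring, with Hilbert
        polynomial 0, so there is nothing to find. The algorithm agrees: it demands k > 0 removals,
        but no term has the positive degree s.\<close>
      case l: False
      have "S l P = {}"
      proof (rule equals0I)
        fix A assume "A \<in> S l P"
        then have "A = terms_of l n" "has_hilbert_poly l n A P"
          using term_sat_trivial[of n l A] l by (auto simp: S_def)
        then obtain T where T: "\<And>t. T \<le> t \<Longrightarrow> poly P (of_nat t) = 0"
          by (auto simp: has_hilbert_poly_def hilbert_fun_terms_of eventually_sequentially)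
        show False
          using T[of "T + r"] gotzmann_poly_pos[OF less.prems(1) False, of "T + r"] by simp
      qed
      moreover have "(let I = genideal (polyring l n) (poly_of B :: 'k mpol set);
            q = poly P (of_nat s) - of_nat ((n + s - l) choose s) + of_nat (mpol_dim (component I s))
        in if q \<ge> 0 then p_Remove p I l n s (nat \<lfloor>q\<rfloor>) else {}) = {}" if "B \<in> S (Suc l) (backward_diff P)" for B
      proof -
        have "B = {0}"
          using that term_sat_trivial[of n "Suc l" B] terms_of_trivial[of n "Suc l"] l by (auto simp: S_def)
        moreover have "genideal (polyring l n) (poly_of {0} :: 'k mpol set) = poly_of (term_span l n {0})"
          by (rule genideal_poly_of) (auto simp: poly_of_def)
        ultimately have I: "genideal (polyring l n) (poly_of B :: 'k mpol set) = poly_of {0}"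
          using terms_of_trivial[of n l] l by (simp add: term_span_def)
        have "component (poly_of {0} :: 'k mpol set) s = poly_of {}"
          unfolding component_poly_of using assms(2) by (intro arg_cong[where f = poly_of]) auto
        then have dim: "mpol_dim (component (poly_of {0} :: 'k mpol set) s) = 0"
          by (simp only: dim_poly_of card.empty)
        have choose: "(n + s - l) choose s = 0"
          using l assms(2) by (intro binomial_eq_0) auto
        have empty: "removable_terms p (poly_of {0} :: 'k mpol set) l n s = {}"
          by (auto simp: removable_terms_def component_poly_of)
        obtain k' where k': "k = Suc k'"
          using \<open>0 < k\<close> by (cases k) auto
        have "nat \<lfloor>rat_of_nat k - of_nat 0 + of_nat 0\<rfloor> = Suc k'"
          unfolding k' by (simp del: of_nat_Suc)
        then show ?thesis
          unfolding I Let_def dim choose k by (simp only: p_Remove.simps empty UN_empty if_cancel)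
      qed
      ultimately show ?thesis
        unfolding target rec by simp
    next
      case l: True
      \<comment> \<open>Counting terms turns q into k minus the Hilbert function of the extension in
        degree s, an integer, so the floor loses nothing.\<close>
      have step: "(let I = genideal (polyring l n) (poly_of B :: 'k mpol set);
            q = poly P (of_nat s) - of_nat ((n + s - l) choose s) + of_nat (mpol_dim (component I s))
        in if q \<ge> 0 then p_Remove p I l n s (nat \<lfloor>q\<rfloor>) else {})
        = (if hilbert_fun l n (term_ext l n B) s \<le> k
           then p_Remove p (poly_of (term_ext l n B)) l n s (k - hilbert_fun l n (term_ext l n B) s) else {})"
        if "B \<in> S (Suc l) (backward_diff P)" for B
      proof -
        let ?A = "term_ext l n B"
        have B: "term_ideal (Suc l) n B"
          using that by (simp add: S_def)
        have "card {\<alpha> \<in> ?A. tdeg \<alpha> = s} + hilbert_fun l n ?A s = (n + s - l) choose s"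
          by (rule card_degree_component[OF term_ideal_subset[OF term_ideal_ext[OF B]] l])
        then have q: "poly P (of_nat s) - of_nat ((n + s - l) choose s)
              + of_nat (mpol_dim (component (poly_of ?A :: 'k mpol set) s))
            = of_int (int k - int (hilbert_fun l n ?A s))"
          unfolding component_poly_of dim_poly_of k by (simp flip: of_nat_add)
        have "0 \<le> int k - int (hilbert_fun l n ?A s) \<longleftrightarrow> hilbert_fun l n ?A s \<le> k"
          "nat (int k - int (hilbert_fun l n ?A s)) = k - hilbert_fun l n ?A s"
          by arith+
        then show ?thesis
          unfolding genideal_ext[OF B l] Let_def q floor_of_int of_int_0_le_iff by (simp only:)
      qed
      have rec': "(Borel l n P s p :: 'k mpol set set) = (\<Union>B\<in>S (Suc l) (backward_diff P).
          if hilbert_fun l n (term_ext l n B) s \<le> k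
          then p_Remove p (poly_of (term_ext l n B)) l n s (k - hilbert_fun l n (term_ext l n B) s) else {})"
        unfolding rec by (rule SUP_cong[OF refl step])
      \<comment> \<open>From degree s on the Hilbert function of the extension has the same first
        difference as P, so it differs from P by a constant; the q removals make up exactly for that
        constant.\<close>
      have ext: "term_ideal l n (term_ext l n B)" "move_closed p l n (term_ext l n B)"
          "stably_generated n s (term_ext l n B)"
          "\<And>t. s \<le> t \<Longrightarrow> of_nat (hilbert_fun l n (term_ext l n B) t)
            = poly P (of_nat t) - of_nat k + of_nat (hilbert_fun l n (term_ext l n B) s)"
        if "B \<in> S (Suc l) (backward_diff P)" for B
      proof -
        have B: "term_ideal (Suc l) n B" "move_closed p (Suc l) n B" "term_sat (Suc l) n B = B"
            "has_hilbert_poly (Suc l) n B (backward_diff P)"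
          using that by (auto simp: S_def)
        show A: "term_ideal l n (term_ext l n B)" "move_closed p l n (term_ext l n B)"
          using term_ideal_ext[OF B(1)] move_closed_ext[OF B(1,2)] by auto
        have "stably_generated n s B"
          using stably_generated_mono[OF hilbert_poly_regularity(1)[OF B(1,2) p B(3,4) r'(2)]] r'(1) less.prems(2)
          by simp
        then show "stably_generated n s (term_ext l n B)"
          using stably_generated_of_slice[OF A p term_sat_ext[OF B(1,2) p l] l] term_slice_ext[OF B(1)] by simp
        show "of_nat (hilbert_fun l n (term_ext l n B) t)
            = poly P (of_nat t) - of_nat k + of_nat (hilbert_fun l n (term_ext l n B) s)" if "s \<le> t" for t
          using that
        proof (induction t rule: dec_induct)
          case (step t)
          have "of_nat (hilbert_fun (Suc l) n B (Suc t)) = poly (backward_diff P) (of_nat (Suc t))"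
            using step(1) r'(1) less.prems(2) by (intro hilbert_poly_regularity(2)[OF B(1,2) p B(3,4) r'(2)]) simp
          then have "of_nat (hilbert_fun (Suc l) n B (Suc t)) = poly P (of_nat (Suc t)) - poly P (of_nat t)"
            unfolding poly_backward_diff_Suc .
          moreover have "hilbert_fun l n (term_ext l n B) (Suc t)
              = hilbert_fun l n (term_ext l n B) t + hilbert_fun (Suc l) n B (Suc t)"
            by (simp add: hilbert_fun_ext[OF l])
          ultimately show ?case
            using step.IH by simp
        qed (simp add: k)
      qed
      have "I \<in> poly_of ` S l P" if I: "I \<in> Borel l n P s p" for I :: "'k mpol set"
      proof -
        obtain B where B: "B \<in> S (Suc l) (backward_diff P)" "hilbert_fun l n (term_ext l n B) s \<le> k"
            "I \<in> p_Remove p (poly_of (term_ext l n B)) l n s (k - hilbert_fun l n (term_ext l n B) s)"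
          using I unfolding rec' by (auto split: if_splits)
        obtain A' where A': "I = poly_of (term_sat l n A')" "term_ideal l n A'" "move_closed p l n A'"
            "\<forall>t\<ge>s. hilbert_fun l n A' t
              = hilbert_fun l n (term_ext l n B) t + (k - hilbert_fun l n (term_ext l n B) s)"
          using p_Remove_sound[OF ext(1-3)[OF B(1)] l B(3)] by blast
        have "of_nat (hilbert_fun l n A' t) = poly P (of_nat t)" if "s \<le> t" for t
          using A'(4) ext(4)[OF B(1) that] B(2) that by (simp add: of_nat_diff)
        then have "has_hilbert_poly l n A' P"
          by (auto simp: has_hilbert_poly_def eventually_sequentially)
        then have "term_sat l n A' \<in> S l P"
          using has_hilbert_poly_sat[OF A'(2,3) p] term_ideal_sat[OF A'(2)]
            move_closed_sat[OF A'(2,3) p] term_sat_idem[OF A'(2,3) p]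
          by (simp add: S_def)
        then show ?thesis
          unfolding A'(1) by blast
      qed
      moreover have "(poly_of C :: 'k mpol set) \<in> Borel l n P s p" if "C \<in> S l P" for C
      proof -
        have C: "term_ideal l n C" "move_closed p l n C" "term_sat l n C = C" "has_hilbert_poly l n C P"
          using that by (auto simp: S_def)
        \<comment> \<open>The ideal in the larger variables from which C is reached: restrict C,
          then saturate there.\<close>
        define C' where "C' = term_slice l C"
        define B where "B = term_sat (Suc l) n C'"
        have C': "term_ideal (Suc l) n C'" "move_closed p (Suc l) n C'"
          unfolding C'_def by (rule term_ideal_slice[OF C(1)] move_closed_slice[OF C(2)])+
        have "has_hilbert_poly (Suc l) n B (backward_diff P)"
          unfolding B_def using has_hilbert_poly_sat[OF C' p]
            has_hilbert_poly_slice[OF C(1,2) p C(3) l C(4), folded C'_def] by blast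
        then have B: "B \<in> S (Suc l) (backward_diff P)"
          unfolding S_def B_def
          using term_ideal_sat[OF C'(1)] move_closed_sat[OF C' p] term_sat_idem[OF C' p] by simp
        let ?A = "term_ext l n B"
        have stable: "stably_generated n s C"
          by (rule stably_generated_mono[OF hilbert_poly_regularity(1)[OF C(1,2) p C(3,4) less.prems(1)] less.prems(2)])
        have hC: "hilbert_fun l n C s = k"
          using hilbert_poly_regularity(2)[OF C(1,2) p C(3,4) less.prems] k by simp
        have CA: "C \<subseteq> ?A"
          using term_ext_mono[OF subset_term_sat[OF C'(1)], of l n] term_ext_slice[OF C(1,2) p C(3) l]
          by (simp add: B_def C'_def)
        have card: "k = hilbert_fun l n ?A s + card {\<alpha> \<in> ?A. tdeg \<alpha> = s \<and> \<alpha> \<notin> C}"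
          using hilbert_fun_add[OF term_ideal_subset[OF ext(1)[OF B]] CA, of s] hC by simp
        \<comment> \<open>The slice of C inherits stability and generation from degree s on, so in
          degree s it equals its saturation B. Hence only terms divisible by x_l separate C from the
          extension.\<close>
        have agree: "\<alpha> \<in> C" if \<alpha>: "tdeg \<alpha> = s" "\<alpha> \<in> ?A" "lookup \<alpha> l = 0" for \<alpha>
        proof -
          have "\<alpha> \<in> term_sat (Suc l) n C'"
            using \<alpha> by (simp add: term_ext_def drop_var_id B_def)
          \<comment> \<open>Without larger variables the slice could contain only the term 1, of
            degree 0, whereas s is positive.\<close>
          moreover have "Suc l \<le> n"
          proof (rule ccontr)
            assume "\<not> Suc l \<le> n"
            then have "\<alpha> = 0"
              using \<open>\<alpha> \<in> term_sat (Suc l) n C'\<close> terms_of_trivial[of n "Suc l"] by (auto simp: term_sat_def)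
            then show False
              using \<alpha>(1) assms(2) by simp
          qed
          ultimately have "\<alpha> \<in> C'"
            using stably_generated_sat[OF stably_generated_slice[OF stable C(1), folded C'_def] C' p, of \<alpha>] \<alpha>(1)
            by simp
          then show ?thesis
            by (simp add: C'_def term_slice_def)
        qed
        have "poly_of (term_sat l n C) \<in> p_Remove p (poly_of ?A :: 'k mpol set) l n s
            (card {\<alpha> \<in> ?A. tdeg \<alpha> = s \<and> \<alpha> \<notin> C})"
          using CA agree
          by (intro p_Remove_complete[OF C(1,2) stable l assms(2) ext(1-3)[OF B]]) auto
        then have "poly_of C \<in> (if hilbert_fun l n ?A s \<le> k
            then p_Remove p (poly_of ?A :: 'k mpol set) l n s (k - hilbert_fun l n ?A s) else {})"
          using card by (simp add: C(3))
        then show ?thesis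
          unfolding rec' using B by blast
      qed
      ultimately show ?thesis
        unfolding target by blast
    qed
  qed
qed

theorem theorem8p6:
  fixes l n s p r :: nat and P :: "rat poly"
  assumes "CHAR('k::field) = p"
    and "l < n"
    and "admissible TYPE('k) l n P"
    and "0 < s"
    and "is_gotzmann_number P r" and "r \<le> s"
  shows "Borel l n P s p =
    {I :: 'k mpol set. p_Borel p l n I \<and> saturated l n I \<and> hilbert_polynomial l n I P}"
  using assms(1,4-6) by (rule Borel_correct)

end
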